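(* Let $n\ge3$. Let $U\subset\mathcal S^{n\times n}$ be a convex open set and $F\in C^1(U)\cap C^0(\overline U)$ satisfy: (1) $O^{-1}UO=U$ for all $O\in O(n)$; (2) $M\in U$ and $N\in\mathcal S^{n\times n}_+$ imply $M+N\in U$; (3) $M\in U$ implies $aM\in U$ for all constants $a>0$; (4) $\{aI : a>0\}\cap\partial U=\emptyset$; (5) $F(O^{-1}MO)=F(M)$ for all $M\in U$, $O\in O(n)$; (6) the matrix $(F_{ij}(M))$ is positive definite for all $M\in U$, where $F_{ij}(M)=\frac{\partial F}{\partial M_{ij}}(M)$; (7) $F>0$ in $U$ and $F=0$ on $\partial U$. Assume that a positive function $u\in C^{1,1}(\mathbb R^n\setminus\{0\})$ satisfies $\Delta u\le0$ in $\mathbb R^n\setminus\{0\}$ in the distribution sense and $$F(A^u)=0,\ \text{ or equivalently } A^u\in\partial U,\ \text{ almost everywhere in }\mathbb R^n\setminus\{0\}.$$ Then $$u_{x,\lambda}(y)\le u(y)\qquad\text{for all } x\in\mathbb R^n\setminus\{0\},\ 0<\lambda<|x|,\ |y-x|\ge\lambda,\ y\ne0 ,$$ and, consequently, $u$ is radially symmetric about the origin.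
   Context: $\mathcal S^{n\times n}$ is the set of $n\times n$ real symmetric matrices, $\mathcal S^{n\times n}_+$ the subset of positive definite matrices, $O(n)$ the set of $n\times n$ real orthogonal matrices, $I$ the identity matrix. For a positive function $u$, at points where $u$ is twice differentiable, $$A^u=-\frac{2}{n-2}u^{-\frac{n+2}{n-2}}\nabla^2u+\frac{2n}{(n-2)^2}u^{-\frac{2n}{n-2}}\nabla u\otimes\nabla u-\frac{2}{(n-2)^2}u^{-\frac{2n}{n-2}}|\nabla u|^2I .$$ For an open set $O$, $C^{1,1}(O)$ denotes the $C^1$ functions on $O$ whose gradient is locally Lipschitz; for such $u$ the Hessian, hence $A^u$, exists almost everywhere. Kelvin transformation: for $x\in\mathbb R^n$, $\lambda>0$, $$u_{x,\lambda}(y):=\frac{\lambda^{n-2}}{|y-x|^{n-2}}\,u\!\left(x+\frac{\lambda^2(y-x)}{|y-x|^2}\right).$$ *)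

theory Defs
  imports "HOL-Analysis.Analysis"
begin

definition sym_mats :: "(real^'n^'n) set" where
  "sym_mats = {M. transpose M = M}"

definition pos_def :: "real^'n^'n \<Rightarrow> bool" where
  "pos_def M \<longleftrightarrow> M \<in> sym_mats \<and> (\<forall>v. v \<noteq> 0 \<longrightarrow> 0 < v \<bullet> (M *v v))"

text \<open>Openness and boundary of sets of symmetric matrices are taken in the space of
  symmetric matrices. That space is closed, so for the closure it makes no difference whether
  it is taken there or among all matrices.\<close>

abbreviation sym_open :: "(real^'n^'n) set \<Rightarrow> bool" where
  "sym_open U \<equiv> openin (top_of_set sym_mats) U"

abbreviation sym_frontier :: "(real^'n^'n) set \<Rightarrow> (real^'n^'n) set" where
  "sym_frontier U \<equiv> top_of_set sym_mats frontier_of U"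

text \<open>The matrix \<open>(F\<^sub>i\<^sub>j(M))\<close> of a function of symmetric matrices is the symmetric matrix with
  \<open>dF\<^sub>M(N) = (\<Sum>i j. F\<^sub>i\<^sub>j(M) N\<^sub>i\<^sub>j)\<close> for symmetric \<open>N\<close>; the double sum is the inner product
  of matrices. In particular \<open>F\<^sub>i\<^sub>j\<close> is not the derivative in the independent coordinate
  \<open>M\<^sub>i\<^sub>j = M\<^sub>j\<^sub>i\<close>, which for \<open>i \<noteq> j\<close> would be twice as large.\<close>

definition has_sym_gradient ::
    "(real^'n^'n \<Rightarrow> real) \<Rightarrow> real^'n^'n \<Rightarrow> real^'n^'n \<Rightarrow> bool" where
  "has_sym_gradient F M G \<longleftrightarrow>
     G \<in> sym_mats \<and> (F has_derivative (\<lambda>N. G \<bullet> N)) (at M within sym_mats)"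

definition sym_gradient :: "(real^'n^'n \<Rightarrow> real) \<Rightarrow> real^'n^'n \<Rightarrow> real^'n^'n" where
  "sym_gradient F M = (THE G. has_sym_gradient F M G)"

definition C1_on_sym :: "(real^'n^'n) set \<Rightarrow> (real^'n^'n \<Rightarrow> real) \<Rightarrow> bool" where
  "C1_on_sym U F \<longleftrightarrow>
     (\<forall>M\<in>U. \<exists>G. has_sym_gradient F M G) \<and> continuous_on U (sym_gradient F)"

lemma sym_gradient_eqI:
  assumes M: "M \<in> sym_mats" and G: "has_sym_gradient F M G"
  shows "sym_gradient F M = G"
  unfolding sym_gradient_def
proof (rule the_equality[where P = "has_sym_gradient F M", OF G])
  fix H assume H: "has_sym_gradient F M H"
  define N where "N = H - G"
  have lin: "(\<lambda>t. M + t *\<^sub>R N) ` UNIV \<subseteq> sym_mats"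
    using M G H unfolding N_def has_sym_gradient_def sym_mats_def
    by (auto simp: transpose_def vec_eq_iff)
  have dir: "((\<lambda>t. F (M + t *\<^sub>R N)) has_derivative (\<lambda>t. K \<bullet> (t *\<^sub>R N))) (at 0)"
    if "has_sym_gradient F M K" for K
  proof (rule has_derivative_in_compose[where f = "\<lambda>t. M + t *\<^sub>R N" and g = F])
    show "((\<lambda>t. M + t *\<^sub>R N) has_derivative (\<lambda>t. t *\<^sub>R N)) (at 0)"
      by (auto intro!: derivative_eq_intros)
    show "(F has_derivative (\<bullet>) K) (at (M + 0 *\<^sub>R N) within range (\<lambda>t. M + t *\<^sub>R N))"
      using that lin unfolding has_sym_gradient_def by (auto intro: has_derivative_subset)
  qed
  have "(\<lambda>t. H \<bullet> (t *\<^sub>R N)) = (\<lambda>t. G \<bullet> (t *\<^sub>R N))"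
    using dir[OF H] dir[OF G] by (rule has_derivative_unique)
  from fun_cong[OF this, of 1] have "N \<bullet> N = 0"
    by (simp add: N_def inner_diff_left)
  then show "H = G"
    by (simp add: N_def)
qed

definition partial_deriv :: "'n \<Rightarrow> (real^'n \<Rightarrow> real) \<Rightarrow> real^'n \<Rightarrow> real" where
  "partial_deriv i f x = frechet_derivative f (at x) (axis i 1)"

definition gradient :: "(real^'n \<Rightarrow> real) \<Rightarrow> real^'n \<Rightarrow> real^'n" where
  "gradient f x = (\<chi> i. partial_deriv i f x)"

definition hessian :: "(real^'n \<Rightarrow> real) \<Rightarrow> real^'n \<Rightarrow> real^'n^'n" where
  "hessian f x = jacobian (gradient f) (at x)"

definition laplacian :: "(real^'n \<Rightarrow> real) \<Rightarrow> real^'n \<Rightarrow> real" where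
  "laplacian f x = (\<Sum>i\<in>UNIV. partial_deriv i (partial_deriv i f) x)"

text \<open>The class \<open>C\<^sup>1\<^sup>,\<^sup>1\<close> on an open set is the local one.\<close>

definition C11_on :: "(real^'n) set \<Rightarrow> (real^'n \<Rightarrow> real) \<Rightarrow> bool" where
  "C11_on S u \<longleftrightarrow>
     (\<forall>x\<in>S. u differentiable (at x)) \<and>
     (\<forall>x\<in>S. \<exists>r>0. \<exists>L. L-lipschitz_on (ball x r \<inter> S) (gradient u))"

definition twice_differentiable_at :: "(real^'n \<Rightarrow> real) \<Rightarrow> real^'n \<Rightarrow> bool" where
  "twice_differentiable_at u x \<longleftrightarrow>
     (\<forall>\<^sub>F y in nhds x. u differentiable (at y)) \<and> gradient u differentiable (at x)"

primrec Ck :: "nat \<Rightarrow> (real^'n \<Rightarrow> real) \<Rightarrow> bool" where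
  "Ck 0 f \<longleftrightarrow> continuous_on UNIV f"
| "Ck (Suc k) f \<longleftrightarrow> (\<forall>x. f differentiable (at x)) \<and> (\<forall>i. Ck k (partial_deriv i f))"

definition test_function_on :: "(real^'n) set \<Rightarrow> (real^'n \<Rightarrow> real) \<Rightarrow> bool" where
  "test_function_on S \<phi> \<longleftrightarrow>
     (\<forall>k. Ck k \<phi>) \<and> compact (closure {x. \<phi> x \<noteq> 0}) \<and> closure {x. \<phi> x \<noteq> 0} \<subseteq> S"

definition laplacian_le_0_distr :: "(real^'n) set \<Rightarrow> (real^'n \<Rightarrow> real) \<Rightarrow> bool" where
  "laplacian_le_0_distr S u \<longleftrightarrow>
     (\<forall>\<phi>. test_function_on S \<phi> \<and> (\<forall>x. 0 \<le> \<phi> x) \<longrightarrow>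
        (LINT x:S|lborel. u x * laplacian \<phi> x) \<le> 0)"

definition outer_prod :: "real^'n \<Rightarrow> real^'n \<Rightarrow> real^'n^'n" where
  "outer_prod v w = (\<chi> i j. v $ i * w $ j)"

definition conf_hessian :: "(real^'n \<Rightarrow> real) \<Rightarrow> real^'n \<Rightarrow> real^'n^'n" where
  "conf_hessian u x =
     (let n = real CARD('n); p = u x; g = gradient u x in
        (- (2 / (n - 2)) * p powr (- ((n + 2) / (n - 2)))) *\<^sub>R hessian u x
      + (2 * n / (n - 2)\<^sup>2 * p powr (- (2 * n / (n - 2)))) *\<^sub>R outer_prod g g
      - (2 / (n - 2)\<^sup>2 * p powr (- (2 * n / (n - 2))) * (norm g)\<^sup>2) *\<^sub>R mat 1)"

definition kelvin :: "(real^'n \<Rightarrow> real) \<Rightarrow> real^'n \<Rightarrow> real \<Rightarrow> real^'n \<Rightarrow> real" where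
  "kelvin u x r y =
     r ^ (CARD('n) - 2) / norm (y - x) ^ (CARD('n) - 2)
       * u (x + (r\<^sup>2 / (norm (y - x))\<^sup>2) *\<^sub>R (y - x))"

end

theory Submission
  imports Defs
begin

text \<open>
  Write \<open>q = u powr (- 2 / (n - 2))\<close>. Then \<open>A\<^sup>u = q D\<^sup>2q - |Dq|\<^sup>2/2 I\<close>, the function
  \<open>W(y) = |y - x|\<^sup>2/r\<^sup>2 q(Ty)\<close>, with \<open>T\<close> the inversion in the sphere of centre \<open>x\<close> and radius \<open>r\<close>,
  corresponds to the Kelvin transform of \<open>u\<close>, and \<open>A\<close> is conjugated by a reflection when passing from \<open>q\<close> to \<open>W\<close>.
  So the claim is a weak comparison principle on the ball of radius \<open>r\<close> about \<open>x\<close>: two solutions that agree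
  on the sphere satisfy \<open>W \<le> q\<close> inside, although \<open>W\<close> is singular at \<open>x\<close> and \<open>T0\<close>; no moving of spheres
  is needed. Replace \<open>W\<close> by \<open>V = W + e (1 + |y - x|\<^sup>2/r\<^sup>2)\<close>, which moves \<open>A\<close> into the open cone by a fixed
  multiple of \<open>I\<close>, and let \<open>m\<close> be the infimum of \<open>q/V\<close>; if the claim fails, \<open>m < 1\<close> for small \<open>e\<close>.
  The infimum is not attained at a regular point, because near a touching point of \<open>C\<^sup>1\<^sup>,\<^sup>1\<close> functions the
  second order conditions hold approximately on a set of positive measure. Nor is it approached at a
  singular point \<open>s\<close>: the fixed gap allows \<open>q\<close> to be tilted by any small linear function vanishing at \<open>s\<close>,
  so \<open>m V \<le> q - p|y - s|\<close>; as \<open>W\<close> is subharmonic and bounded near \<open>s\<close>, the cone forces a gap at \<open>s\<close> itself.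

  Radial symmetry: for a unit vector \<open>a\<close>, \<open>x = a/t\<close> and \<open>r\<close> slightly below \<open>1/t\<close>, the inversions tend to
  the reflection in the hyperplane orthogonal to \<open>a\<close> as \<open>t\<close> tends to 0.
\<close>

section \<open>Pointwise Lipschitz gradients and touching points\<close>

text \<open>The bound is centred at the single point \<open>x\<close>. Differentiability at
  \<open>x\<close> already implies it, it passes to sums, products and compositions, and it still
  forces null sets to have null images.\<close>

definition lip_at :: "('a::real_normed_vector \<Rightarrow> 'b::real_normed_vector) \<Rightarrow> 'a \<Rightarrow> bool" where
  "lip_at g x \<longleftrightarrow> (\<exists>B. \<forall>\<^sub>F y in nhds x. norm (g y - g x) \<le> B * norm (y - x))"

lemma lip_atE:
  assumes "lip_at g x"
  obtains B where "B > 0" "\<forall>\<^sub>F y in nhds x. norm (g y - g x) \<le> B * norm (y - x)"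
proof -
  obtain B where B: "\<forall>\<^sub>F y in nhds x. norm (g y - g x) \<le> B * norm (y - x)"
    using assms unfolding lip_at_def by blast
  have "\<forall>\<^sub>F y in nhds x. norm (g y - g x) \<le> (\<bar>B\<bar> + 1) * norm (y - x)"
    using B by eventually_elim
      (smt (verit) mult_right_mono norm_ge_zero)
  then show thesis using that[of "\<bar>B\<bar> + 1"] by auto
qed

lemma lip_at_isCont:
  assumes "lip_at g x"
  shows "isCont g x"
proof -
  obtain B where B: "B > 0" "\<forall>\<^sub>F y in nhds x. norm (g y - g x) \<le> B * norm (y - x)"
    using assms by (rule lip_atE)
  have "((\<lambda>y. g y - g x) \<longlongrightarrow> 0) (nhds x)"
  proof (rule Lim_null_comparison[OF B(2)])
    have "((\<lambda>y. B * norm (y - x)) \<longlongrightarrow> B * norm (x - x)) (nhds x)"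
      by (intro tendsto_intros filterlim_ident)
    then show "((\<lambda>y. B * norm (y - x)) \<longlongrightarrow> 0) (nhds x)" by simp
  qed
  then have "((\<lambda>y. g y - g x) \<longlongrightarrow> 0) (at x)"
    by (rule tendsto_mono[rotated]) (simp add: at_within_def)
  then show ?thesis
    by (simp add: isCont_def LIM_zero_iff)
qed

lemma lip_at_differentiable:
  assumes "(g has_derivative g') (at x)"
  shows "lip_at g x"
proof -
  have bl: "bounded_linear g'" using assms by (rule has_derivative_bounded_linear)
  obtain d where d: "d > 0"
    "\<And>y. norm (y - x) < d \<Longrightarrow> norm (g y - g x - g' (y - x)) \<le> 1 * norm (y - x)"
    using assms unfolding has_derivative_at_alt by (meson zero_less_one)
  have "norm (g y - g x) \<le> (onorm g' + 1) * norm (y - x)" if "dist y x < d" for y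
  proof -
    have "norm (g y - g x) \<le> norm (g y - g x - g' (y - x)) + norm (g' (y - x))"
      using norm_triangle_ineq[of "g y - g x - g' (y - x)" "g' (y - x)"] by simp
    also have "\<dots> \<le> norm (y - x) + onorm g' * norm (y - x)"
      using d(2)[of y] onorm[OF bl, of "y - x"] that by (auto simp: dist_norm)
    finally show ?thesis by (simp add: algebra_simps)
  qed
  then show ?thesis
    unfolding lip_at_def eventually_nhds_metric using d(1) by blast
qed

lemma lip_at_const [simp]: "lip_at (\<lambda>_. c) x"
  unfolding lip_at_def by (rule exI[of _ 0]) simp

lemma lip_at_add:
  assumes "lip_at f x" "lip_at g x"
  shows "lip_at (\<lambda>y. f y + g y) x"
proof -
  obtain B where B: "\<forall>\<^sub>F y in nhds x. norm (f y - f x) \<le> B * norm (y - x)"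
    using assms(1) by (rule lip_atE)
  obtain C where C: "\<forall>\<^sub>F y in nhds x. norm (g y - g x) \<le> C * norm (y - x)"
    using assms(2) by (rule lip_atE)
  have "\<forall>\<^sub>F y in nhds x. norm (f y + g y - (f x + g x)) \<le> (B + C) * norm (y - x)"
    using B C
  proof eventually_elim
    case (elim y)
    have "norm (f y + g y - (f x + g x)) \<le> norm (f y - f x) + norm (g y - g x)"
      by (rule norm_diff_triangle_ineq)
    then show ?case using elim by (simp add: distrib_right)
  qed
  then show ?thesis unfolding lip_at_def by blast
qed

lemma (in bounded_bilinear) lip_at:
  assumes "lip_at f x" "lip_at g x"
  shows "lip_at (\<lambda>y. prod (f y) (g y)) x"
proof -
  obtain B where B: "B > 0" "\<forall>\<^sub>F y in nhds x. norm (f y - f x) \<le> B * norm (y - x)"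
    using assms(1) by (rule lip_atE)
  obtain C where C: "C > 0" "\<forall>\<^sub>F y in nhds x. norm (g y - g x) \<le> C * norm (y - x)"
    using assms(2) by (rule lip_atE)
  obtain K where K: "K > 0" "\<And>a b. norm (prod a b) \<le> norm a * norm b * K"
    using pos_bounded by blast
  have "isCont g x" by (rule lip_at_isCont[OF assms(2)])
  then have lim: "((\<lambda>y. norm (g y)) \<longlongrightarrow> norm (g x)) (nhds x)"
    by (simp add: continuous_at_imp_continuous_at_within isCont_def tendsto_norm tendsto_at_iff_tendsto_nhds)
  have bd: "\<forall>\<^sub>F y in nhds x. norm (g y) < norm (g x) + 1"
    by (rule order_tendstoD(2)[OF lim]) simp
  have "\<forall>\<^sub>F y in nhds x. norm (prod (f y) (g y) - prod (f x) (g x))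
      \<le> (B * (norm (g x) + 1) * K + norm (f x) * C * K) * norm (y - x)"
    using B(2) C(2) bd
  proof eventually_elim
    case (elim y)
    have eq: "prod (f y) (g y) - prod (f x) (g x)
        = prod (f y - f x) (g y) + prod (f x) (g y - g x)"
      by (simp add: diff_left diff_right)
    have "norm (prod (f y - f x) (g y)) \<le> norm (f y - f x) * norm (g y) * K" by (rule K)
    also have "\<dots> \<le> (B * norm (y - x)) * (norm (g x) + 1) * K"
      using elim K(1) B(1) by (intro mult_right_mono mult_mono) auto
    finally have 1: "norm (prod (f y - f x) (g y)) \<le> (B * norm (y - x)) * (norm (g x) + 1) * K" .
    have "norm (prod (f x) (g y - g x)) \<le> norm (f x) * norm (g y - g x) * K" by (rule K)
    also have "\<dots> \<le> norm (f x) * (C * norm (y - x)) * K"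
      using elim K(1) by (intro mult_right_mono mult_left_mono) auto
    finally have 2: "norm (prod (f x) (g y - g x)) \<le> norm (f x) * (C * norm (y - x)) * K" .
    have "norm (prod (f y) (g y) - prod (f x) (g x))
        \<le> norm (prod (f y - f x) (g y)) + norm (prod (f x) (g y - g x))"
      unfolding eq by (rule norm_triangle_ineq)
    with 1 2 show ?case by (simp add: algebra_simps)
  qed
  then show ?thesis unfolding lip_at_def by blast
qed

lemma lip_at_scaleR_const: "lip_at g x \<Longrightarrow> lip_at (\<lambda>y. a *\<^sub>R g y) x"
  by (rule bounded_bilinear.lip_at[OF bounded_bilinear_scaleR]) simp_all

lemma lip_at_compose:
  assumes "lip_at g (T x)" "lip_at T x"
  shows "lip_at (\<lambda>y. g (T y)) x"
proof -
  obtain B where B: "B > 0" "\<forall>\<^sub>F y in nhds (T x). norm (g y - g (T x)) \<le> B * norm (y - T x)"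
    using assms(1) by (rule lip_atE)
  obtain C where C: "C > 0" "\<forall>\<^sub>F y in nhds x. norm (T y - T x) \<le> C * norm (y - x)"
    using assms(2) by (rule lip_atE)
  have "filterlim T (nhds (T x)) (nhds x)"
    using lip_at_isCont[OF assms(2)] by (simp add: isCont_def tendsto_at_iff_tendsto_nhds)
  then have "\<forall>\<^sub>F y in nhds x. norm (g (T y) - g (T x)) \<le> B * norm (T y - T x)"
    by (rule eventually_compose_filterlim[OF B(2)])
  then have "\<forall>\<^sub>F y in nhds x. norm (g (T y) - g (T x)) \<le> (B * C) * norm (y - x)"
    using C(2)
  proof eventually_elim
    case (elim y)
    have "B * norm (T y - T x) \<le> B * (C * norm (y - x))"
      using elim B(1) by (intro mult_left_mono) auto
    with elim show ?case by (simp add: mult.assoc)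
  qed
  then show ?thesis unfolding lip_at_def by blast
qed

lemma negligible_lip_at_image:
  fixes g :: "'a::euclidean_space \<Rightarrow> 'a"
  assumes "negligible S" "\<And>x. x \<in> S \<Longrightarrow> lip_at g x"
  shows "negligible (g ` S)"
proof (rule negligible_locally_Lipschitz_image[OF order_refl assms(1)])
  fix x assume "x \<in> S"
  then obtain B where "\<forall>\<^sub>F y in nhds x. norm (g y - g x) \<le> B * norm (y - x)"
    using assms(2) unfolding lip_at_def by blast
  then show "\<exists>T B. open T \<and> x \<in> T \<and> (\<forall>y\<in>S \<inter> T. norm (g y - g x) \<le> B * norm (y - x))"
    unfolding eventually_nhds by blast
qed

text \<open>Along the line through \<open>x\<close> in direction \<open>h\<close>, subtracting the
  tangent and adding the paraboloid gives a function with a minimum at 0. Were its second derivative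
  negative, the first derivative would be negative just to the right of 0, against the mean value
  theorem.\<close>

lemma second_derivative_ge:
  fixes f :: "'a::euclidean_space \<Rightarrow> real"
  assumes df: "\<forall>\<^sub>F y in nhds x. (f has_derivative (\<lambda>h. g y \<bullet> h)) (at y)"
    and dg: "(g has_derivative H) (at x)"
    and lb: "\<forall>\<^sub>F y in nhds x. f x + g x \<bullet> (y - x) - c * (norm (y - x))\<^sup>2 \<le> f y"
  shows "- (2 * c) * (norm h)\<^sup>2 \<le> h \<bullet> H h"
proof (rule ccontr)
  assume neg: "\<not> ?thesis"
  define k where "k = (\<lambda>t. f (x + t *\<^sub>R h) - t * (g x \<bullet> h) + c * t\<^sup>2 * (norm h)\<^sup>2)"
  define k' where "k' = (\<lambda>t. (g (x + t *\<^sub>R h) - g x) \<bullet> h + 2 * c * t * (norm h)\<^sup>2)"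
  have lim: "filterlim (\<lambda>t::real. x + t *\<^sub>R h) (nhds x) (nhds 0)"
  proof -
    have "((\<lambda>t::real. x + t *\<^sub>R h) \<longlongrightarrow> x + 0 *\<^sub>R h) (nhds 0)"
      by (intro tendsto_intros filterlim_ident)
    then show ?thesis by simp
  qed
  have "\<forall>\<^sub>F t in nhds 0. (f has_derivative (\<lambda>v. g (x + t *\<^sub>R h) \<bullet> v)) (at (x + t *\<^sub>R h))"
    by (rule eventually_compose_filterlim[OF df lim])
  then have "\<forall>\<^sub>F t in nhds 0. (k has_real_derivative k' t) (at t)"
  proof eventually_elim
    case (elim t)
    have "((\<lambda>t. f (x + t *\<^sub>R h)) has_derivative (\<lambda>s. g (x + t *\<^sub>R h) \<bullet> (s *\<^sub>R h))) (at t)"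
      by (rule has_derivative_compose[where f = "\<lambda>t. x + t *\<^sub>R h", OF _ elim])
        (auto intro!: derivative_eq_intros)
    then have "((\<lambda>t. f (x + t *\<^sub>R h)) has_real_derivative (g (x + t *\<^sub>R h) \<bullet> h)) (at t)"
      by (simp add: has_field_derivative_def mult_commute_abs)
    then show ?case
      unfolding k_def k'_def
      by (auto intro!: derivative_eq_intros simp: inner_diff_left)
  qed
  then obtain d1 where d1: "d1 > 0" "\<And>t. \<bar>t\<bar> < d1 \<Longrightarrow> (k has_real_derivative k' t) (at t)"
    unfolding eventually_nhds_metric by (auto simp: dist_norm)
  have "(k' has_derivative (\<lambda>s. H (s *\<^sub>R h) \<bullet> h + 2 * c * s * (norm h)\<^sup>2)) (at 0)"
  proof -
    have "((\<lambda>t. g (x + t *\<^sub>R h)) has_derivative (\<lambda>s. H (s *\<^sub>R h))) (at 0)"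
      by (rule has_derivative_compose[where f = "\<lambda>t. x + t *\<^sub>R h"])
        (use dg in \<open>auto intro!: derivative_eq_intros\<close>)
    then show ?thesis unfolding k'_def
      by (auto intro!: derivative_eq_intros)
  qed
  moreover have "H (s *\<^sub>R h) = s *\<^sub>R H h" for s
    using has_derivative_linear[OF dg] by (simp add: linear_cmul)
  ultimately have "(k' has_real_derivative (h \<bullet> H h + 2 * c * (norm h)\<^sup>2)) (at 0)"
    unfolding has_field_derivative_def
    by (auto elim!: has_derivative_eq_rhs simp: fun_eq_iff inner_commute algebra_simps)
  from DERIV_neg_dec_right[OF this] neg
  obtain d2 where d2: "d2 > 0" "\<And>t. 0 < t \<Longrightarrow> t < d2 \<Longrightarrow> k' t < k' 0"
    by auto
  have "\<forall>\<^sub>F t in nhds 0. f x + g x \<bullet> (x + t *\<^sub>R h - x) - c * (norm (x + t *\<^sub>R h - x))\<^sup>2 \<le> f (x + t *\<^sub>R h)"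
    by (rule eventually_compose_filterlim[OF lb lim])
  then obtain d3 where d3: "d3 > 0" "\<And>t. \<bar>t\<bar> < d3 \<Longrightarrow> k 0 \<le> k t"
    unfolding eventually_nhds_metric k_def
    by (auto simp: dist_norm power_mult_distrib algebra_simps)
  define t where "t = min d1 (min d2 d3) / 2"
  have t: "0 < t" "t < d1" "t < d2" "t < d3" using d1 d2 d3 unfolding t_def by auto
  have "\<exists>z. z > 0 \<and> z < t \<and> k t - k 0 = (t - 0) * k' z"
    by (rule MVT2[OF t(1)]) (use d1 t in auto)
  then obtain z where z: "0 < z" "z < t" "k t - k 0 = t * k' z" by auto
  have "k' z < 0" using d2(2)[of z] z t by (simp add: k'_def)
  then have "k t < k 0" using z t by (smt (verit) mult_pos_neg)
  with d3(2)[of t] t show False by simp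
qed

text \<open>The gradients of the tilted functions fill a ball, so by the Lipschitz property the
  points where a paraboloid touches from below cannot lie in a null set.\<close>

lemma near_minimum_off_negligible:
  fixes f :: "'a::euclidean_space \<Rightarrow> real"
  assumes "open D"
    and df: "\<And>y. y \<in> D \<Longrightarrow> (f has_derivative (\<lambda>h. g y \<bullet> h)) (at y)"
    and lip: "\<And>y. y \<in> D \<Longrightarrow> lip_at g y"
    and x: "x \<in> D" and min: "\<And>y. y \<in> D \<Longrightarrow> f x \<le> f y"
    and N: "negligible N" and e: "e > 0"
  shows "\<exists>y\<in>D - N. dist y x < e \<and> norm (g y) < e \<and>
           (\<forall>H h. (g has_derivative H) (at y) \<longrightarrow> - e * (norm h)\<^sup>2 \<le> h \<bullet> H h)"
proof -
  \<comment> \<open>\<open>c <= 1/6\<close> keeps the gradient \<open>p - 2c(y - x)\<close> within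
    \<open>3cr <= r/2\<close>; \<open>c <= e/2\<close> turns the second order bound
    \<open>-2c\<close> into \<open>-e\<close>.\<close>
  define c where "c = min (e / 2) (1 / 6)"
  have c: "c > 0" "2 * c \<le> e" "c \<le> 1 / 6" using e unfolding c_def by auto
  obtain r0 where r0: "r0 > 0" "cball x r0 \<subseteq> D"
    using \<open>open D\<close> x open_contains_cball by blast
  define r where "r = min r0 (e / 2)"
  have r: "r > 0" "cball x r \<subseteq> D" "r < e" using r0 e unfolding r_def by auto
  \<comment> \<open>\<open>G\<close> is the gradient of \<open>f + c|y - x|^2\<close>, so
    \<open>G y = p\<close> at interior critical points of that function tilted by \<open>p\<close>.
    \<open>C\<close> collects the points where a downward paraboloid touches \<open>f\<close> from
    below and the gradient is small.\<close>
  define G where "G = (\<lambda>y. g y + (2 * c) *\<^sub>R (y - x))"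
  define C where "C = {y \<in> ball x r. norm (g y) < e \<and>
      (\<forall>z\<in>ball x r. f y + g y \<bullet> (z - y) - c * (norm (z - y))\<^sup>2 \<le> f z)}"
  have fc: "continuous_on (cball x r) f"
    by (intro continuous_at_imp_continuous_on ballI has_derivative_continuous[OF df])
       (use r in auto)
  have sub: "ball 0 (c * r) \<subseteq> G ` C"
  proof
    fix p :: 'a assume p: "p \<in> ball 0 (c * r)"
    define k where "k = (\<lambda>y. f y + c * ((y - x) \<bullet> (y - x)) - p \<bullet> (y - x))"
    have "continuous_on (cball x r) k" unfolding k_def
      by (intro continuous_intros fc)
    then obtain y where y: "y \<in> cball x r" "\<And>z. z \<in> cball x r \<Longrightarrow> k y \<le> k z"
      using continuous_attains_inf[of "cball x r" k] r(1) by auto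
    \<comment> \<open>On the sphere the term \<open>c r^2\<close> exceeds the tilt, as
      \<open>norm p < c r\<close>, so \<open>k\<close> is larger there than at
      \<open>x\<close>.\<close>
    have yin: "y \<in> ball x r"
    proof (rule ccontr)
      assume "y \<notin> ball x r"
      then have ny: "norm (y - x) = r" using y(1) by (auto simp: dist_norm norm_minus_commute)
      have "p \<bullet> (y - x) \<le> norm p * r" using norm_cauchy_schwarz[of p "y - x"] ny by simp
      also have "\<dots> < c * r * r" using p r(1) by simp
      finally have "f y < k y" unfolding k_def using ny
        by (simp add: power2_norm_eq_inner[symmetric] power2_eq_square)
      moreover have "k y \<le> k x" using y r by simp
      moreover have "k x = f x" by (simp add: k_def)
      moreover have "f x \<le> f y" using min y r by auto
      ultimately show False by simp
    qed
    have yD: "y \<in> D" using y r by auto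
    have dk: "(k has_derivative (\<lambda>h. (G y - p) \<bullet> h)) (at y)"
      unfolding k_def G_def using df[OF yD]
      by (auto intro!: derivative_eq_intros simp: fun_eq_iff inner_add_left inner_diff_left inner_commute algebra_simps)
    have "(\<lambda>h. (G y - p) \<bullet> h) = (\<lambda>h. 0)"
      by (rule differential_zero_maxmin[OF yin _ dk]) (use y in auto)
    then have Gy: "G y = p" by (metis eq_iff_diff_eq_0 inner_eq_zero_iff)
    have gy: "g y = p - (2 * c) *\<^sub>R (y - x)" using Gy unfolding G_def by (metis add_diff_cancel_right')
    have "norm (g y) \<le> norm p + 2 * c * norm (y - x)" unfolding gy
      using norm_triangle_ineq4[of p "(2 * c) *\<^sub>R (y - x)"] c by simp
    also have "\<dots> \<le> c * r + 2 * c * r" using p yin c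
      by (intro add_mono mult_left_mono) (auto simp: dist_norm norm_minus_commute)
    also have "\<dots> \<le> r / 2" using c(3) r(1) by (simp add: field_simps)
    finally have ng: "norm (g y) < e" using r by simp
    have "f y + g y \<bullet> (z - y) - c * (norm (z - y))\<^sup>2 \<le> f z" if "z \<in> ball x r" for z
    proof -
      define v w where "v = y - x" and "w = z - y"
      have zx: "z - x = w + v" by (simp add: v_def w_def)
      have "k y \<le> k z" using y that by auto
      then have "f y + c * (v \<bullet> v) - p \<bullet> v \<le> f z + c * ((w + v) \<bullet> (w + v)) - p \<bullet> (w + v)"
        unfolding k_def zx by (simp add: v_def)
      moreover have "(w + v) \<bullet> (w + v) = w \<bullet> w + 2 * (v \<bullet> w) + v \<bullet> v"
        by (simp add: inner_add_left inner_add_right inner_commute)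
      moreover have "p \<bullet> (w + v) = p \<bullet> w + p \<bullet> v" by (rule inner_add_right)
      moreover have "g y \<bullet> w = p \<bullet> w - 2 * c * (v \<bullet> w)"
        unfolding gy v_def by (simp add: inner_diff_left)
      ultimately show ?thesis
        unfolding w_def[symmetric] power2_norm_eq_inner by (simp add: distrib_left)
    qed
    then have "y \<in> C" unfolding C_def using yin ng by auto
    then show "p \<in> G ` C" using Gy by blast
  qed
  \<comment> \<open>If \<open>C\<close> were null, so would be its image under \<open>G\<close>, but
    that image contains a ball.\<close>
  have "\<not> C \<subseteq> N"
  proof
    assume "C \<subseteq> N"
    then have "negligible C" using N negligible_subset by blast
    moreover have "lip_at G y" if "y \<in> C" for y
      unfolding G_def
    proof (rule lip_at_add)
      show "lip_at g y" using that r unfolding C_def by (auto intro!: lip)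
      show "lip_at (\<lambda>y. (2 * c) *\<^sub>R (y - x)) y"
        by (rule lip_at_differentiable) (auto intro!: derivative_eq_intros)
    qed
    ultimately have "negligible (G ` C)" by (rule negligible_lip_at_image)
    then have "negligible (ball (0::'a) (c * r))" using sub negligible_subset by blast
    then show False using c r open_not_negligible[of "ball (0::'a) (c * r)"] by (simp add: not_le)
  qed
  then obtain y where y: "y \<in> C" "y \<notin> N" by blast
  have yb: "y \<in> ball x r" using y unfolding C_def by auto
  have "- e * (norm h)\<^sup>2 \<le> h \<bullet> H h" if H: "(g has_derivative H) (at y)" for H h
  proof -
    have ev: "\<forall>\<^sub>F z in nhds y. z \<in> ball x r" using yb by (intro eventually_nhds_in_open) auto
    have "- (2 * c) * (norm h)\<^sup>2 \<le> h \<bullet> H h"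
    proof (rule second_derivative_ge[OF _ H])
      show "\<forall>\<^sub>F z in nhds y. (f has_derivative (\<lambda>h. g z \<bullet> h)) (at z)"
        using ev by eventually_elim (use r in \<open>auto intro!: df\<close>)
      show "\<forall>\<^sub>F z in nhds y. f y + g y \<bullet> (z - y) - c * (norm (z - y))\<^sup>2 \<le> f z"
        using ev by eventually_elim (use y in \<open>auto simp: C_def\<close>)
    qed
    moreover have "2 * c * (norm h)\<^sup>2 \<le> e * (norm h)\<^sup>2" using c by (intro mult_right_mono) auto
    ultimately show ?thesis by simp
  qed
  then show ?thesis using y yb r unfolding C_def
    by (intro bexI[of _ y]) (auto simp: dist_commute)
qed

section \<open>Superharmonic functions on punctured balls\<close>

text \<open>Gradient and Hessian are arguments rather than operators applied to \<open>f\<close>, so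
  that the closure rules below produce explicit formulas for them. Symmetry of the Hessian comes
  later from the cone, not from this predicate.\<close>

definition hess_on :: "(real^'n) set \<Rightarrow> (real^'n) set \<Rightarrow> (real^'n \<Rightarrow> real) \<Rightarrow>
    (real^'n \<Rightarrow> real^'n) \<Rightarrow> (real^'n \<Rightarrow> real^'n^'n) \<Rightarrow> bool" where
  "hess_on D N f g H \<longleftrightarrow> open D \<and>
     (\<forall>y\<in>D. (f has_derivative (\<lambda>h. g y \<bullet> h)) (at y)) \<and>
     (\<forall>y\<in>D. lip_at g y) \<and>
     (\<forall>y\<in>D - N. (g has_derivative (\<lambda>h. H y *v h)) (at y))"

lemma hess_onD:
  assumes "hess_on D N f g H"
  shows "open D" "y \<in> D \<Longrightarrow> (f has_derivative (\<lambda>h. g y \<bullet> h)) (at y)"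
    "y \<in> D \<Longrightarrow> lip_at g y"
    "y \<in> D \<Longrightarrow> y \<notin> N \<Longrightarrow> (g has_derivative (\<lambda>h. H y *v h)) (at y)"
  using assms unfolding hess_on_def by auto

lemma hess_on_isCont:
  assumes "hess_on D N f g H" "y \<in> D"
  shows "isCont f y" "isCont g y"
  using hess_onD[OF assms(1)] assms(2) has_derivative_continuous lip_at_isCont by blast+

lemma hess_on_subset:
  assumes "hess_on D N f g H" "open D'" "D' \<subseteq> D" "N \<subseteq> N'"
  shows "hess_on D' N' f g H"
  using assms unfolding hess_on_def by auto

lemma hess_on_linear_combination:
  fixes f1 :: "real^'n \<Rightarrow> real"
  assumes "hess_on D N f1 g1 H1" "hess_on D N f2 g2 H2"
  shows "hess_on D N (\<lambda>y. a * f1 y + b * f2 y) (\<lambda>y. a *\<^sub>R g1 y + b *\<^sub>R g2 y)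
    (\<lambda>y. a *\<^sub>R H1 y + b *\<^sub>R H2 y)"
  unfolding hess_on_def
proof (intro conjI ballI)
  note h1 = hess_onD[OF assms(1)] and h2 = hess_onD[OF assms(2)]
  show "open D" by (rule h1)
  fix y assume "y \<in> D"
  then show "((\<lambda>y. a * f1 y + b * f2 y) has_derivative (\<lambda>h. (a *\<^sub>R g1 y + b *\<^sub>R g2 y) \<bullet> h)) (at y)"
    using h1(2) h2(2) by (auto intro!: derivative_eq_intros simp: inner_add_left)
  show "lip_at (\<lambda>y. a *\<^sub>R g1 y + b *\<^sub>R g2 y) y"
    using h1(3) h2(3) \<open>y \<in> D\<close> by (intro lip_at_add lip_at_scaleR_const) auto
next
  fix y assume y: "y \<in> D - N"
  have "(g1 has_derivative (\<lambda>h. H1 y *v h)) (at y)" "(g2 has_derivative (\<lambda>h. H2 y *v h)) (at y)"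
    using y hess_onD[OF assms(1)] hess_onD[OF assms(2)] by auto
  then show "((\<lambda>y. a *\<^sub>R g1 y + b *\<^sub>R g2 y) has_derivative
      (\<lambda>h. (a *\<^sub>R H1 y + b *\<^sub>R H2 y) *v h)) (at y)"
    by (auto intro!: derivative_eq_intros
        simp: matrix_vector_mult_add_rdistrib scaleR_matrix_vector_assoc[symmetric])
qed

lemma hess_on_scale:
  assumes "hess_on D N f g H"
  shows "hess_on D N (\<lambda>y. a * f y) (\<lambda>y. a *\<^sub>R g y) (\<lambda>y. a *\<^sub>R H y)"
  using hess_on_linear_combination[OF assms assms, of a 0] by simp

lemma hess_on_affine:
  assumes "open D"
  shows "hess_on D N (\<lambda>y. b + p \<bullet> (y - s)) (\<lambda>_. p) (\<lambda>_. 0)"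
  unfolding hess_on_def using assms
  by (auto intro!: derivative_eq_intros)

lemma hess_on_quadratic:
  fixes c :: "real^'n"
  assumes "open D"
  shows "hess_on D N (\<lambda>y. b + d * (norm (y - c))\<^sup>2) (\<lambda>y. (2 * d) *\<^sub>R (y - c)) (\<lambda>_. (2 * d) *\<^sub>R mat 1)"
  unfolding hess_on_def power2_norm_eq_inner
proof (intro conjI ballI)
  have *: "((\<lambda>y. (2 * d) *\<^sub>R (y - c)) has_derivative (\<lambda>h. ((2 * d) *\<^sub>R mat 1) *v h)) (at y)" for y
    by (auto intro!: derivative_eq_intros simp: scaleR_matrix_vector_assoc[symmetric])
  show "lip_at (\<lambda>y. (2 * d) *\<^sub>R (y - c)) y" for y
    by (rule lip_at_differentiable[OF *])
  show "((\<lambda>y. (2 * d) *\<^sub>R (y - c)) has_derivative (\<lambda>h. ((2 * d) *\<^sub>R mat 1) *v h)) (at y)" for y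
    by (rule *)
qed (use assms in \<open>auto intro!: derivative_eq_intros simp: inner_commute fun_eq_iff\<close>)

lemma outer_prod_mult_vec: "outer_prod v w *v h = (w \<bullet> h) *\<^sub>R v"
  by (simp add: outer_prod_def vec_eq_iff matrix_vector_mult_def inner_vec_def sum_distrib_left
      mult.assoc mult.commute mult.left_commute)

lemma hess_on_compose:
  assumes f: "hess_on D N f g H"
    and d1: "\<And>y. y \<in> D \<Longrightarrow> (k has_real_derivative k1 (f y)) (at (f y))"
    and d2: "\<And>y. y \<in> D \<Longrightarrow> (k1 has_real_derivative k2 (f y)) (at (f y))"
  shows "hess_on D N (\<lambda>y. k (f y)) (\<lambda>y. k1 (f y) *\<^sub>R g y)
    (\<lambda>y. k1 (f y) *\<^sub>R H y + k2 (f y) *\<^sub>R outer_prod (g y) (g y))"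
  unfolding hess_on_def
proof (intro conjI ballI)
  note h = hess_onD[OF f]
  have d1': "((\<lambda>y. k1 (f y)) has_derivative (\<lambda>v. k2 (f y) * (g y \<bullet> v))) (at y)" if "y \<in> D" for y
    using has_derivative_compose[OF h(2)[OF that] d2[OF that, unfolded has_field_derivative_def]] .
  show "open D" by (rule h)
  fix y assume y: "y \<in> D"
  show "((\<lambda>y. k (f y)) has_derivative (\<lambda>v. (k1 (f y) *\<^sub>R g y) \<bullet> v)) (at y)"
    using has_derivative_compose[OF h(2)[OF y] d1[OF y, unfolded has_field_derivative_def]] by simp
  show "lip_at (\<lambda>y. k1 (f y) *\<^sub>R g y) y"
    by (intro bounded_bilinear.lip_at[OF bounded_bilinear_scaleR] h(3)[OF y]
        lip_at_differentiable[OF d1'[OF y]])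
next
  note h = hess_onD[OF f]
  fix y assume y: "y \<in> D - N"
  have d1': "((\<lambda>y. k1 (f y)) has_derivative (\<lambda>v. k2 (f y) * (g y \<bullet> v))) (at y)"
    using has_derivative_compose[OF h(2) d2[unfolded has_field_derivative_def]] y by auto
  show "((\<lambda>y. k1 (f y) *\<^sub>R g y) has_derivative
      (\<lambda>v. (k1 (f y) *\<^sub>R H y + k2 (f y) *\<^sub>R outer_prod (g y) (g y)) *v v)) (at y)"
    by (rule has_derivative_eq_rhs[OF has_derivative_scaleR[OF d1' h(4)]])
      (use y in \<open>auto simp: matrix_vector_mult_add_rdistrib scaleR_matrix_vector_assoc[symmetric]
        outer_prod_mult_vec fun_eq_iff\<close>)
qed

section \<open>Traces and the logarithmic barrier\<close>

lemma trace_outer_prod: "trace (outer_prod v w) = v \<bullet> w"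
  by (simp add: trace_def outer_prod_def inner_vec_def)

lemma trace_scaleR: "trace (a *\<^sub>R A) = a * trace (A :: real^'n^'n)"
  by (simp add: trace_def sum_distrib_left)

lemma axis_inner_matrix: "axis i 1 \<bullet> ((A :: real^'n^'n) *v axis i 1) = A $ i $ i"
  by (simp add: inner_axis' matrix_vector_mult_basis column_def)

text \<open>For n >= 3 the Laplacian of \<open>ln |y - s|^2\<close> is strictly positive.
  Subtracting a small multiple therefore gives strict superharmonicity together with a pole going to
  plus infinity at \<open>s\<close>.\<close>

lemma hess_on_ln_norm:
  fixes s :: "real^'n"
  assumes "open D" "s \<notin> D"
  shows "\<exists>H. hess_on D N (\<lambda>y. ln ((norm (y - s))\<^sup>2)) (\<lambda>y. (2 / (norm (y - s))\<^sup>2) *\<^sub>R (y - s)) H \<and>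
    (\<forall>y\<in>D. trace (H y) = 2 * (real CARD('n) - 2) / (norm (y - s))\<^sup>2)"
proof -
  have ne: "(norm (y - s))\<^sup>2 > 0" if "y \<in> D" for y using that assms by auto
  let ?H = "\<lambda>y. (1 / (norm (y - s))\<^sup>2) *\<^sub>R ((2 * 1) *\<^sub>R mat 1) +
      (- 1 / ((norm (y - s))\<^sup>2)\<^sup>2) *\<^sub>R outer_prod ((2 * 1) *\<^sub>R (y - s)) ((2 * 1) *\<^sub>R (y - s)) :: real^'n^'n"
  have "hess_on D N (\<lambda>y. ln (0 + 1 * (norm (y - s))\<^sup>2))
      (\<lambda>y. (1 / (0 + 1 * (norm (y - s))\<^sup>2)) *\<^sub>R ((2 * 1) *\<^sub>R (y - s)))
      (\<lambda>y. (1 / (0 + 1 * (norm (y - s))\<^sup>2)) *\<^sub>R ((2 * 1) *\<^sub>R mat 1) +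
        (- 1 / (0 + 1 * (norm (y - s))\<^sup>2)\<^sup>2) *\<^sub>R outer_prod ((2 * 1) *\<^sub>R (y - s)) ((2 * 1) *\<^sub>R (y - s)))"
    by (rule hess_on_compose[OF hess_on_quadratic[OF assms(1)]])
      (use ne in \<open>force intro!: derivative_eq_intros simp: power2_eq_square field_simps\<close>)+
  then have "hess_on D N (\<lambda>y. ln ((norm (y - s))\<^sup>2)) (\<lambda>y. (2 / (norm (y - s))\<^sup>2) *\<^sub>R (y - s)) ?H"
    by simp
  moreover have "trace (?H y) = 2 * (real CARD('n) - 2) / (norm (y - s))\<^sup>2" if "y \<in> D" for y
  proof -
    define z t where "z = y - s" and "t = (norm z)\<^sup>2"
    have t: "t > 0" using ne[OF that] by (simp add: t_def z_def)
    have "z \<bullet> z = t" by (simp add: t_def power2_norm_eq_inner)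
    then show ?thesis
      unfolding z_def[symmetric] t_def[symmetric] trace_add trace_scaleR trace_outer_prod trace_I
      using t by (simp add: field_simps power2_eq_square)
  qed
  ultimately show ?thesis by blast
qed

text \<open>The logarithmic barrier both absorbs the singularity and provides the strict inequality.\<close>

lemma superharmonic_ge_affine_on_punctured_ball:
  fixes v :: "real^'n \<Rightarrow> real"
  assumes n: "3 \<le> CARD('n)" and v: "hess_on D N v gv Hv" and N: "negligible N"
    and r: "r > 0" and sub: "cball s r - {s} \<subseteq> D"
    and tr: "\<And>y. y \<in> D \<Longrightarrow> y \<notin> N \<Longrightarrow> trace (Hv y) \<le> 0"
    and bdd: "\<And>y. y \<in> cball s r - {s} \<Longrightarrow> B \<le> v y"
    and sph: "\<And>y. y \<in> sphere s r \<Longrightarrow> b + p \<bullet> (y - s) \<le> v y"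
    and y1: "y1 \<in> cball s r - {s}"
  shows "b + p \<bullet> (y1 - s) \<le> v y1"
proof (rule ccontr)
  assume neg: "\<not> ?thesis"
  define d where "d = b + p \<bullet> (y1 - s) - v y1"
  have d: "d > 0" using neg unfolding d_def by simp
  define l where "l = (\<lambda>y. ln ((norm (y - s))\<^sup>2))"
  \<comment> \<open>This makes \<open>k (ln r^2 - l y1 + 1) = d/2\<close>, so the barrier spends at
    most half of the defect \<open>d\<close> at \<open>y1\<close>. The summand 1 keeps the
    denominator positive when \<open>y1\<close> lies on the sphere.\<close>
  define k where "k = d / (2 * (ln (r\<^sup>2) - l y1 + 1))"
  have ly1: "l y1 \<le> ln (r\<^sup>2)" unfolding l_def using y1 r
    by (auto simp: dist_norm norm_minus_commute)
  have k: "k > 0" unfolding k_def using d ly1 by (intro divide_pos_pos) auto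
  \<comment> \<open>\<open>f + k ln r^2\<close> is \<open>v\<close> minus the affine function plus a
    barrier vanishing on the sphere. The coefficients 1 and -1 are kept so that
    \<open>hess_on_linear_combination\<close> matches literally.\<close>
  define f where "f = (\<lambda>y. 1 * (1 * v y + (-1) * (b + p \<bullet> (y - s))) + (- k) * l y)"
  define M where "M = \<bar>B\<bar> + \<bar>b\<bar> + norm p * r"
  \<comment> \<open>At distance \<open>R\<close> from \<open>s\<close> the barrier equals
    \<open>M + 1\<close>, while \<open>v\<close> minus the affine function is at least
    \<open>-M\<close> on the punctured ball. So negative values stay away from
    \<open>s\<close>.\<close>
  define R where "R = r * exp (- ((M + 1) / (2 * k)))"
  have M: "M \<ge> 0" unfolding M_def using r by auto
  have R: "R > 0" "R \<le> r" unfolding R_def using r M k by auto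
  have lR: "ln (R\<^sup>2) = ln (r\<^sup>2) - (M + 1) / k"
    unfolding R_def using r k by (simp add: ln_mult ln_realpow field_simps)
  have k_ne: "k * ((M + 1) / k) = M + 1" using k by simp
  have fy1: "f y1 + k * ln (r\<^sup>2) < 0"
  proof -
    have "k * (ln (r\<^sup>2) - l y1 + 1) = d / 2" unfolding k_def using ly1 by (simp add: field_simps)
    then show ?thesis unfolding f_def using d k by (simp add: d_def algebra_simps)
  qed
  have near: "f y + k * ln (r\<^sup>2) > 0" if y: "y \<in> cball s R" "y \<noteq> s" for y
  proof -
    have nz: "0 < norm (y - s)" "norm (y - s) \<le> R"
      using y by (auto simp: dist_norm norm_minus_commute)
    then have "l y \<le> ln (R\<^sup>2)" unfolding l_def using R by auto
    then have "k * l y \<le> k * ln (r\<^sup>2) - (M + 1)"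
      using k k_ne unfolding lR by (metis mult_le_cancel_left_pos right_diff_distrib)
    moreover have "B \<le> v y" using bdd y R by auto
    moreover have "p \<bullet> (y - s) \<le> norm p * r"
      using norm_cauchy_schwarz[of p "y - s"] nz R mult_left_mono[of "norm (y - s)" r "norm p"] by simp
    ultimately show ?thesis unfolding f_def M_def by simp
  qed
  have onsph: "f y + k * ln (r\<^sup>2) \<ge> 0" if "y \<in> sphere s r" for y
    using sph[OF that] that unfolding f_def l_def by (simp add: dist_norm norm_minus_commute)
  obtain Hl where Hl: "hess_on (D - {s}) N l (\<lambda>y. (2 / (norm (y - s))\<^sup>2) *\<^sub>R (y - s)) Hl"
    "\<And>y. y \<in> D - {s} \<Longrightarrow> trace (Hl y) = 2 * (real CARD('n) - 2) / (norm (y - s))\<^sup>2"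
    using hess_on_ln_norm[of "D - {s}" s N] hess_onD(1)[OF v] unfolding l_def by auto
  have oD: "open (D - {s})" using hess_onD(1)[OF v] by auto
  define g where "g = (\<lambda>y. 1 *\<^sub>R (1 *\<^sub>R gv y + (-1) *\<^sub>R p) + (- k) *\<^sub>R ((2 / (norm (y - s))\<^sup>2) *\<^sub>R (y - s)))"
  define H where "H = (\<lambda>y. 1 *\<^sub>R (1 *\<^sub>R Hv y + (-1) *\<^sub>R 0) + (- k) *\<^sub>R Hl y)"
  have hf: "hess_on (D - {s}) N f g H"
    unfolding f_def g_def H_def
    by (intro hess_on_linear_combination hess_on_affine oD Hl(1) hess_on_subset[OF v]) auto
  let ?K = "cball s r - ball s R"
  have Ksub: "?K \<subseteq> D - {s}" using sub \<open>0 < R\<close> by auto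
  have "y1 \<in> ?K" using y1 near[of y1] fy1 by force
  moreover have "continuous_on ?K f"
    using Ksub by (intro continuous_at_imp_continuous_on ballI hess_on_isCont[OF hf]) blast
  moreover have "compact ?K" by (intro compact_diff) auto
  ultimately obtain y2 where y2: "y2 \<in> ?K" "\<And>y. y \<in> ?K \<Longrightarrow> f y2 \<le> f y"
    using continuous_attains_inf[of ?K f] by blast
  have fy2: "f y2 + k * ln (r\<^sup>2) < 0" using y2(2)[OF \<open>y1 \<in> ?K\<close>] fy1 by linarith
  define E where "E = ball s r - cball s R"
  have y2E: "y2 \<in> E" using y2(1) near[of y2] onsph[of y2] fy2 R unfolding E_def by force
  have Esub: "E \<subseteq> ?K" unfolding E_def by auto
  have hfE: "hess_on E N f g H"
    by (rule hess_on_subset[OF hf]) (use Ksub Esub in \<open>auto simp: E_def open_Diff\<close>)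
  \<comment> \<open>The diagonal entries of \<open>H y\<close> then sum to at least
    \<open>-k/r^2\<close>, whereas the barrier forces the trace to be at most
    \<open>-2k/r^2\<close>.\<close>
  define e where "e = k / (real CARD('n) * r\<^sup>2)"
  have e: "e > 0" unfolding e_def using k r by simp
  obtain y where y: "y \<in> E - N"
    "\<And>H h. (g has_derivative H) (at y) \<Longrightarrow> - e * (norm h)\<^sup>2 \<le> h \<bullet> H h"
    using near_minimum_off_negligible[of E f g y2 N e] hess_onD[OF hfE] y2E y2(2) Esub N e
    by (metis (no_types, lifting) subsetD)
  have yD: "y \<in> D - {s}" "y \<notin> N" using y(1) Esub Ksub by auto
  have "- e \<le> H y $ i $ i" for i
    using y(2)[of "\<lambda>h. H y *v h" "axis i 1"] hess_onD(4)[OF hf yD] by (simp add: axis_inner_matrix)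
  then have "(\<Sum>i::'n\<in>UNIV. - e) \<le> trace (H y)"
    unfolding trace_def by (intro sum_mono) auto
  moreover have "(\<Sum>i::'n\<in>UNIV. - e) = - (k / r\<^sup>2)" unfolding e_def by simp
  moreover have "trace (H y) = trace (Hv y) - k * (2 * (real CARD('n) - 2) / (norm (y - s))\<^sup>2)"
    unfolding H_def using Hl(2)[OF yD(1)] by (simp add: trace_add trace_scaleR trace_sub)
  moreover have "2 / r\<^sup>2 \<le> 2 * (real CARD('n) - 2) / (norm (y - s))\<^sup>2"
  proof (rule frac_le)
    show "(norm (y - s))\<^sup>2 \<le> r\<^sup>2" using y(1) unfolding E_def
      by (intro power_mono) (auto simp: dist_norm norm_minus_commute)
    show "0 < (norm (y - s))\<^sup>2" using yD by auto
  qed (use n in auto)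
  then have "k * (2 / r\<^sup>2) \<le> k * (2 * (real CARD('n) - 2) / (norm (y - s))\<^sup>2)"
    using k by (intro mult_left_mono) auto
  moreover have "trace (Hv y) \<le> 0" using tr yD by auto
  moreover have "0 < k / r\<^sup>2" using k r by simp
  ultimately show False by simp
qed

section \<open>The comparison principle\<close>

text \<open>For the metric \<open>q^(-2)|dx|^2\<close> this is the Schouten tensor with one index
  raised; \<open>p\<close>, \<open>g\<close>, \<open>H\<close> stand for value, gradient and Hessian
  of \<open>q\<close> at one point.\<close>

definition schouten :: "real \<Rightarrow> real^'n \<Rightarrow> real^'n^'n \<Rightarrow> real^'n^'n" where
  "schouten p g H = p *\<^sub>R H - ((norm g)\<^sup>2 / 2) *\<^sub>R mat 1"

lemma schouten_scale: "schouten (m * p) (m *\<^sub>R g) (m *\<^sub>R H) = m\<^sup>2 *\<^sub>R schouten p g H"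
  by (simp add: schouten_def scaleR_diff_right power_mult_distrib mult.assoc)
    (simp add: power2_eq_square mult.assoc mult.left_commute)

lemma trace_schouten: "trace (schouten p g (H :: real^'n^'n)) = p * trace H - real CARD('n) / 2 * (norm g)\<^sup>2"
  by (simp add: schouten_def trace_sub trace_scaleR trace_I)

lemma sym_mats_linear:
  "A \<in> sym_mats \<Longrightarrow> B \<in> sym_mats \<Longrightarrow> A + B \<in> sym_mats"
  "A \<in> sym_mats \<Longrightarrow> B \<in> sym_mats \<Longrightarrow> A - B \<in> sym_mats"
  "A \<in> sym_mats \<Longrightarrow> a *\<^sub>R A \<in> sym_mats"
  "mat a \<in> sym_mats"
  by (auto simp: sym_mats_def transpose_def vec_eq_iff mat_def)

lemma pos_def_scaled_mat: "0 < a \<Longrightarrow> pos_def (a *\<^sub>R mat 1)"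
  unfolding pos_def_def
  by (auto simp: sym_mats_linear scaleR_matrix_vector_assoc[symmetric])

lemma schouten_sym_iff:
  assumes "p \<noteq> 0"
  shows "schouten p g H \<in> sym_mats \<longleftrightarrow> H \<in> sym_mats"
proof
  assume "schouten p g H \<in> sym_mats"
  then have "schouten p g H + ((norm g)\<^sup>2 / 2) *\<^sub>R mat 1 \<in> sym_mats"
    by (intro sym_mats_linear)
  then have "p *\<^sub>R H \<in> sym_mats" by (simp add: schouten_def)
  then have "(1 / p) *\<^sub>R (p *\<^sub>R H) \<in> sym_mats" by (rule sym_mats_linear)
  then show "H \<in> sym_mats" using assms by simp
next
  assume "H \<in> sym_mats"
  then show "schouten p g H \<in> sym_mats"
    unfolding schouten_def by (intro sym_mats_linear)
qed

text \<open>Adding a multiple of the spherical profile \<open>1 + d|z|\<^sup>2\<close> is the substitute for strict ellipticity: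
  it pushes the tensor into the interior of the cone without any bound on the gradient.\<close>

lemma schouten_perturb:
  fixes g z :: "real^'n"
  assumes p: "0 < p" and e: "0 < e" and d: "0 < d" and z: "d * (norm z)\<^sup>2 \<le> 1"
  shows "\<exists>k \<ge> 2 * d * e\<^sup>2. schouten (p + e * (1 + d * (norm z)\<^sup>2)) (g + e *\<^sub>R ((2 * d) *\<^sub>R z)) (H + e *\<^sub>R ((2 * d) *\<^sub>R mat 1))
     = (1 + e * (1 + d * (norm z)\<^sup>2) / p) *\<^sub>R schouten p g H + k *\<^sub>R mat 1"
proof -
  define f where "f = 1 + d * (norm z)\<^sup>2"
  \<comment> \<open>On expansion, the part linear in \<open>e\<close> beyond the rescaled tensor is
    \<open>e b\<close> times the identity, and the quadratic terms collapse to
    \<open>2 d e^2\<close>.\<close>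
  define b where "b = 2 * d * p + f * (norm g)\<^sup>2 / (2 * p) - 2 * d * (g \<bullet> z)"
  define k where "k = e * b + 2 * d * e\<^sup>2"
  have ng: "(norm (g + e *\<^sub>R ((2 * d) *\<^sub>R z)))\<^sup>2 = (norm g)\<^sup>2 + 4 * e * d * (g \<bullet> z) + 4 * e\<^sup>2 * d\<^sup>2 * (norm z)\<^sup>2"
    unfolding power2_norm_eq_inner
    by (simp add: inner_add_left inner_add_right inner_commute power2_eq_square algebra_simps)
  \<comment> \<open>This square, with \<open>d|z|^2 <= 1\<close>, controls the mixed term and gives
    \<open>b >= 0\<close> for every \<open>g\<close>.\<close>
  have "(norm (g - (2 * p * d) *\<^sub>R z))\<^sup>2 = (norm g)\<^sup>2 - 4 * p * d * (g \<bullet> z) + 4 * p\<^sup>2 * d * (d * (norm z)\<^sup>2)"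
    unfolding power2_norm_eq_inner
    by (simp add: inner_diff_left inner_diff_right inner_commute power2_eq_square algebra_simps)
  moreover have "4 * p\<^sup>2 * d * (d * (norm z)\<^sup>2) \<le> 4 * p\<^sup>2 * d * 1"
    using z p d by (intro mult_left_mono) auto
  ultimately have "0 \<le> (norm g)\<^sup>2 - 4 * p * d * (g \<bullet> z) + 4 * p\<^sup>2 * d"
    by (smt (verit) zero_le_power2)
  moreover have "(norm g)\<^sup>2 \<le> f * (norm g)\<^sup>2"
    using d unfolding f_def by (simp add: mult_right_mono distrib_right)
  moreover have two_pb: "2 * p * b = f * (norm g)\<^sup>2 - 4 * p * d * (g \<bullet> z) + 4 * p\<^sup>2 * d"
    unfolding b_def using p by (simp add: field_simps power2_eq_square)
  ultimately have "0 \<le> 2 * p * b"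
    by (simp add: two_pb)
  then have "0 \<le> b" using p by (simp add: zero_le_mult_iff)
  then have "2 * d * e\<^sup>2 \<le> k" unfolding k_def using e by simp
  moreover have "schouten (p + e * f) (g + e *\<^sub>R ((2 * d) *\<^sub>R z)) (H + e *\<^sub>R ((2 * d) *\<^sub>R mat 1))
     = (1 + e * f / p) *\<^sub>R schouten p g H + k *\<^sub>R mat 1"
  proof -
    have c: "(p + e * f) * (e * (2 * d)) - ((norm g)\<^sup>2 + 4 * e * d * (g \<bullet> z) + 4 * e\<^sup>2 * d\<^sup>2 * (norm z)\<^sup>2) / 2
      = k - (1 + e * f / p) * ((norm g)\<^sup>2 / 2)"
      unfolding k_def b_def f_def using p by (simp add: field_simps power2_eq_square)
    have "schouten (p + e * f) (g + e *\<^sub>R ((2 * d) *\<^sub>R z)) (H + e *\<^sub>R ((2 * d) *\<^sub>R mat 1))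
      = (p + e * f) *\<^sub>R H + ((p + e * f) * (e * (2 * d)) - ((norm g)\<^sup>2 + 4 * e * d * (g \<bullet> z) + 4 * e\<^sup>2 * d\<^sup>2 * (norm z)\<^sup>2) / 2) *\<^sub>R mat 1"
      unfolding schouten_def ng by (simp add: scaleR_add_right scaleR_diff_left)
    also have "\<dots> = (1 + e * f / p) *\<^sub>R (p *\<^sub>R H - ((norm g)\<^sup>2 / 2) *\<^sub>R mat 1) + k *\<^sub>R mat 1"
      unfolding c using p by (simp add: scaleR_diff_right scaleR_diff_left distrib_right)
    finally show ?thesis by (simp add: schouten_def)
  qed
  ultimately show ?thesis unfolding f_def by blast
qed

section \<open>Admissible cones and the exclusion of contact points\<close>

lemma norm_quadratic_form_le:
  fixes A :: "real^'n^'n"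
  assumes "norm (A *v h) \<le> L * norm h"
  shows "\<bar>h \<bullet> (A *v h)\<bar> \<le> L * (norm h)\<^sup>2"
proof -
  have "\<bar>h \<bullet> (A *v h)\<bar> \<le> norm h * norm (A *v h)" by (rule Cauchy_Schwarz_ineq2)
  also have "\<dots> \<le> norm h * (L * norm h)" using assms by (intro mult_left_mono) auto
  finally show ?thesis by (simp add: power2_eq_square mult.left_commute)
qed

text \<open>The facts about the cone on which comparison rests. They are stated for the closure
  because solutions have their tensor in \<open>closure U - U\<close>; the trace condition makes a
  positive \<open>q\<close> with tensor in the closure subharmonic.\<close>

locale admissible_cone =
  fixes U :: "(real^'n^'n) set"
  assumes closure_sym: "closure U \<subseteq> sym_mats"
    and add_pos_def: "M \<in> closure U \<Longrightarrow> pos_def N \<Longrightarrow> M + N \<in> U"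
    and scale: "M \<in> closure U \<Longrightarrow> 0 < a \<Longrightarrow> a *\<^sub>R M \<in> closure U"
    and trace_nonneg: "M \<in> closure U \<Longrightarrow> 0 \<le> trace M"
begin

lemma add_scaled_mat:
  assumes "M \<in> closure U" "0 \<le> a"
  shows "M + a *\<^sub>R mat 1 \<in> closure U"
proof (cases "a = 0")
  case False
  then have "M + a *\<^sub>R mat 1 \<in> U"
    using assms by (intro add_pos_def pos_def_scaled_mat) auto
  then show ?thesis using closure_subset by blast
qed (use assms in simp)

text \<open>Near a contact point, on a set that no null set covers, values and gradients of
  \<open>P\<close> and \<open>V\<close> almost agree and the Hessian of \<open>P\<close> is almost
  at least that of \<open>V\<close>. Hence \<open>P\<close> inherits the gap \<open>c\<close> of
  \<open>V\<close> up to a loss of \<open>c/2\<close>, against the assumption on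
  \<open>P\<close>.\<close>

lemma no_touching:
  assumes P: "hess_on D N P gP HP" and V: "hess_on D N V gV HV" and N: "negligible N"
    and x: "x \<in> D" "P x = V x" "0 < V x" and le: "\<And>y. y \<in> D \<Longrightarrow> V y \<le> P y" and c: "0 < c"
    and bdd: "\<And>y h. y \<in> D \<Longrightarrow> y \<notin> N \<Longrightarrow> norm (HP y *v h) \<le> L * norm h"
    and AP: "\<And>y. y \<in> D \<Longrightarrow> y \<notin> N \<Longrightarrow> schouten (P y) (gP y) (HP y) \<in> sym_mats"
      "\<And>y. y \<in> D \<Longrightarrow> y \<notin> N \<Longrightarrow> schouten (P y) (gP y) (HP y) - (c / 2) *\<^sub>R mat 1 \<notin> U"
    and AV: "\<And>y. y \<in> D \<Longrightarrow> y \<notin> N \<Longrightarrow> schouten (V y) (gV y) (HV y) - c *\<^sub>R mat 1 \<in> closure U"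
  shows False
proof -
  have f: "hess_on D N (\<lambda>y. 1 * P y + (-1) * V y) (\<lambda>y. 1 *\<^sub>R gP y + (-1) *\<^sub>R gV y)
      (\<lambda>y. 1 *\<^sub>R HP y + (-1) *\<^sub>R HV y)"
    by (rule hess_on_linear_combination[OF P V])
  have cont: "isCont P x" "isCont V x" "isCont gP x" "isCont gV x"
    using hess_on_isCont[OF P x(1)] hess_on_isCont[OF V x(1)] by auto
  obtain K where K: "0 \<le> K" "L \<le> K" using abs_ge_self abs_ge_zero by blast
  \<comment> \<open>\<open>l\<close> bounds \<open>P - V\<close> and limits its effect, multiplied
    by the Hessian bound, to \<open>c/8\<close>. \<open>G\<close> bounds the sum of the gradients,
    which appears on factoring the difference of their squared norms.\<close>
  define l where "l = c / (8 * (K + 1))"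
  define G where "G = norm (gP x + gV x) + 1"
  have l: "l > 0" unfolding l_def using c K by (intro divide_pos_pos) auto
  have G: "G > 0" unfolding G_def by (simp add: add_nonneg_pos)
  have "((\<lambda>y. P y - V y) \<longlongrightarrow> P x - V x) (nhds x)" "(V \<longlongrightarrow> V x) (nhds x)"
    "((\<lambda>y. norm (gP y + gV y)) \<longlongrightarrow> norm (gP x + gV x)) (nhds x)"
    using cont unfolding isCont_def tendsto_at_iff_tendsto_nhds by (auto intro!: tendsto_intros)
  then have "\<forall>\<^sub>F y in nhds x. P y - V y < l \<and> V y > 0 \<and> V y < V x + 1 \<and> norm (gP y + gV y) < G"
    unfolding G_def using x l by (intro eventually_conj) (auto intro!: order_tendstoD)
  then obtain r where r: "r > 0" "\<And>y. dist y x < r \<Longrightarrow>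
      P y - V y < l \<and> V y > 0 \<and> V y < V x + 1 \<and> norm (gP y + gV y) < G"
    unfolding eventually_nhds_metric by blast
  \<comment> \<open>The Hessian error \<open>e (V x + 1)\<close> and the gradient error
    \<open>e G\<close> together cost at most \<open>c/8\<close>.\<close>
  define e where "e = min r (c / (8 * (V x + 1 + G)))"
  have "0 < c / (8 * (V x + 1 + G))" using c x G by (intro divide_pos_pos) auto
  then have e: "e > 0" "e \<le> r" unfolding e_def using r by auto
  have eV: "e * (V x + 1 + G) \<le> c / 8"
  proof -
    have "e \<le> c / (8 * (V x + 1 + G))" unfolding e_def by simp
    then show ?thesis using x G by (simp add: field_simps)
  qed
  obtain y where y: "y \<in> D - N" "dist y x < e" "norm (1 *\<^sub>R gP y + (-1) *\<^sub>R gV y) < e"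
    "\<And>H h. ((\<lambda>y. 1 *\<^sub>R gP y + (-1) *\<^sub>R gV y) has_derivative H) (at y) \<Longrightarrow> - e * (norm h)\<^sup>2 \<le> h \<bullet> H h"
    using near_minimum_off_negligible[of D "\<lambda>y. 1 * P y + (-1) * V y" "\<lambda>y. 1 *\<^sub>R gP y + (-1) *\<^sub>R gV y" x N e]
      hess_onD[OF f] x le N e(1) by auto
  have yD: "y \<in> D" "y \<notin> N" using y(1) by auto
  have ry: "P y - V y < l" "V y > 0" "V y < V x + 1" "norm (gP y + gV y) < G"
    using r(2)[of y] y(2) e by auto
  let ?A = "schouten (P y) (gP y) (HP y)" and ?B = "schouten (V y) (gV y) (HV y)"
  have "pos_def (?A - ?B + (c / 2) *\<^sub>R mat 1)"
    unfolding pos_def_def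
  proof (intro conjI allI impI)
    have "?B - c *\<^sub>R mat 1 \<in> sym_mats" using AV[OF yD] closure_sym by blast
    from sym_mats_linear(1)[OF this sym_mats_linear(3)[OF sym_mats_linear(4)[of 1], of c]]
    have "?B \<in> sym_mats" by simp
    then show "?A - ?B + (c / 2) *\<^sub>R mat 1 \<in> sym_mats"
      using AP(1)[OF yD] by (intro sym_mats_linear)
  next
    fix h :: "real^'n" assume "h \<noteq> 0"
    define t where "t = (norm h)\<^sup>2"
    have t: "t > 0" "h \<bullet> h = t" using \<open>h \<noteq> 0\<close> by (auto simp: t_def power2_norm_eq_inner)
    \<comment> \<open>The products are split as
      \<open>P HP - V HV = V (HP - HV) + (P - V) HP\<close>: the first term is controlled by the
      near minimum, the second by the local bound on \<open>HP\<close>.\<close>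
    have q: "h \<bullet> ((?A - ?B + (c / 2) *\<^sub>R mat 1) *v h) =
       V y * (h \<bullet> ((1 *\<^sub>R HP y + (-1) *\<^sub>R HV y) *v h)) + (P y - V y) * (h \<bullet> (HP y *v h))
        - ((norm (gP y))\<^sup>2 - (norm (gV y))\<^sup>2) / 2 * t + c / 2 * t"
      unfolding schouten_def
      by (simp add: matrix_vector_mult_add_rdistrib matrix_vector_mult_diff_rdistrib t(2)
          scaleR_matrix_vector_assoc[symmetric] inner_add_right inner_diff_right algebra_simps diff_divide_distrib)
    have "- e * t \<le> h \<bullet> ((1 *\<^sub>R HP y + (-1) *\<^sub>R HV y) *v h)"
      unfolding t_def by (rule y(4)[OF hess_onD(4)[OF f yD]])
    then have "V y * (- e * t) \<le> V y * (h \<bullet> ((1 *\<^sub>R HP y + (-1) *\<^sub>R HV y) *v h))"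
      using ry by (intro mult_left_mono) auto
    moreover have "V y * (e * t) \<le> (V x + 1) * (e * t)" using ry e t by (intro mult_right_mono) auto
    moreover have "- (l * (K * t)) \<le> (P y - V y) * (h \<bullet> (HP y *v h))"
    proof -
      have "\<bar>h \<bullet> (HP y *v h)\<bar> \<le> L * t" unfolding t_def by (rule norm_quadratic_form_le[OF bdd[OF yD]])
      also have "\<dots> \<le> K * t" using t K by (intro mult_right_mono) auto
      finally have "\<bar>P y - V y\<bar> * \<bar>h \<bullet> (HP y *v h)\<bar> \<le> l * (K * t)"
        using ry le[OF yD(1)] K t by (intro mult_mono) auto
      then show ?thesis unfolding abs_mult[symmetric] by linarith
    qed
    moreover have "l * K \<le> c / 8"
      unfolding l_def using c K by (simp add: field_simps)
    then have "l * (K * t) \<le> c / 8 * t" unfolding mult.assoc[symmetric] using t by (intro mult_right_mono) auto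
    moreover have "(norm (gP y))\<^sup>2 - (norm (gV y))\<^sup>2 \<le> e * G"
    proof -
      have "(norm (gP y))\<^sup>2 - (norm (gV y))\<^sup>2 = (gP y - gV y) \<bullet> (gP y + gV y)"
        unfolding power2_norm_eq_inner by (simp add: inner_add_right inner_diff_left inner_diff_right inner_commute)
      also have "\<dots> \<le> norm (gP y - gV y) * norm (gP y + gV y)" by (rule norm_cauchy_schwarz)
      also have "\<dots> \<le> e * G" using y(3) ry e by (intro mult_mono) auto
      finally show ?thesis .
    qed
    then have "((norm (gP y))\<^sup>2 - (norm (gV y))\<^sup>2) / 2 \<le> e * G"
    proof -
      have "x / 2 \<le> w" if "x \<le> w" "0 < w" for x w :: real using that by linarith
      then show ?thesis using \<open>_ \<le> e * G\<close> mult_pos_pos[OF e(1) G] by blast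
    qed
    then have "((norm (gP y))\<^sup>2 - (norm (gV y))\<^sup>2) / 2 * t \<le> e * G * t"
      using t(1) by (intro mult_right_mono) auto
    moreover have "e * (V x + 1 + G) * t \<le> c / 8 * t" using eV t by (intro mult_right_mono) auto
    then have "(V x + 1) * (e * t) + e * G * t \<le> c / 8 * t" by (simp add: algebra_simps)
    moreover have "0 < c / 8 * t" "c / 2 * t = 4 * (c / 8 * t)" using c t by auto
    \<comment> \<open>Read with \<open>w = c/8 t\<close>: the errors use up at most
      \<open>2w\<close> of the available \<open>4w\<close>.\<close>
    moreover have "0 < a + b - d + k" if "- a' \<le> a" "a' \<le> a''" "- b' \<le> b" "b' \<le> w" "d \<le> d'"
      "a'' + d' \<le> w" "0 < w" "k = 4 * w" for a a' a'' b b' d d' k w :: real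
      using that by linarith
    ultimately show "0 < h \<bullet> ((?A - ?B + (c / 2) *\<^sub>R mat 1) *v h)"
      unfolding q mult_minus_left mult_minus_right by blast
  qed
  from add_pos_def[OF AV[OF yD] this]
  have "?A - (c / 2) *\<^sub>R mat 1 \<in> U"
  proof (rule back_subst[of "\<lambda>X. X \<in> U"])
    have "(c / 2) *\<^sub>R mat 1 + (c / 2) *\<^sub>R mat 1 = (c *\<^sub>R mat 1 :: real^'n^'n)"
      by (simp flip: scaleR_add_left)
    then show "?B - c *\<^sub>R mat 1 + (?A - ?B + (c / 2) *\<^sub>R mat 1) = ?A - (c / 2) *\<^sub>R mat 1"
      by (metis (no_types, opaque_lifting) add_diff_cancel_left' add_diff_eq diff_add_cancel diff_diff_eq2 diff_diff_add)
  qed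
  then show False using AP(2)[OF yD] by blast
qed

end

text \<open>On a small sphere of radius \<open>R\<close> the cone leaves a gap \<open>p R\<close>,
  while \<open>G\<close> differs from its tangent at \<open>s\<close> by at most
  \<open>p R/2\<close>. So the superharmonic function \<open>-W\<close> lies above an affine
  function with room \<open>p R/2\<close> on the sphere, and the comparison on the punctured ball
  carries this inwards.\<close>

lemma subharmonic_below_cone_at_puncture:
  fixes W :: "real^'n \<Rightarrow> real"
  assumes n: "3 \<le> CARD('n)" and W: "hess_on D N W gW HW" and N: "negligible N"
    and r: "r > 0" and sub: "cball s r - {s} \<subseteq> D"
    and tr: "\<And>y. y \<in> D \<Longrightarrow> y \<notin> N \<Longrightarrow> 0 \<le> trace (HW y)"
    and G: "(G has_derivative (\<lambda>h. a \<bullet> h)) (at s)" and p: "p > 0"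
    and le: "\<And>y. y \<in> cball s r - {s} \<Longrightarrow> W y \<le> G y - p * norm (y - s)"
  shows "\<exists>k>0. \<forall>\<^sub>F y in at s. W y \<le> G y - k"
proof -
  obtain d where d: "d > 0" "\<And>y. norm (y - s) < d \<Longrightarrow>
      norm (G y - G s - a \<bullet> (y - s)) \<le> p / 2 * norm (y - s)"
    using G p unfolding has_derivative_at_alt by (meson half_gt_zero)
  define R where "R = min r (d / 2)"
  have R: "R > 0" "R \<le> r" "R < d" unfolding R_def using r d by auto
  have Gb: "\<bar>G y - G s - a \<bullet> (y - s)\<bar> \<le> p / 2 * norm (y - s)" if "y \<in> cball s R" for y
    using d(2)[of y] that R by (auto simp: dist_norm norm_minus_commute)
  have W': "hess_on D N (\<lambda>y. (-1) * W y) (\<lambda>y. (-1) *\<^sub>R gW y) (\<lambda>y. (-1) *\<^sub>R HW y)"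
    by (rule hess_on_scale[OF W])
  have main: "(p * R / 2 - G s) + (- a) \<bullet> (y - s) \<le> (-1) * W y" if "y \<in> cball s R - {s}" for y
  proof (rule superharmonic_ge_affine_on_punctured_ball[OF n W' N R(1)])
    show "cball s R - {s} \<subseteq> D" using sub subset_cball[OF R(2), of s] by blast
    show "trace ((-1) *\<^sub>R HW y) \<le> 0" if "y \<in> D" "y \<notin> N" for y
      using tr[OF that] by (simp only: trace_scaleR)
    show "- (G s + norm a * R + p / 2 * R) \<le> (-1) * W y" if y: "y \<in> cball s R - {s}" for y
    proof -
      have ny: "norm (y - s) \<le> R" using y by (auto simp: dist_norm norm_minus_commute)
      have "a \<bullet> (y - s) \<le> norm a * norm (y - s)" by (rule norm_cauchy_schwarz)
      also have "\<dots> \<le> norm a * R" using ny by (intro mult_left_mono) auto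
      finally have "a \<bullet> (y - s) \<le> norm a * R" .
      moreover have "W y \<le> G y - p * norm (y - s)" using le y R by auto
      moreover have "p / 2 * norm (y - s) \<le> p / 2 * R" "0 \<le> p * norm (y - s)"
        using ny p by (auto intro!: mult_left_mono)
      moreover have "G y - G s - a \<bullet> (y - s) \<le> p / 2 * norm (y - s)"
        using order_trans[OF abs_ge_self Gb[of y]] y by auto
      ultimately show ?thesis by simp
    qed
    show "(p * R / 2 - G s) + (- a) \<bullet> (y - s) \<le> (-1) * W y" if y: "y \<in> sphere s R" for y
    proof -
      have ny: "norm (y - s) = R" using y by (auto simp: dist_norm norm_minus_commute)
      then have "y \<in> cball s R - {s}" using y R by auto
      moreover from this have "W y \<le> G y - p * R" using le[of y] R ny by auto
      moreover have "G y - G s - a \<bullet> (y - s) \<le> p / 2 * R"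
        using order_trans[OF abs_ge_self Gb[of y]] y ny by auto
      ultimately show ?thesis by simp
    qed
    show "y \<in> cball s R - {s}" by (rule that)
  qed
  show ?thesis
  proof (intro exI conjI)
    \<comment> \<open>On the ball of half the radius the tangent approximation costs at most
      \<open>p R/4\<close>, leaving \<open>p R/4\<close> of the gap.\<close>
    show "0 < p * R / 4" using p R by simp
    have "\<forall>\<^sub>F y in at s. y \<in> ball s (R / 2) \<and> y \<noteq> s"
      unfolding eventually_at using R by (intro exI[of _ "R / 2"]) (auto simp: dist_commute)
    then show "\<forall>\<^sub>F y in at s. W y \<le> G y - p * R / 4"
    proof eventually_elim
      case (elim y)
      then have ny: "norm (y - s) \<le> R / 2" and y: "y \<in> cball s R - {s}"
        using R by (auto simp: dist_norm norm_minus_commute)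
      have "p / 2 * norm (y - s) \<le> p / 2 * (R / 2)" using ny p by (intro mult_left_mono) auto
      moreover have "- (p / 2 * norm (y - s)) \<le> G y - G s - a \<bullet> (y - s)"
        using order_trans[OF abs_ge_minus_self Gb[of y]] y by auto
      ultimately show ?case using main[OF y] by simp
    qed
  qed
qed

section \<open>Boundedness and conic gaps at a puncture\<close>

context admissible_cone begin

lemma trace_hessian_ge:
  assumes "schouten p g H \<in> closure U"
  shows "real CARD('n) / 2 * (norm g)\<^sup>2 \<le> p * trace H"
  using trace_nonneg[OF assms] by (simp add: trace_schouten)

text \<open>\<open>W powr (-1/2)\<close> is superharmonic in every dimension at least three.\<close>

lemma bounded_at_puncture:
  assumes n: "3 \<le> CARD('n)" and W: "hess_on D N W gW HW" and N: "negligible N"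
    and r: "r > 0" and sub: "cball s r - {s} \<subseteq> D"
    and pos: "\<And>y. y \<in> D \<Longrightarrow> 0 < W y"
    and A: "\<And>y. y \<in> D \<Longrightarrow> y \<notin> N \<Longrightarrow> schouten (W y) (gW y) (HW y) \<in> closure U"
  shows "\<exists>M. \<forall>y \<in> cball s r - {s}. W y \<le> M"
proof -
  have ss: "sphere s r \<subseteq> D" using sub r by auto
  have "continuous_on (sphere s r) W"
    using ss by (intro continuous_at_imp_continuous_on ballI hess_on_isCont[OF W]) blast
  then have "\<exists>M. \<forall>y\<in>sphere s r. W y \<le> M"
    using continuous_attains_sup[of "sphere s r" W] by (cases "sphere s r = {}") auto
  then obtain M0 where M0: "\<And>y. y \<in> sphere s r \<Longrightarrow> W y \<le> M0" by blast
  define M where "M = max M0 1"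
  have M: "M > 0" "\<And>y. y \<in> sphere s r \<Longrightarrow> W y \<le> M" using M0 unfolding M_def by fastforce+
  let ?k1 = "\<lambda>t::real. (- 1 / 2) * t powr (- 3 / 2)" and ?k2 = "\<lambda>t::real. (3 / 4) * t powr (- 5 / 2)"
  have v: "hess_on D N (\<lambda>y. W y powr (- 1 / 2)) (\<lambda>y. ?k1 (W y) *\<^sub>R gW y)
      (\<lambda>y. ?k1 (W y) *\<^sub>R HW y + ?k2 (W y) *\<^sub>R outer_prod (gW y) (gW y))"
    by (rule hess_on_compose[OF W]) (use pos in \<open>auto intro!: derivative_eq_intros\<close>)
  have "W y \<le> M" if y: "y \<in> cball s r - {s}" for y
  proof -
    have "M powr (- 1 / 2) + 0 \<bullet> (y - s) \<le> W y powr (- 1 / 2)"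
    proof (rule superharmonic_ge_affine_on_punctured_ball[OF n v N r sub _ _ _ y])
      fix y assume y: "y \<in> D" "y \<notin> N"
      \<comment> \<open>After factoring out \<open>W powr (- 5 / 2)\<close>, superharmonicity reads
        \<open>3/2 |gW|^2 <= W trace HW\<close>, which the trace condition gives for n >= 3.\<close>
      define w where "w = W y powr (- 5 / 2)"
      have w: "w \<ge> 0" "W y powr (- 3 / 2) = w * W y"
        unfolding w_def using pos[OF y(1)] by (auto simp flip: powr_add powr_mult_base simp: powr_mult_base mult.commute)
      have "3 / 2 * (norm (gW y))\<^sup>2 \<le> real CARD('n) / 2 * (norm (gW y))\<^sup>2"
        using n by (intro mult_right_mono) auto
      also have "\<dots> \<le> W y * trace (HW y)" by (rule trace_hessian_ge[OF A[OF y]])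
      finally have "w * (3 / 2 * (norm (gW y))\<^sup>2) \<le> w * (W y * trace (HW y))"
        using w(1) by (rule mult_left_mono)
      then show "trace (?k1 (W y) *\<^sub>R HW y + ?k2 (W y) *\<^sub>R outer_prod (gW y) (gW y)) \<le> 0"
        unfolding w_def[symmetric] w(2) trace_add trace_scaleR trace_outer_prod
        by (simp add: power2_norm_eq_inner algebra_simps)
    next
      fix y assume "y \<in> sphere s r"
      then have "0 < W y" "W y \<le> M" using ss pos M by auto
      then show "M powr (- 1 / 2) + 0 \<bullet> (y - s) \<le> W y powr (- 1 / 2)"
        by (simp add: powr_mono2')
    next
      show "0 \<le> W y powr (- 1 / 2)" for y by simp
    qed
    then have "M powr (- 1 / 2) \<le> W y powr (- 1 / 2)" by simp
    moreover have "0 < W y" using y sub pos by auto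
    ultimately show ?thesis
      using powr_less_mono2_neg[of "- 1 / 2" M "W y"] M(1) by (meson leD leI divide_neg_pos less_minus_one_simps(1) zero_less_numeral)
  qed
  then show ?thesis by blast
qed

text \<open>A strict supersolution leaves room to tilt the subsolution by any small linear function.\<close>

lemma cone_gap_at_puncture:
  assumes q: "hess_on D N q gq Hq" and V: "hess_on D' N V gV HV" and N: "negligible N"
    and r: "r > 0" and sub: "cball s r \<subseteq> D" "cball s r - {s} \<subseteq> D'"
    and pos: "\<And>y. y \<in> cball s r \<Longrightarrow> 0 < q y" "\<And>y. y \<in> D' \<Longrightarrow> 0 < V y" and c: "0 < c"
    and bdd: "\<And>y h. y \<in> cball s r \<Longrightarrow> y \<notin> N \<Longrightarrow> norm (Hq y *v h) \<le> L * norm h"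
    and Aq: "\<And>y. y \<in> D \<Longrightarrow> y \<notin> N \<Longrightarrow> schouten (q y) (gq y) (Hq y) \<in> sym_mats - U"
    and AV: "\<And>y. y \<in> D' \<Longrightarrow> y \<notin> N \<Longrightarrow> schouten (V y) (gV y) (HV y) - c *\<^sub>R mat 1 \<in> closure U"
    and le: "\<And>y. y \<in> cball s r - {s} \<Longrightarrow> V y \<le> q y"
    and less: "\<And>y. y \<in> sphere s r \<Longrightarrow> V y < q y"
  shows "\<exists>p>0. \<forall>y \<in> cball s r - {s}. V y \<le> q y - p * norm (y - s)"
proof -
  have qc: "continuous_on (cball s r) q" "continuous_on (cball s r) gq"
    using sub by (auto intro!: continuous_at_imp_continuous_on hess_on_isCont[OF q])
  have Vc: "continuous_on (cball s r - {s}) V"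
    using sub by (auto intro!: continuous_at_imp_continuous_on hess_on_isCont[OF V])
  obtain z where "z \<in> cball s r" "\<And>y. y \<in> cball s r \<Longrightarrow> q z \<le> q y"
    using continuous_attains_inf[OF compact_cball _ qc(1)] r by auto
  then obtain q0 where q0: "q0 > 0" "\<And>y. y \<in> cball s r \<Longrightarrow> q0 \<le> q y" using pos by blast
  have "\<exists>d>0. \<forall>y\<in>sphere s r. d \<le> q y - V y"
  proof (cases "sphere s r = {}")
    case False
    have "continuous_on (sphere s r) (\<lambda>y. q y - V y)"
      using r by (intro continuous_intros continuous_on_subset[OF qc(1)] continuous_on_subset[OF Vc]) auto
    then obtain y where "y \<in> sphere s r" "\<forall>x\<in>sphere s r. q y - V y \<le> q x - V x"
      using continuous_attains_inf[OF compact_sphere False] by blast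
    then show ?thesis using less by (intro exI[of _ "q y - V y"]) auto
  qed (use zero_less_one in blast)
  then obtain d where d: "d > 0" "\<And>y. y \<in> sphere s r \<Longrightarrow> d \<le> q y - V y" by blast
  have "bounded (gq ` cball s r)"
    by (intro compact_imp_bounded compact_continuous_image qc) auto
  then obtain G where G: "G > 0" "\<And>y. y \<in> cball s r \<Longrightarrow> norm (gq y) \<le> G"
    unfolding bounded_pos by auto
  obtain K where K: "0 \<le> K" "L \<le> K" using abs_ge_self abs_ge_zero by blast
  define T where "T = r * K + G + 1"
  have T: "T > 0" unfolding T_def using r G K by (simp add: add_nonneg_pos)
  \<comment> \<open>The bound by \<open>d\<close> keeps the inequality strict on the sphere after
    tilting, the one by \<open>q0\<close> keeps the tilted function above \<open>q/2\<close>, and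
    the one by \<open>c\<close> keeps the change of the tensor below the gap.\<close>
  define p0 where "p0 = min 1 (min (d / (2 * r)) (min (q0 / (2 * r)) (c / (16 * T))))"
  have p0: "p0 > 0" "p0 \<le> 1" unfolding p0_def using d r q0 c T by auto
  have "p0 \<le> d / (2 * r)" "p0 \<le> q0 / (2 * r)" "p0 \<le> c / (16 * T)" unfolding p0_def by auto
  then have p0b: "p0 * r < d" "p0 * r \<le> q0 / 2" "p0 * T \<le> c / 16"
    using d r T by (auto simp: field_simps)
  \<comment> \<open>If a tilt broke the inequality, the quotient \<open>P/V\<close> would have a
    minimum \<open>m < 1\<close> at an interior point other than \<open>s\<close>, and
    \<open>m V\<close> would touch \<open>P\<close> from below there.\<close>
  have tilt: "V y1 \<le> q y1 + p \<bullet> (y1 - s)" if p: "norm p \<le> p0" and y1: "y1 \<in> cball s r - {s}" for p y1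
  proof (rule ccontr)
    assume neg: "\<not> ?thesis"
    define P where "P = (\<lambda>y. 1 * q y + 1 * (0 + p \<bullet> (y - s)))"
    have P: "hess_on D N P (\<lambda>y. 1 *\<^sub>R gq y + 1 *\<^sub>R p) (\<lambda>y. 1 *\<^sub>R Hq y + 1 *\<^sub>R 0)"
      unfolding P_def by (intro hess_on_linear_combination q hess_on_affine hess_onD(1)[OF q])
    have pb: "\<bar>p \<bullet> (y - s)\<bar> \<le> p0 * norm (y - s)" for y
      using Cauchy_Schwarz_ineq2[of p "y - s"] mult_right_mono[OF p norm_ge_zero[of "y - s"]] by linarith
    have pb': "\<bar>p \<bullet> (y - s)\<bar> \<le> p0 * r" if "y \<in> cball s r" for y
    proof -
      have "norm (y - s) \<le> r" using that by (simp add: dist_norm norm_minus_commute)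
      then have "p0 * norm (y - s) \<le> p0 * r" using p0 by (intro mult_left_mono) auto
      then show ?thesis using pb[of y] by linarith
    qed
    have Pq: "q y / 2 \<le> P y" if "y \<in> cball s r" for y
      using pb'[OF that] p0b q0(2)[OF that] unfolding P_def by (simp add: abs_le_iff)
    have Vp: "0 < V y" if "y \<in> cball s r - {s}" for y using that sub pos by auto
    define k where "k = (\<lambda>y. P y / V y)"
    have k1: "k y1 < 1" unfolding k_def using neg Vp[OF y1] by (simp add: P_def)
    \<comment> \<open>Inside this radius the tilt, which vanishes at \<open>s\<close>, is below
      \<open>(1 - k y1) q0\<close>; combined with \<open>V <= q\<close> this makes the quotient
      larger than at \<open>y1\<close>.\<close>
    define R where "R = min r ((1 - k y1) * q0 / (2 * p0))"
    have R: "R > 0" "R \<le> r" unfolding R_def using k1 q0 p0 r by auto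
    have near: "k y1 < k y" if y: "y \<in> cball s R" "y \<noteq> s" for y
    proof -
      have yr: "y \<in> cball s r - {s}" using y R by auto
      have "p0 * norm (y - s) \<le> p0 * ((1 - k y1) * q0 / (2 * p0))"
        using y p0 unfolding R_def by (intro mult_left_mono) (auto simp: dist_norm norm_minus_commute)
      also have "\<dots> = (1 - k y1) * q0 / 2" using p0 by simp
      also have "\<dots> < (1 - k y1) * q0" using k1 q0 by simp
      also have "\<dots> \<le> (1 - k y1) * q y" using k1 q0 yr by (intro mult_left_mono) auto
      finally have "k y1 * q y < P y" using pb[of y] unfolding P_def by (simp add: algebra_simps abs_le_iff)
      moreover have "k y1 * V y \<le> k y1 * q y"
        using le[OF yr] Pq[of y1] pos(1)[of y1] Vp[OF y1] y1 unfolding k_def by (intro mult_left_mono) (auto intro!: divide_nonneg_pos)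
      ultimately show ?thesis using Vp[OF yr] by (simp add: pos_less_divide_eq k_def)
    qed
    let ?K = "cball s r - ball s R"
    have Ks: "?K \<subseteq> cball s r - {s}" using R by auto
    have y1K: "y1 \<in> ?K" using near[of y1] y1 by force
    have "continuous_on ?K k"
      unfolding k_def P_def using Ks Vp
      by (intro continuous_intros continuous_on_subset[OF qc(1)] continuous_on_subset[OF Vc]) force+
    moreover have "compact ?K" by (intro compact_diff) auto
    ultimately obtain y2 where y2: "y2 \<in> ?K" "\<And>y. y \<in> ?K \<Longrightarrow> k y2 \<le> k y"
      using continuous_attains_inf[of ?K k] y1K by blast
    define m where "m = k y2"
    have m1: "m \<le> k y1" "m < 1" unfolding m_def using y2(2)[OF y1K] k1 by auto
    have y2r: "y2 \<in> cball s r - {s}" using y2 Ks by blast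
    have "V y2 / 2 \<le> P y2" using Pq[of y2] le[OF y2r] y2r by auto
    \<comment> \<open>The lower bound on \<open>m\<close> preserves a quarter of the gap, since
      scaling by \<open>m\<close> multiplies the tensor by \<open>m^2\<close>.\<close>
    then have m2: "1 / 2 \<le> m" unfolding m_def k_def using Vp[OF y2r] by (simp add: pos_le_divide_eq)
    define E where "E = ball s r - cball s R"
    have EK: "E \<subseteq> ?K" and EE: "E \<subseteq> D" "E \<subseteq> D'" "E \<subseteq> cball s r - {s}" "open E"
      using sub R unfolding E_def by (auto simp: open_Diff)
    have "y2 \<notin> sphere s r"
    proof
      assume y2s: "y2 \<in> sphere s r"
      then have "V y2 < P y2" using d(2)[OF y2s] pb'[of y2] p0b y2r unfolding P_def by (simp add: abs_le_iff)
      then have "1 < m" unfolding m_def k_def using Vp[OF y2r] by simp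
      then show False using m1 by simp
    qed
    moreover have "y2 \<notin> cball s R" using near[of y2] m1 y2r unfolding m_def by force
    ultimately have y2E: "y2 \<in> E" unfolding E_def using y2(1) by auto
    have mV: "hess_on E N (\<lambda>y. m * V y) (\<lambda>y. m *\<^sub>R gV y) (\<lambda>y. m *\<^sub>R HV y)"
      by (rule hess_on_scale[OF hess_on_subset[OF V]]) (use EE in auto)
    show False
    proof (rule no_touching[OF hess_on_subset[OF P EE(4,1) order_refl] mV N y2E])
      show "P y2 = m * V y2" unfolding m_def k_def using Vp[OF y2r] by simp
      show "0 < m * V y2" using m2 Vp[OF y2r] by simp
      show "m * V y \<le> P y" if "y \<in> E" for y
      proof -
        have "m \<le> k y" unfolding m_def using y2(2) EK that by blast
        then show ?thesis unfolding k_def using Vp EE(3) that by (simp add: pos_le_divide_eq subset_iff)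
      qed
      show "0 < c / 4" using c by simp
      show "norm ((1 *\<^sub>R Hq y + 1 *\<^sub>R 0) *v h) \<le> L * norm h" if "y \<in> E" "y \<notin> N" for y h
        using bdd[of y h] that EE by auto
    next
      fix y assume y: "y \<in> E" "y \<notin> N"
      have "schouten (V y) (gV y) (HV y) - c *\<^sub>R mat 1 \<in> closure U" using AV y EE by auto
      then have "m\<^sup>2 *\<^sub>R (schouten (V y) (gV y) (HV y) - c *\<^sub>R mat 1) \<in> closure U"
        using m2 by (intro scale) auto
      moreover have "(1/2)\<^sup>2 \<le> m\<^sup>2" using m2 by (intro power_mono) auto
      then have "(1/2)\<^sup>2 * c \<le> m\<^sup>2 * c" using c by (intro mult_right_mono) auto
      ultimately have "m\<^sup>2 *\<^sub>R (schouten (V y) (gV y) (HV y) - c *\<^sub>R mat 1) + (m\<^sup>2 * c - c / 4) *\<^sub>R mat 1 \<in> closure U"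
        by (intro add_scaled_mat) (auto simp: power2_eq_square)
      then show "schouten (m * V y) (m *\<^sub>R gV y) (m *\<^sub>R HV y) - (c / 4) *\<^sub>R mat 1 \<in> closure U"
        unfolding schouten_scale by (simp add: scaleR_diff_right scaleR_diff_left)
    next
      fix y assume y: "y \<in> E" "y \<notin> N"
      have yr: "y \<in> cball s r" using y EE by auto
      let ?A = "schouten (q y) (gq y) (Hq y)" and ?B = "schouten (P y) (1 *\<^sub>R gq y + 1 *\<^sub>R p) (1 *\<^sub>R Hq y + 1 *\<^sub>R 0)"
      have A: "?A \<in> sym_mats" "?A \<notin> U" using Aq y EE by auto
      have "P y \<noteq> 0" "q y \<noteq> 0" using Pq[OF yr] pos(1)[OF yr] by auto
      then show B: "?B \<in> sym_mats"
        using A(1) by (simp add: schouten_sym_iff)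
      \<comment> \<open>The tensor \<open>?A\<close> of \<open>q\<close> lies outside
        \<open>U\<close>. If the tilted tensor lay inside with room \<open>c/8\<close>, then
        \<open>?A\<close> would arise from it by adding a positive definite matrix.\<close>
      show "?B - (c / 4 / 2) *\<^sub>R mat 1 \<notin> U"
      proof
        assume "?B - (c / 4 / 2) *\<^sub>R mat 1 \<in> U"
        then have "?B - (c / 4 / 2) *\<^sub>R mat 1 \<in> closure U" using closure_subset by blast
        moreover have "pos_def (?A - (?B - (c / 4 / 2) *\<^sub>R mat 1))"
          unfolding pos_def_def
        proof (intro conjI allI impI)
          show "?A - (?B - (c / 4 / 2) *\<^sub>R mat 1) \<in> sym_mats"
            using A B by (intro sym_mats_linear)
          fix h :: "real^'n" assume "h \<noteq> 0"
          define t where "t = (norm h)\<^sup>2"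
          have t: "t > 0" "h \<bullet> h = t" using \<open>h \<noteq> 0\<close> by (auto simp: t_def power2_norm_eq_inner)
          have ng: "(norm (gq y + p))\<^sup>2 = (norm (gq y))\<^sup>2 + 2 * (gq y \<bullet> p) + (norm p)\<^sup>2"
            unfolding power2_norm_eq_inner by (simp add: inner_add_left inner_add_right inner_commute)
          have e: "h \<bullet> ((?A - (?B - (c / 4 / 2) *\<^sub>R mat 1)) *v h) =
            c / 8 * t - (p \<bullet> (y - s)) * (h \<bullet> (Hq y *v h)) + (2 * (gq y \<bullet> p) + (norm p)\<^sup>2) / 2 * t"
            unfolding schouten_def P_def scaleR_one ng
            by (simp add: matrix_vector_mult_add_rdistrib matrix_vector_mult_diff_rdistrib t(2)
              scaleR_matrix_vector_assoc[symmetric] inner_add_right inner_diff_right algebra_simps add_divide_distrib)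
          have "\<bar>h \<bullet> (Hq y *v h)\<bar> \<le> L * t" unfolding t_def by (rule norm_quadratic_form_le[OF bdd[OF yr y(2)]])
          also have "\<dots> \<le> K * t" using t K by (intro mult_right_mono) auto
          finally have "\<bar>p \<bullet> (y - s)\<bar> * \<bar>h \<bullet> (Hq y *v h)\<bar> \<le> (p0 * r) * (K * t)"
            using pb'[OF yr] p0 r K t by (intro mult_mono) auto
          then have 1: "(p \<bullet> (y - s)) * (h \<bullet> (Hq y *v h)) \<le> (p0 * r) * (K * t)"
            unfolding abs_mult[symmetric] by linarith
          have "\<bar>gq y \<bullet> p\<bar> \<le> norm (gq y) * norm p" by (rule Cauchy_Schwarz_ineq2)
          also have "\<dots> \<le> G * p0" using G(2)[OF yr] p G(1) by (intro mult_mono) auto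
          finally have "- (G * p0) \<le> gq y \<bullet> p" by linarith
          then have "- (G * p0) \<le> (2 * (gq y \<bullet> p) + (norm p)\<^sup>2) / 2"
            using zero_le_power2[of "norm p"] by (simp add: add_divide_distrib add_increasing2)
          then have 2: "- (G * p0) * t \<le> (2 * (gq y \<bullet> p) + (norm p)\<^sup>2) / 2 * t"
            using t by (intro mult_right_mono) auto
          have "(p0 * T) * t \<le> c / 16 * t" using p0b t by (intro mult_right_mono) auto
          moreover have "(p0 * T) * t = (p0 * r) * (K * t) + (G * p0) * t + p0 * t" unfolding T_def by (simp add: algebra_simps)
          moreover have "0 < p0 * t" "0 < c / 16 * t" "c / 8 * t = 2 * (c / 16 * t)" using p0 t c by auto
          moreover have "0 < k - a + b" if "x \<le> w" "0 < w" "x = a' + b' + z" "0 < z" "k = 2 * w" "a \<le> a'" "- b' \<le> b"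
            for a a' b b' k w x z :: real
            using that by linarith
          ultimately show "0 < h \<bullet> ((?A - (?B - (c / 4 / 2) *\<^sub>R mat 1)) *v h)"
            unfolding e using 1 2[unfolded mult_minus_left] by blast
        qed
        ultimately have "?B - (c / 4 / 2) *\<^sub>R mat 1 + (?A - (?B - (c / 4 / 2) *\<^sub>R mat 1)) \<in> U"
          by (rule add_pos_def)
        then show False using A by simp
      qed
    qed
  qed
  have "V y \<le> q y - p0 * norm (y - s)" if y: "y \<in> cball s r - {s}" for y
  proof -
    have n: "norm (y - s) \<noteq> 0" using y by auto
    \<comment> \<open>The tilt is directed against \<open>y - s\<close>, with the largest admissible
      size; letting \<open>y\<close> vary gives the cone.\<close>
    have "V y \<le> q y + (- (p0 / norm (y - s)) *\<^sub>R (y - s)) \<bullet> (y - s)"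
      using n p0 by (intro tilt y) auto
    then show ?thesis using n by (simp add: power2_norm_eq_inner[symmetric] power2_eq_square)
  qed
  then show ?thesis using p0 by blast
qed

end

text \<open>Each puncture has a neighbourhood on which the values exceed \<open>m\<close> by a fixed
  amount. Removing these finitely many open sets leaves a compact set containing every point with
  value close to \<open>m\<close>.\<close>

lemma attains_infimum_off_punctures:
  fixes k :: "'a::metric_space \<Rightarrow> real"
  assumes K: "compact K" and S: "finite S" and k: "continuous_on (K - S) k"
    and ge: "\<And>y. y \<in> K - S \<Longrightarrow> m \<le> k y"
    and approx: "\<And>e. e > 0 \<Longrightarrow> \<exists>y\<in>K - S. k y < m + e"
    and near: "\<And>s. s \<in> S \<Longrightarrow> \<exists>e>0. \<forall>\<^sub>F y in at s. y \<in> K - S \<longrightarrow> m + e \<le> k y"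
  shows "\<exists>y\<in>K - S. k y = m"
proof -
  have "\<forall>s\<in>S. \<exists>e T. e > 0 \<and> open T \<and> s \<in> T \<and> (\<forall>y\<in>T. y \<in> K - S \<longrightarrow> m + e \<le> k y)"
  proof
    fix s assume s: "s \<in> S"
    then obtain e where "e > 0" "\<forall>\<^sub>F y in at s. y \<in> K - S \<longrightarrow> m + e \<le> k y" using near by blast
    then show "\<exists>e T. e > 0 \<and> open T \<and> s \<in> T \<and> (\<forall>y\<in>T. y \<in> K - S \<longrightarrow> m + e \<le> k y)"
      using s unfolding eventually_at_topological by (elim exE conjE, intro exI conjI) auto
  qed
  then obtain e T where eT: "\<And>s. s \<in> S \<Longrightarrow> e s > 0 \<and> open (T s) \<and> s \<in> T s \<and>
      (\<forall>y\<in>T s. y \<in> K - S \<longrightarrow> m + e s \<le> k y)"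
    unfolding bchoice_iff by blast
  \<comment> \<open>The inserted 1 makes the minimum meaningful when \<open>S\<close> is
    empty.\<close>
  define d where "d = Min (insert 1 (e ` S))"
  have d: "d > 0" "\<And>s. s \<in> S \<Longrightarrow> d \<le> e s" unfolding d_def using S eT by auto
  let ?K = "K - (\<Union>s\<in>S. T s)"
  have sub: "?K \<subseteq> K - S" using eT by auto
  have inK: "y \<in> ?K" if y: "y \<in> K - S" "k y < m + d" for y
  proof (rule ccontr)
    assume "y \<notin> ?K"
    then obtain s where s: "s \<in> S" "y \<in> T s" using y by auto
    then have "m + e s \<le> k y" using eT y by blast
    then show False using d(2)[OF s(1)] y(2) by linarith
  qed
  obtain y1 where y1: "y1 \<in> K - S" "k y1 < m + d" using approx[OF d(1)] by blast
  have "compact ?K" using eT by (intro compact_diff K open_UN) auto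
  moreover have "?K \<noteq> {}" using inK[OF y1] by blast
  ultimately obtain y2 where y2: "y2 \<in> ?K" "\<And>y. y \<in> ?K \<Longrightarrow> k y2 \<le> k y"
    using continuous_attains_inf[OF _ _ continuous_on_subset[OF k sub]] by blast
  have "k y2 = m"
  proof (rule ccontr)
    assume "k y2 \<noteq> m"
    then have "k y2 - m > 0" using ge[of y2] y2 sub by force
    then obtain y where y: "y \<in> K - S" "k y < m + min d (k y2 - m)"
      using approx[of "min d (k y2 - m)"] d by auto
    then have "y \<in> ?K" by (intro inK) auto
    then show False using y2(2)[of y] y by auto
  qed
  then show ?thesis using y2 sub by blast
qed

text \<open>The quotient of \<open>q\<close> by a strict perturbation \<open>V\<close> of
  \<open>W\<close> cannot attain an infimum as low as \<open>m0\<close> on the sphere or at a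
  regular interior point, nor approach it at a puncture. Compactness then gives the
  contradiction.\<close>

lemma (in admissible_cone) comparison:
  assumes n: "3 \<le> CARD('n)" and q: "hess_on D N q gq Hq" and N: "negligible N"
    and qpos: "\<And>y. y \<in> D \<Longrightarrow> 0 < q y"
    and bdd: "\<And>x. x \<in> D \<Longrightarrow> \<exists>r>0. \<exists>L. \<forall>y\<in>ball x r - N. \<forall>h. norm (Hq y *v h) \<le> L * norm h"
    and Aq: "\<And>y. y \<in> D \<Longrightarrow> y \<notin> N \<Longrightarrow> schouten (q y) (gq y) (Hq y) \<in> sym_mats - U"
    and l: "0 < l" "cball c l \<subseteq> D" and S: "finite S" "S \<subseteq> ball c l"
    and W: "hess_on D' N W gW HW" "cball c l - S \<subseteq> D'"
    and Wpos: "\<And>y. y \<in> D' \<Longrightarrow> 0 < W y"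
    and AW: "\<And>y. y \<in> D' \<Longrightarrow> y \<notin> N \<Longrightarrow> schouten (W y) (gW y) (HW y) \<in> closure U"
    and eq: "\<And>y. y \<in> sphere c l \<Longrightarrow> W y = q y"
    and y0: "y0 \<in> cball c l - S"
  shows "W y0 \<le> q y0"
proof (rule ccontr)
  assume neg: "\<not> ?thesis"
  define X where "X = cball c l - S"
  \<comment> \<open>With this scale \<open>d|y - c|^2 <= 1\<close> on the ball, as
    \<open>schouten_perturb\<close> requires.\<close>
  define d where "d = 1 / l\<^sup>2"
  define f where "f = (\<lambda>y. 1 + d * (norm (y - c))\<^sup>2)"
  have d: "d > 0" unfolding d_def using l by simp
  have dz: "d * (norm (y - c))\<^sup>2 \<le> 1" if "y \<in> cball c l" for y
  proof -
    have "(norm (y - c))\<^sup>2 \<le> l\<^sup>2" using that by (intro power_mono) (auto simp: dist_norm norm_minus_commute)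
    then show ?thesis unfolding d_def using l by (simp add: divide_simps)
  qed
  have f: "1 \<le> f y" for y unfolding f_def using d by simp
  have f2: "f y \<le> 2" if "y \<in> cball c l" for y unfolding f_def using dz[OF that] by simp
  have qc: "continuous_on (cball c l) q"
    using l by (auto intro!: continuous_at_imp_continuous_on hess_on_isCont[OF q])
  obtain z where "z \<in> cball c l" "\<And>y. y \<in> cball c l \<Longrightarrow> q z \<le> q y"
    using continuous_attains_inf[OF compact_cball _ qc] l by auto
  then obtain q0 where q0: "q0 > 0" "\<And>y. y \<in> cball c l \<Longrightarrow> q0 \<le> q y" using qpos l by blast
  obtain z where "z \<in> cball c l" "\<And>y. y \<in> cball c l \<Longrightarrow> q y \<le> q z"
    using continuous_attains_sup[OF compact_cball _ qc] l by auto
  then obtain q1 where q1: "q1 > 0" "\<And>y. y \<in> cball c l \<Longrightarrow> q y \<le> q1" using qpos l by blast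
  have XD: "X \<subseteq> D" "X \<subseteq> D'" unfolding X_def using l W by auto
  have Xc: "X \<subseteq> cball c l" unfolding X_def by auto
  have y0X: "y0 \<in> X" using y0 unfolding X_def by simp
  define m0 where "m0 = q y0 / W y0"
  have W0: "W y0 > 0" "q y0 > 0" using Wpos qpos y0X XD by auto
  have m0: "m0 < 1" "0 < m0" unfolding m0_def using neg W0 by auto
  \<comment> \<open>On the ball \<open>e f <= 2 e = (1 - m0) q0 / 2\<close>, so on the sphere, where
    \<open>W = q\<close>, the quotient \<open>q/V\<close> stays above \<open>m0\<close>.\<close>
  define e where "e = (1 - m0) * q0 / 4"
  have e: "e > 0" unfolding e_def using m0 q0 by simp
  define V where "V = (\<lambda>y. 1 * W y + e * f y)"
  define gV where "gV = (\<lambda>y. 1 *\<^sub>R gW y + e *\<^sub>R ((2 * d) *\<^sub>R (y - c)))"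
  define HV where "HV = (\<lambda>y. 1 *\<^sub>R HW y + e *\<^sub>R ((2 * d) *\<^sub>R mat 1) :: real^'n^'n)"
  define DV where "DV = D' \<inter> ball c l"
  have oD: "open D" "open D'" using hess_onD(1)[OF q] hess_onD(1)[OF W(1)] by auto
  have oDV: "open DV" unfolding DV_def using oD by auto
  have hV': "hess_on D' N V gV HV"
    unfolding V_def gV_def HV_def f_def
    by (intro hess_on_linear_combination W hess_on_quadratic oD)
  have hV: "hess_on DV N V gV HV"
    by (rule hess_on_subset[OF hV' oDV]) (auto simp: DV_def)
  have VW: "W y < V y" for y unfolding V_def using e f[of y] by (smt (verit) mult_pos_pos)
  have Vpos: "0 < V y" if "y \<in> D'" for y using VW[of y] Wpos[OF that] by simp
  define c0 where "c0 = 2 * d * e\<^sup>2"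
  have c0: "c0 > 0" unfolding c0_def using d e by simp
  have AV: "schouten (V y) (gV y) (HV y) - c0 *\<^sub>R mat 1 \<in> closure U" if y: "y \<in> DV" "y \<notin> N" for y
  proof -
    have yD: "y \<in> D'" "y \<in> cball c l" using y unfolding DV_def by auto
    obtain k where k: "k \<ge> c0" "schouten (V y) (gV y) (HV y) =
        (1 + e * f y / W y) *\<^sub>R schouten (W y) (gW y) (HW y) + k *\<^sub>R mat 1"
      using schouten_perturb[OF Wpos[OF yD(1)] e d dz[OF yD(2)], of "gW y" "HW y"]
      unfolding V_def gV_def HV_def f_def c0_def by auto
    have "0 < 1 + e * f y / W y" using e f[of y] Wpos[OF yD(1)] by (simp add: add_pos_nonneg)
    then have "(1 + e * f y / W y) *\<^sub>R schouten (W y) (gW y) (HW y) + (k - c0) *\<^sub>R mat 1 \<in> closure U"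
      using AW[OF yD(1) y(2)] k by (intro add_scaled_mat scale) auto
    then show ?thesis unfolding k(2) by (simp add: scaleR_diff_left add_diff_eq)
  qed
  define k where "k = (\<lambda>y. q y / V y)"
  have kpos: "0 < k y" if "y \<in> X" for y unfolding k_def using that XD Vpos qpos by (simp add: subset_iff)
  define m where "m = Inf (k ` X)"
  have bb: "bdd_below (k ` X)" using kpos by (intro bdd_belowI[of _ 0]) (auto intro: less_imp_le)
  have mle: "m \<le> k y" if "y \<in> X" for y unfolding m_def using bb that by (intro cInf_lower) auto
  have mV: "m * V y \<le> q y" if "y \<in> X" for y
    using mle[OF that] Vpos[of y] XD that unfolding k_def by (simp add: pos_le_divide_eq subset_iff)
  have mge: "0 \<le> m" unfolding m_def using y0X kpos by (intro cInf_greatest) (auto intro: less_imp_le)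
  have approx: "\<exists>y\<in>X. k y < m + e'" if "e' > 0" for e'
    using cInf_lessD[of "k ` X" "m + e'"] that y0X unfolding m_def by auto
  have "k y0 \<le> m0" unfolding k_def m0_def using VW[of y0] W0 by (intro divide_left_mono) auto
  then have mm0: "m \<le> m0" using mle[OF y0X] by linarith
  have no_contact: False if y: "y \<in> X" "k y = m" for y
  proof -
    have mpos: "m > 0" using kpos[OF y(1)] y(2) by simp
    have Vy: "V y > 0" using y XD Vpos by auto
    have yc: "y \<in> cball c l" using y Xc by auto
    have "y \<notin> sphere c l"
    proof
      assume ys: "y \<in> sphere c l"
      have "e * f y \<le> e * 2" using e f2[OF yc] by (intro mult_left_mono) auto
      also have "\<dots> < (1 - m0) * q0" unfolding e_def using m0 q0 by simp
      also have "\<dots> \<le> (1 - m0) * q y" using m0 q0(2)[OF yc] by (intro mult_left_mono) auto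
      finally have 1: "e * f y < (1 - m0) * q y" .
      have "m0 * (e * f y) \<le> 1 * (e * f y)" using m0 e f[of y] by (intro mult_right_mono) auto
      then have "m0 * V y < q y" unfolding V_def using eq[OF ys] 1 by (simp add: algebra_simps)
      then have "m0 < k y" unfolding k_def using Vy by (simp add: pos_less_divide_eq)
      then show False using y mm0 by simp
    qed
    then have yDV: "y \<in> DV" unfolding DV_def using yc y XD by auto
    obtain r L where r: "r > 0" "\<And>y' h. y' \<in> ball y r - N \<Longrightarrow> norm (Hq y' *v h) \<le> L * norm h"
      using bdd[of y] y XD by (metis subsetD)
    define E where "E = ball y r \<inter> DV \<inter> (D - S)"
    have oE: "open E" unfolding E_def using oDV oD S by (auto intro!: finite_imp_closed)
    have E: "E \<subseteq> D" "E \<subseteq> DV" "E \<subseteq> X" "E \<subseteq> ball y r" unfolding E_def DV_def X_def by auto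
    have yE: "y \<in> E" unfolding E_def using yDV r y XD unfolding X_def by auto
    have hE: "hess_on E N (\<lambda>y. m * V y) (\<lambda>y. m *\<^sub>R gV y) (\<lambda>y. m *\<^sub>R HV y)"
      by (rule hess_on_scale[OF hess_on_subset[OF hV oE E(2) order_refl]])
    show False
    proof (rule no_touching[OF hess_on_subset[OF q oE E(1) order_refl] hE N yE])
      show "q y = m * V y" using y(2) Vy unfolding k_def by (simp add: field_simps)
      show "0 < m * V y" "0 < m\<^sup>2 * c0" using mpos Vy c0 by auto
      show "m * V y \<le> q y" if "y \<in> E" for y using mV that E by auto
      show "norm (Hq y *v h) \<le> L * norm h" if "y \<in> E" "y \<notin> N" for y h
        using r(2) that E by auto
    next
      fix y assume y: "y \<in> E" "y \<notin> N"
      have A: "schouten (q y) (gq y) (Hq y) \<in> sym_mats - U" using Aq y E by auto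
      then show "schouten (q y) (gq y) (Hq y) \<in> sym_mats" by simp
      show "schouten (q y) (gq y) (Hq y) - (m\<^sup>2 * c0 / 2) *\<^sub>R mat 1 \<notin> U"
      proof
        assume "schouten (q y) (gq y) (Hq y) - (m\<^sup>2 * c0 / 2) *\<^sub>R mat 1 \<in> U"
        then have "schouten (q y) (gq y) (Hq y) - (m\<^sup>2 * c0 / 2) *\<^sub>R mat 1 \<in> closure U"
          using closure_subset by blast
        then have "schouten (q y) (gq y) (Hq y) - (m\<^sup>2 * c0 / 2) *\<^sub>R mat 1 + (m\<^sup>2 * c0 / 2) *\<^sub>R mat 1 \<in> U"
          using mpos c0 by (intro add_pos_def pos_def_scaled_mat) auto
        then show False using A by simp
      qed
      have "m\<^sup>2 *\<^sub>R (schouten (V y) (gV y) (HV y) - c0 *\<^sub>R mat 1) \<in> closure U"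
        using mpos y E by (intro scale AV) auto
      then show "schouten (m * V y) (m *\<^sub>R gV y) (m *\<^sub>R HV y) - (m\<^sup>2 * c0) *\<^sub>R mat 1 \<in> closure U"
        unfolding schouten_scale by (simp add: scaleR_diff_right)
    qed
  qed
  have near: "\<exists>e>0. \<forall>\<^sub>F y in at s. y \<in> X \<longrightarrow> m + e \<le> k y" if s: "s \<in> S" for s
  proof -
    have sD: "s \<in> D" using s S l ball_subset_cball by blast
    obtain r1 where r1: "r1 > 0" "cball s r1 \<subseteq> ball c l"
      using s S open_contains_cball[of "ball c l"] by blast
    obtain r2 L where r2: "r2 > 0" "\<And>y' h. y' \<in> ball s r2 - N \<Longrightarrow> norm (Hq y' *v h) \<le> L * norm h"
      using bdd[OF sD] by metis
    obtain r3 where r3: "r3 > 0" "\<And>x. x \<in> S \<Longrightarrow> x \<noteq> s \<Longrightarrow> r3 \<le> dist s x"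
      using finite_set_avoid[OF S(1)] by blast
    define r where "r = min r1 (min (r2 / 2) (r3 / 2))"
    have r: "r > 0" "r \<le> r1" "r < r2" "r < r3" unfolding r_def using r1 r2 r3 by auto
    have rb: "cball s r \<subseteq> ball c l" using r r1 by force
    then have rc: "cball s r \<subseteq> cball c l" using ball_subset_cball by blast
    have rX: "cball s r - {s} \<subseteq> X" unfolding X_def using rc r3(2) r by force
    have rDV: "cball s r - {s} \<subseteq> DV" unfolding DV_def using rb rX XD by blast
    have rD': "cball s r - {s} \<subseteq> D'" using rX XD by blast
    have evr: "\<forall>\<^sub>F y in at s. y \<in> cball s r - {s}"
      unfolding eventually_at using r by (intro exI[of _ r]) (auto simp: dist_commute)
    show ?thesis
    \<comment> \<open>For \<open>m = 0\<close> the conic argument degenerates; there the boundedness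
      of \<open>W\<close> near \<open>s\<close> keeps \<open>q/V\<close> away from 0.\<close>
    proof (cases "m = 0")
      case True
      obtain M where M: "\<And>y. y \<in> cball s r - {s} \<Longrightarrow> W y \<le> M"
        using bounded_at_puncture[OF n W(1) N r(1) rD' Wpos AW] by blast
      have "M + 2 * e > 0"
      proof -
        obtain y where "y \<in> cball s r - {s}" using evr eventually_happens[OF evr] by auto
        then show ?thesis using M Wpos rD' e by (smt (verit) subsetD)
      qed
      have "\<forall>\<^sub>F y in at s. y \<in> X \<longrightarrow> m + q0 / (M + 2 * e) \<le> k y"
        using evr
      proof eventually_elim
        case (elim y)
        then have yc: "y \<in> cball c l" "y \<in> D'" using rc rD' by auto
        have "e * f y \<le> e * 2" using e f2[OF yc(1)] by (intro mult_left_mono) auto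
        then have "V y \<le> M + 2 * e" unfolding V_def using M[OF elim] by simp
        then have "q0 / (M + 2 * e) \<le> k y"
          unfolding k_def using q0(2)[OF yc(1)] q0(1) Vpos[OF yc(2)] by (intro frac_le) auto
        then show ?case using True by simp
      qed
      moreover have "q0 / (M + 2 * e) > 0" using q0 \<open>M + 2 * e > 0\<close> by simp
      ultimately show ?thesis by blast
    next
      case False
      then have mpos: "m > 0" using mge by simp
      have less: "m * V y < q y" if "y \<in> X" for y
      proof -
        have "m \<noteq> k y" using no_contact that by blast
        then have "m < k y" using mle[OF that] by simp
        then show ?thesis unfolding k_def using Vpos XD that by (simp add: pos_less_divide_eq subset_iff)
      qed
      have hmV: "hess_on DV N (\<lambda>y. m * V y) (\<lambda>y. m *\<^sub>R gV y) (\<lambda>y. m *\<^sub>R HV y)"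
        by (rule hess_on_scale[OF hV])
      have "\<exists>p>0. \<forall>y \<in> cball s r - {s}. m * V y \<le> q y - p * norm (y - s)"
      proof (rule cone_gap_at_puncture[OF q hmV N r(1) _ rDV])
        show "cball s r \<subseteq> D" using rc l by blast
        show "0 < q y" if "y \<in> cball s r" for y using rc l(2) that qpos by blast
        show "0 < m * V y" if "y \<in> DV" for y using that mpos Vpos unfolding DV_def by auto
        show "0 < m\<^sup>2 * c0" using mpos c0 by simp
        show "norm (Hq y *v h) \<le> L * norm h" if "y \<in> cball s r" "y \<notin> N" for y h
          using that r by (intro r2(2)) auto
        show "schouten (q y) (gq y) (Hq y) \<in> sym_mats - U" if "y \<in> D" "y \<notin> N" for y
          by (rule Aq[OF that])
        show "m * V y \<le> q y" if "y \<in> cball s r - {s}" for y using that rX mV by blast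
        show "m * V y < q y" if "y \<in> sphere s r" for y
        proof (rule less)
          show "y \<in> X" using that r(1) by (intro subsetD[OF rX]) auto
        qed
      next
        fix y assume y: "y \<in> DV" "y \<notin> N"
        have "m\<^sup>2 *\<^sub>R (schouten (V y) (gV y) (HV y) - c0 *\<^sub>R mat 1) \<in> closure U"
          using mpos y by (intro scale AV) auto
        then show "schouten (m * V y) (m *\<^sub>R gV y) (m *\<^sub>R HV y) - (m\<^sup>2 * c0) *\<^sub>R mat 1 \<in> closure U"
          unfolding schouten_scale by (simp add: scaleR_diff_right)
      qed
      then obtain p where p: "p > 0" "\<And>y. y \<in> cball s r - {s} \<Longrightarrow> m * V y \<le> q y - p * norm (y - s)"
        by blast
      \<comment> \<open>Dividing the conic inequality for \<open>m V\<close> by \<open>m\<close>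
        bounds \<open>W\<close> by \<open>G\<close> minus a cone. \<open>G\<close> is differentiable
        at \<open>s\<close>, since \<open>q\<close> is regular there even if \<open>W\<close> is
        not.\<close>
      define G where "G = (\<lambda>y. (1 / m) * q y + (- e) * f y)"
      have hG: "hess_on D N G (\<lambda>y. (1 / m) *\<^sub>R gq y + (- e) *\<^sub>R ((2 * d) *\<^sub>R (y - c)))
         (\<lambda>y. (1 / m) *\<^sub>R Hq y + (- e) *\<^sub>R ((2 * d) *\<^sub>R mat 1))"
        unfolding G_def f_def by (intro hess_on_linear_combination q hess_on_quadratic oD)
      have tr: "0 \<le> trace (HW y)" if y: "y \<in> D'" "y \<notin> N" for y
      proof -
        have "0 \<le> W y * trace (HW y)"
          by (rule order_trans[OF _ trace_hessian_ge[OF AW[OF y]]]) simp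
        then show ?thesis using Wpos[OF y(1)] by (simp add: zero_le_mult_iff)
      qed
      have "\<exists>k>0. \<forall>\<^sub>F y in at s. W y \<le> G y - k"
      proof (rule subharmonic_below_cone_at_puncture[OF n W(1) N r(1) rD' tr hess_onD(2)[OF hG sD]])
        show "0 < p / m" using p mpos by simp
        show "W y \<le> G y - p / m * norm (y - s)" if "y \<in> cball s r - {s}" for y
        proof -
          have "m * (W y + e * f y) \<le> q y - p * norm (y - s)" using p(2)[OF that] unfolding V_def by simp
          then have "W y + e * f y \<le> (q y - p * norm (y - s)) / m"
            using mpos by (simp add: pos_le_divide_eq mult.commute)
          then show ?thesis unfolding G_def by (simp add: diff_divide_distrib)
        qed
      qed
      then obtain k0 where k0: "k0 > 0" "\<forall>\<^sub>F y in at s. W y \<le> G y - k0" by blast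
      have "\<forall>\<^sub>F y in at s. y \<in> X \<longrightarrow> m + m\<^sup>2 * k0 / q1 \<le> k y"
        using k0(2)
      proof eventually_elim
        case (elim y)
        show ?case
        proof
          assume y: "y \<in> X"
          have V: "V y > 0" using y XD Vpos by auto
          have "m * W y \<le> m * (G y - k0)" using elim mpos by (intro mult_left_mono) auto
          moreover have "m * G y = q y - m * (e * f y)" unfolding G_def using mpos by (simp add: right_diff_distrib)
          ultimately have 1: "m * V y + m * k0 \<le> q y" unfolding V_def by (simp add: algebra_simps)
          \<comment> \<open>This upper bound for \<open>V\<close> converts the additive gap
            \<open>m k0\<close> into a gap for the quotient.\<close>
          have "m * V y \<le> q1" using mV[OF y] q1(2)[of y] y Xc by auto
          then have "m * k0 * (m * V y) \<le> m * k0 * q1" using mpos k0 by (intro mult_left_mono) auto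
          then have "m\<^sup>2 * k0 / q1 * V y \<le> m * k0" using q1 by (simp add: field_simps power2_eq_square)
          then have "(m + m\<^sup>2 * k0 / q1) * V y \<le> q y" using 1 by (simp add: distrib_right)
          then show "m + m\<^sup>2 * k0 / q1 \<le> k y" unfolding k_def using V by (simp add: pos_le_divide_eq)
        qed
      qed
      moreover have "m\<^sup>2 * k0 / q1 > 0" using mpos k0 q1 by simp
      ultimately show ?thesis by blast
    qed
  qed
  have "continuous_on X q" "continuous_on X V"
    using XD by (auto intro!: continuous_at_imp_continuous_on hess_on_isCont[OF q] hess_on_isCont[OF hV'])
  then have "continuous_on X k" unfolding k_def
    by (intro continuous_on_divide) (use Vpos XD in force)+
  then have "\<exists>y\<in>X. k y = m"
    using attains_infimum_off_punctures[OF compact_cball S(1), of c l k m] mle approx near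
    unfolding X_def by blast
  then show False using no_contact by blast
qed

section \<open>Orthogonally invariant cones\<close>

text \<open>The Householder matrix of the hyperplane orthogonal to \<open>v\<close>. For
  \<open>v = y - c\<close> it is the orthogonal factor of the derivative at \<open>y\<close> of the
  inversion about \<open>c\<close>.\<close>

definition reflection :: "real^'n \<Rightarrow> real^'n^'n" where
  "reflection v = mat 1 - (2 / (v \<bullet> v)) *\<^sub>R outer_prod v v"

lemma reflection_mult_vec: "reflection v *v h = h - (2 * (v \<bullet> h) / (v \<bullet> v)) *\<^sub>R v"
  by (simp add: reflection_def matrix_vector_mult_diff_rdistrib scaleR_matrix_vector_assoc[symmetric]
      outer_prod_mult_vec)

lemma transpose_reflection: "transpose (reflection v) = reflection v"
  by (simp add: reflection_def transpose_def outer_prod_def vec_eq_iff mat_def mult.commute)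

lemma reflection_involution:
  assumes "v \<noteq> 0"
  shows "reflection v ** reflection v = mat 1"
proof -
  have "(reflection v ** reflection v) *v h = mat 1 *v h" for h
    using assms unfolding matrix_vector_mul_assoc[symmetric] reflection_mult_vec
    by (simp add: inner_diff_right algebra_simps)
  then show ?thesis by (simp add: matrix_eq)
qed

lemma orthogonal_reflection: "v \<noteq> 0 \<Longrightarrow> orthogonal_matrix (reflection v)"
  by (simp add: orthogonal_matrix transpose_reflection reflection_involution)

text \<open>The norm is the Frobenius norm: right multiplication by \<open>Q\<close> acts
  isometrically on each row, and transposition reduces left multiplication to this. It serves to
  show that a closest point to 0 in an invariant set is invariant.\<close>

lemma norm_orthogonal_conjugate:
  fixes M :: "real^'n^'n"
  assumes Q: "orthogonal_matrix Q"
  shows "norm (transpose Q ** M ** Q) = norm M"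
proof -
  have tr: "norm (transpose A) = norm A" for A :: "real^'n^'n"
    unfolding norm_eq_sqrt_inner inner_vec_def transpose_def
    by (subst sum.swap) simp
  have nv: "norm (transpose Q *v a) = norm a" for a :: "real^'n"
  proof -
    have "orthogonal_transformation ((*v) (transpose Q))"
      using Q by (simp add: orthogonal_transformation_matrix)
    then show ?thesis by (rule orthogonal_transformation_norm)
  qed
  have mul: "norm (A ** Q) = norm A" for A :: "real^'n^'n"
  proof -
    have row: "(A ** Q) $ i = transpose Q *v (A $ i)" for i
      by (simp add: matrix_matrix_mult_def matrix_vector_mult_def transpose_def vec_eq_iff mult.commute)
    have "norm ((A ** Q) $ i) = norm (A $ i)" for i unfolding row by (rule nv)
    then show ?thesis by (simp add: norm_vec_def)
  qed
  have "norm (transpose Q ** M ** Q) = norm (transpose (transpose Q ** M))"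
    unfolding mul tr by simp
  also have "\<dots> = norm M" by (simp add: matrix_transpose_mul mul tr)
  finally show ?thesis .
qed

lemma matrix_inv_orthogonal:
  fixes Q :: "real^'n^'n"
  assumes "orthogonal_matrix Q"
  shows "matrix_inv Q = transpose Q"
proof -
  have Q: "Q ** transpose Q = mat 1" "transpose Q ** Q = mat 1"
    using assms by (auto simp: orthogonal_matrix_def)
  have "Q ** matrix_inv Q = mat 1 \<and> matrix_inv Q ** Q = mat 1"
    unfolding matrix_inv_def by (rule someI) (use Q in blast)
  then have "transpose Q ** (Q ** matrix_inv Q) = transpose Q" by simp
  then show ?thesis unfolding matrix_mul_assoc Q by simp
qed

lemma norm_matrix_vector_mult_le: "norm ((A :: real^'n^'n) *v v) \<le> norm A * norm v"
proof -
  have "(norm (A *v v))\<^sup>2 = (\<Sum>i\<in>UNIV. (A $ i \<bullet> v)\<^sup>2)"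
    unfolding power2_norm_eq_inner by (simp add: inner_vec_def matrix_vector_mult_def power2_eq_square)
  also have "\<dots> \<le> (\<Sum>i\<in>UNIV. (norm (A $ i))\<^sup>2 * (norm v)\<^sup>2)"
  proof (rule sum_mono)
    fix i
    show "(A $ i \<bullet> v)\<^sup>2 \<le> (norm (A $ i))\<^sup>2 * (norm v)\<^sup>2"
      using Cauchy_Schwarz_ineq[of "A $ i" v] by (simp add: power2_norm_eq_inner)
  qed
  also have "\<dots> = (norm A * norm v)\<^sup>2"
    by (simp add: power_mult_distrib sum_distrib_right power2_norm_eq_inner inner_vec_def[of A A])
  finally show ?thesis by (rule power2_le_imp_le) simp
qed

lemma pos_def_lower_bound:
  fixes N :: "real^'n^'n"
  assumes "pos_def N"
  obtains k where "k > 0" "\<And>v. k * (norm v)\<^sup>2 \<le> v \<bullet> (N *v v)"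
proof -
  have "continuous_on (sphere 0 1) (\<lambda>v. v \<bullet> (N *v v))"
    by (intro continuous_intros linear_continuous_on_compose[OF continuous_on_id] matrix_vector_mul_linear)
  moreover have "axis undefined 1 \<in> sphere (0 :: real^'n) 1" by (simp add: norm_axis_1)
  ultimately obtain w where w: "w \<in> sphere 0 1" "\<And>v. v \<in> sphere 0 1 \<Longrightarrow> w \<bullet> (N *v w) \<le> v \<bullet> (N *v v)"
    using continuous_attains_inf[OF compact_sphere, of 0 1 "\<lambda>v. v \<bullet> (N *v v)"] by blast
  show ?thesis
  proof
    have "w \<noteq> 0" using w by auto
    then show "w \<bullet> (N *v w) > 0" using assms unfolding pos_def_def by blast
    fix v :: "real^'n"
    show "(w \<bullet> (N *v w)) * (norm v)\<^sup>2 \<le> v \<bullet> (N *v v)"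
    proof (cases "v = 0")
      case False
      then have "v /\<^sub>R norm v \<in> sphere 0 1" by simp
      from w(2)[OF this] False show ?thesis
        by (simp add: matrix_vector_mult_scaleR field_simps power2_eq_square)
    qed simp
  qed
qed

lemma closed_sym_mats: "closed (sym_mats :: (real^'n^'n) set)"
proof -
  have eq: "sym_mats = (\<Inter>i. \<Inter>j. {M :: real^'n^'n. M $ j $ i = M $ i $ j})"
    by (auto simp: sym_mats_def transpose_def vec_eq_iff)
  show ?thesis
    unfolding eq by (intro closed_INT ballI closed_Collect_eq continuous_intros)
qed

text \<open>Invariance under the reflection determined by \<open>v\<close> forces \<open>X v\<close>
  to be a multiple of \<open>v\<close>, and a matrix for which every vector is an eigenvector is
  scalar.\<close>

lemma orthogonally_invariant_scalar:
  fixes X :: "real^'n^'n"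
  assumes inv: "\<And>Q. orthogonal_matrix Q \<Longrightarrow> transpose Q ** X ** Q = X"
  obtains a where "X = a *\<^sub>R mat 1"
proof -
  have eig: "\<exists>a. X *v v = a *\<^sub>R v" for v
  proof (cases "v = 0")
    case False
    let ?R = "reflection v"
    have "?R ** X ** ?R = X" using inv[OF orthogonal_reflection[OF False]] by (simp add: transpose_reflection)
    then have "?R *v (X *v (?R *v v)) = X *v v" by (metis matrix_vector_mul_assoc)
    moreover have Rv: "?R *v v = - v" using False by (simp add: reflection_mult_vec scaleR_2)
    moreover have neg: "A *v (- w) = - (A *v w)" for A :: "real^'n^'n" and w
      by (simp add: linear_neg matrix_vector_mul_linear)
    ultimately have "- (?R *v (X *v v)) = X *v v" by simp
    then have "(2 * (v \<bullet> (X *v v)) / (v \<bullet> v)) *\<^sub>R v = X *v v + X *v v"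
      unfolding reflection_mult_vec by (simp add: algebra_simps)
    then have "X *v v = (1 / 2) *\<^sub>R ((2 * (v \<bullet> (X *v v)) / (v \<bullet> v)) *\<^sub>R v)"
      by (simp flip: scaleR_2)
    then show ?thesis by (metis scaleR_scaleR)
  qed simp
  then obtain a where a: "\<And>v. X *v v = a v *\<^sub>R v" by metis
  have "a (axis i 1) = a (axis j 1)" for i j :: 'n
  proof (cases "i = j")
    case False
    let ?b = "a (axis i 1 + axis j 1)"
    have "?b *\<^sub>R (axis i 1 + axis j 1 :: real^'n) = a (axis i 1) *\<^sub>R axis i 1 + a (axis j 1) *\<^sub>R axis j 1"
      using matrix_vector_right_distrib[of X "axis i 1" "axis j 1"] by (simp only: a)
    then have "\<And>k. (?b *\<^sub>R (axis i 1 + axis j 1 :: real^'n)) $ k = (a (axis i 1) *\<^sub>R axis i 1 + a (axis j 1) *\<^sub>R axis j 1) $ k"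
      by simp
    from this[of i] this[of j] show ?thesis using False by (simp add: axis_def)
  qed simp
  then obtain b where b: "\<And>i::'n. a (axis i 1) = b" by metis
  have "X $ i $ j = (b *\<^sub>R mat 1) $ i $ j" for i j
  proof -
    have "(X *v axis j 1) $ i = (b *\<^sub>R axis j 1) $ i" using a b by metis
    moreover have "(X *v axis j 1) $ i = X $ i $ j" by (simp add: matrix_vector_mult_basis column_def)
    ultimately show ?thesis by (simp add: axis_def mat_def)
  qed
  then show ?thesis using that[of b] by (simp add: vec_eq_iff)
qed

text \<open>The trace bound combines convexity and invariance: the matrix of least norm in a slice
  of negative trace is unique, hence invariant, hence a negative multiple of the identity. Adding
  positive definite matrices to its positive multiples would put all of \<open>closure U\<close>
  into \<open>U\<close>, which \<open>proper\<close> forbids.\<close>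

lemma convex_cone_admissible:
  fixes U :: "(real^'n^'n) set"
  assumes U_convex: "convex U"
    and U_sym: "U \<subseteq> sym_mats"
    and U_inv: "\<And>Q M. orthogonal_matrix Q \<Longrightarrow> M \<in> U \<Longrightarrow> transpose Q ** M ** Q \<in> U"
    and U_add: "\<And>M N. M \<in> U \<Longrightarrow> pos_def N \<Longrightarrow> M + N \<in> U"
    and U_cone: "\<And>M a. M \<in> U \<Longrightarrow> 0 < a \<Longrightarrow> a *\<^sub>R M \<in> U"
    and proper: "\<not> closure U \<subseteq> U"
  shows "admissible_cone U"
    and "\<And>Q M. orthogonal_matrix Q \<Longrightarrow> M \<in> closure U \<Longrightarrow> transpose Q ** M ** Q \<in> closure U"
proof -
  have clsym: "closure U \<subseteq> sym_mats" using U_sym closed_sym_mats closure_minimal by blast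
  have scale: "a *\<^sub>R M \<in> closure U" if "M \<in> closure U" "0 < a" for M a
  proof -
    have "(*\<^sub>R) a ` closure U \<subseteq> closure ((*\<^sub>R) a ` U)" by (simp add: closure_scaleR)
    also have "\<dots> \<subseteq> closure U" using U_cone that by (intro closure_mono) auto
    finally show ?thesis using that by auto
  qed
  show conj: "transpose Q ** M ** Q \<in> closure U" if Q: "orthogonal_matrix Q" and M: "M \<in> closure U" for Q M
  proof -
    have "linear (\<lambda>M. transpose Q ** M ** Q)"
      by (rule linearI) (simp_all add: vec_eq_iff matrix_matrix_mult_def sum_distrib_left sum_distrib_right
          distrib_left distrib_right sum.distrib mult.assoc mult.left_commute)
    then have "continuous_on (closure U) (\<lambda>M. transpose Q ** M ** Q)"
      by (simp add: linear_continuous_on linear_conv_bounded_linear)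
    then have "(\<lambda>M. transpose Q ** M ** Q) ` closure U \<subseteq> closure U"
      using U_inv[OF Q] closure_subset by (intro image_closure_subset) auto
    then show ?thesis using M by auto
  qed
  have add: "M + N \<in> U" if M: "M \<in> closure U" and N: "pos_def N" for M N
  proof -
    obtain k where k: "k > 0" "\<And>v. k * (norm v)\<^sup>2 \<le> v \<bullet> (N *v v)"
      using pos_def_lower_bound[OF N] by blast
    \<comment> \<open>\<open>M\<close> is replaced by a nearby element of \<open>U\<close>; the
      error \<open>M - M'\<close> is dominated by the quadratic form of \<open>N\<close> and
      absorbed into it.\<close>
    obtain M' where M': "M' \<in> U" "dist M' M < k"
      using M k closure_approachable by blast
    have "pos_def (N + (M - M'))"
      unfolding pos_def_def
    proof (intro conjI allI impI)
      show "N + (M - M') \<in> sym_mats"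
        using N M M' U_sym clsym unfolding pos_def_def by (intro sym_mats_linear) auto
      fix v :: "real^'n" assume v: "v \<noteq> 0"
      have "\<bar>v \<bullet> ((M - M') *v v)\<bar> \<le> norm (M - M') * (norm v)\<^sup>2"
        by (rule norm_quadratic_form_le[OF norm_matrix_vector_mult_le])
      also have "\<dots> < k * (norm v)\<^sup>2"
        using M' v by (intro mult_strict_right_mono) (auto simp: dist_norm norm_minus_commute)
      finally show "0 < v \<bullet> ((N + (M - M')) *v v)"
        using k(2)[of v] by (simp add: matrix_vector_mult_add_rdistrib inner_add_right)
    qed
    from U_add[OF M'(1) this] show ?thesis by (simp add: add.commute)
  qed
  have trace: "0 \<le> trace M" if M: "M \<in> closure U" for M
  proof (rule ccontr)
    assume neg: "\<not> 0 \<le> trace M"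
    define S where "S = closure U \<inter> {X. trace X = trace M}"
    have lt: "linear (trace :: real^'n^'n \<Rightarrow> real)"
      by (rule linearI) (simp_all add: trace_add trace_scaleR)
    have "closed {X :: real^'n^'n. trace X = trace M}"
      by (intro closed_Collect_eq continuous_intros linear_continuous_on)
        (use lt in \<open>simp add: linear_conv_bounded_linear\<close>)
    then have clS: "closed S" unfolding S_def by auto
    have cvS: "convex S"
      unfolding S_def
    proof (rule convex_Int)
      show "convex (closure U)" using U_convex by (rule convex_closure)
      show "convex {X :: real^'n^'n. trace X = trace M}"
        by (rule convexI) (simp add: trace_add trace_scaleR flip: distrib_right)
    qed
    have MS: "M \<in> S" unfolding S_def using M by simp
    define X where "X = closest_point S 0"
    have XS: "X \<in> S" "\<And>Y. Y \<in> S \<Longrightarrow> dist 0 X \<le> dist 0 Y"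
      using closest_point_exists[OF clS, of 0] MS unfolding X_def by auto
    have "transpose Q ** X ** Q = X" if Q: "orthogonal_matrix Q" for Q
    proof (rule any_closest_point_unique[OF cvS clS _ XS(1)])
      have "trace (transpose Q ** X ** Q) = trace (Q ** (transpose Q ** X))" by (rule trace_mul_sym)
      also have "\<dots> = trace X" using Q by (simp add: matrix_mul_assoc orthogonal_matrix_def)
      finally show "transpose Q ** X ** Q \<in> S" using XS(1) conj[OF Q] unfolding S_def by auto
      show "\<forall>z\<in>S. dist 0 (transpose Q ** X ** Q) \<le> dist 0 z"
        using XS(2) norm_orthogonal_conjugate[OF Q, of X] by simp
      show "\<forall>z\<in>S. dist 0 X \<le> dist 0 z" using XS(2) by blast
    qed
    then obtain a where a: "X = a *\<^sub>R mat 1" by (rule orthogonally_invariant_scalar)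
    have "trace X < 0" using XS(1) neg unfolding S_def by simp
    then have a0: "a < 0" unfolding a by (simp add: trace_scaleR trace_I mult_less_0_iff)
    have "A \<in> U" if A: "A \<in> closure U" for A
    proof -
      define b where "b = norm A + 1"
      have b: "b > 0" unfolding b_def by (simp add: add_nonneg_pos)
      \<comment> \<open>Scaling \<open>X\<close> reaches \<open>-b I\<close> with \<open>b\<close>
        larger than the norm of \<open>A\<close>, so that \<open>A + b I\<close> is positive
        definite.\<close>
      have "(b / (- a)) *\<^sub>R X \<in> closure U"
        using XS(1) a0 b unfolding S_def by (intro scale) (auto simp: divide_pos_neg)
      then have "(- b) *\<^sub>R mat 1 \<in> closure U" unfolding a using a0 by simp
      moreover have "pos_def (A + b *\<^sub>R mat 1)"
        unfolding pos_def_def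
      proof (intro conjI allI impI)
        show "A + b *\<^sub>R mat 1 \<in> sym_mats" using A clsym by (intro sym_mats_linear) auto
        fix v :: "real^'n" assume v: "v \<noteq> 0"
        have "\<bar>v \<bullet> (A *v v)\<bar> \<le> norm A * (norm v)\<^sup>2"
          by (rule norm_quadratic_form_le[OF norm_matrix_vector_mult_le])
        moreover have "norm A * (norm v)\<^sup>2 < b * (norm v)\<^sup>2"
          unfolding b_def using v by (intro mult_strict_right_mono) auto
        ultimately show "0 < v \<bullet> ((A + b *\<^sub>R mat 1) *v v)"
          by (simp add: matrix_vector_mult_add_rdistrib scaleR_matrix_vector_assoc[symmetric]
              inner_add_right power2_norm_eq_inner)
      qed
      ultimately have "(- b) *\<^sub>R mat 1 + (A + b *\<^sub>R mat 1) \<in> U" by (rule add)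
      then show ?thesis by simp
    qed
    then show False using proper by blast
  qed
  show "admissible_cone U"
    by unfold_locales (use clsym add scale trace in auto)
qed

section \<open>Inversion\<close>

definition inversion :: "real^'n \<Rightarrow> real \<Rightarrow> real^'n \<Rightarrow> real^'n" where
  "inversion c l y = c + (l\<^sup>2 / ((y - c) \<bullet> (y - c))) *\<^sub>R (y - c)"

lemma inversion_minus: "inversion c l y - c = (l\<^sup>2 / ((y - c) \<bullet> (y - c))) *\<^sub>R (y - c)"
  by (simp add: inversion_def)

lemma inversion_inner:
  assumes "y \<noteq> c"
  shows "(inversion c l y - c) \<bullet> (inversion c l y - c) = l\<^sup>2 * l\<^sup>2 / ((y - c) \<bullet> (y - c))"
proof -
  define z where "z = y - c"
  have "z \<bullet> z \<noteq> 0" using assms by (simp add: z_def)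
  then show ?thesis unfolding inversion_minus z_def[symmetric] by simp
qed

lemma inversion_involution:
  assumes "y \<noteq> c" "l \<noteq> 0"
  shows "inversion c l (inversion c l y) = y"
  unfolding inversion_def[of c l "inversion c l y"] inversion_inner[OF assms(1)]
  using assms by (simp add: inversion_minus)

lemma inner_shift_has_derivative:
  fixes c :: "'a::real_inner"
  shows "((\<lambda>y. (y - c) \<bullet> (y - c)) has_derivative (\<lambda>h. 2 * ((y - c) \<bullet> h))) (at y)"
  by (rule has_derivative_eq_rhs, (rule derivative_intros)+) (auto simp: inner_commute)

lemma inversion_has_derivative:
  assumes "y \<noteq> c"
  shows "(inversion c l has_derivative (\<lambda>h. (l\<^sup>2 / ((y - c) \<bullet> (y - c))) *\<^sub>R (reflection (y - c) *v h))) (at y)"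
proof -
  define z where "z = y - c"
  have zz: "z \<bullet> z \<noteq> 0" using assms by (simp add: z_def)
  have d1: "((\<lambda>y. y - c) has_derivative (\<lambda>h. h)) (at y)"
    by (rule has_derivative_eq_rhs, (rule derivative_intros)+) auto
  have "((\<lambda>y. l\<^sup>2 / ((y - c) \<bullet> (y - c))) has_derivative
      (\<lambda>h. - l\<^sup>2 * (2 * (z \<bullet> h)) / ((z \<bullet> z) * (z \<bullet> z)))) (at y)"
    by (rule has_derivative_eq_rhs[OF has_derivative_divide[OF has_derivative_const inner_shift_has_derivative]])
      (use assms zz in \<open>auto simp: z_def[symmetric] fun_eq_iff divide_inverse\<close>)
  from has_derivative_add[OF has_derivative_const has_derivative_scaleR[OF this d1]]
  have "((\<lambda>y. c + (l\<^sup>2 / ((y - c) \<bullet> (y - c))) *\<^sub>R (y - c)) has_derivative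
      (\<lambda>h. 0 + ((l\<^sup>2 / (z \<bullet> z)) *\<^sub>R h + (- l\<^sup>2 * (2 * (z \<bullet> h)) / ((z \<bullet> z) * (z \<bullet> z))) *\<^sub>R z))) (at y)"
    unfolding z_def[symmetric] .
  then show ?thesis
    unfolding z_def[symmetric] reflection_mult_vec inversion_def[abs_def]
    by (simp add: scaleR_diff_right)
qed

text \<open>In the gradient the weight \<open>|z|^2/l^2\<close> cancels the conformal factor of the
  inversion. In the Hessian one reflection comes from the inversion and the other from the
  derivative of \<open>a\<close>.\<close>

lemma hess_on_kelvin:
  fixes q :: "real^'n \<Rightarrow> real"
  assumes q: "hess_on D N q gq Hq" and l: "l \<noteq> 0"
    and D': "open D'" "c \<notin> D'" "inversion c l ` D' \<subseteq> D"
    and N': "\<And>y. y \<in> D' \<Longrightarrow> inversion c l y \<in> N \<Longrightarrow> y \<in> N'"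
  defines "a \<equiv> (\<lambda>y. 2 / l\<^sup>2 * q (inversion c l y) - 2 * ((y - c) \<bullet> gq (inversion c l y)) / ((y - c) \<bullet> (y - c)))"
  shows "hess_on D' N' (\<lambda>y. ((y - c) \<bullet> (y - c)) / l\<^sup>2 * q (inversion c l y))
    (\<lambda>y. a y *\<^sub>R (y - c) + gq (inversion c l y))
    (\<lambda>y. (l\<^sup>2 / ((y - c) \<bullet> (y - c))) *\<^sub>R (reflection (y - c) ** Hq (inversion c l y) ** reflection (y - c)) + a y *\<^sub>R mat 1)"
  unfolding hess_on_def
proof (intro conjI ballI)
  show "open D'" by (rule D')
  note h = hess_onD[OF q]
  fix y assume y: "y \<in> D'"
  define z where "z = y - c"
  define T where "T = inversion c l y"
  have yc: "y \<noteq> c" "z \<noteq> 0" using y D' by (auto simp: z_def)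
  have TD: "T \<in> D" using y D' unfolding T_def by auto
  define dT where "dT = (\<lambda>h. (l\<^sup>2 / (z \<bullet> z)) *\<^sub>R (reflection z *v h))"
  have dI: "(inversion c l has_derivative dT) (at y)"
    unfolding dT_def z_def by (rule inversion_has_derivative[OF yc(1)])
  have dq: "((\<lambda>y. q (inversion c l y)) has_derivative (\<lambda>h. gq T \<bullet> dT h)) (at y)"
    unfolding T_def by (rule has_derivative_compose[OF dI h(2)[OF TD[unfolded T_def]]])
  have "((\<lambda>y. ((y - c) \<bullet> (y - c)) / l\<^sup>2 * q (inversion c l y)) has_derivative
      (\<lambda>h. (2 * (z \<bullet> h)) / l\<^sup>2 * q T + (z \<bullet> z) / l\<^sup>2 * (gq T \<bullet> dT h))) (at y)"
  proof -
    have "((\<lambda>y. ((y - c) \<bullet> (y - c)) / l\<^sup>2) has_derivative (\<lambda>h. (2 * (z \<bullet> h)) / l\<^sup>2)) (at y)"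
      by (rule has_derivative_eq_rhs[OF has_derivative_divide[OF inner_shift_has_derivative has_derivative_const]])
        (use l in \<open>auto simp: z_def[symmetric] fun_eq_iff divide_inverse\<close>)
    from has_derivative_mult[OF this dq] show ?thesis
      unfolding z_def[symmetric] T_def[symmetric] by (simp add: add.commute)
  qed
  moreover have "(2 * (z \<bullet> h)) / l\<^sup>2 * q T + (z \<bullet> z) / l\<^sup>2 * (gq T \<bullet> dT h) = (a y *\<^sub>R (y - c) + gq T) \<bullet> h" for h
  proof -
    define A B C Z where "A = gq T \<bullet> h" and "B = z \<bullet> h" and "C = z \<bullet> gq T" and "Z = z \<bullet> z"
    have Z: "Z \<noteq> 0" using yc by (simp add: Z_def)
    have 1: "gq T \<bullet> dT h = l\<^sup>2 / Z * (A - 2 * B / Z * C)"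
      unfolding dT_def reflection_mult_vec A_def B_def C_def Z_def
      by (simp add: inner_diff_right inner_commute)
    have 2: "(a y *\<^sub>R z + gq T) \<bullet> h = a y * B + A"
      by (simp add: inner_add_left A_def B_def)
    have 3: "a y = 2 / l\<^sup>2 * q T - 2 * C / Z"
      unfolding a_def C_def Z_def z_def T_def ..
    show ?thesis
      unfolding z_def[symmetric] 1 2 unfolding 3 B_def[symmetric] Z_def[symmetric] using Z l by (simp add: field_simps)
  qed
  ultimately show "((\<lambda>y. ((y - c) \<bullet> (y - c)) / l\<^sup>2 * q (inversion c l y)) has_derivative
      (\<lambda>h. (a y *\<^sub>R (y - c) + gq (inversion c l y)) \<bullet> h)) (at y)"
    unfolding T_def by simp
  have lg: "lip_at (\<lambda>y. gq (inversion c l y)) y"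
    using lip_at_compose[OF h(3)[OF TD[unfolded T_def]] lip_at_differentiable[OF dI]] .
  have lz: "lip_at (\<lambda>y. y - c) y"
    by (rule lip_at_differentiable) (auto intro!: derivative_eq_intros)
  have "((\<lambda>y. 1 / ((y - c) \<bullet> (y - c))) has_derivative (\<lambda>h. - (2 * (z \<bullet> h)) / (z \<bullet> z)\<^sup>2)) (at y)"
    by (rule has_derivative_eq_rhs[OF has_derivative_divide[OF has_derivative_const inner_shift_has_derivative]])
      (use yc in \<open>auto simp: z_def[symmetric] fun_eq_iff divide_inverse power2_eq_square\<close>)
  then have l1: "lip_at (\<lambda>y. 1 / ((y - c) \<bullet> (y - c))) y" by (rule lip_at_differentiable)
  have a_alt: "a = (\<lambda>y. (2 / l\<^sup>2) *\<^sub>R q (inversion c l y)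
      + (-2) *\<^sub>R ((1 / ((y - c) \<bullet> (y - c))) *\<^sub>R ((y - c) \<bullet> gq (inversion c l y))))"
    unfolding a_def by (simp add: fun_eq_iff)
  have "lip_at a y"
    unfolding a_alt
    by (intro lip_at_add lip_at_scaleR_const bounded_bilinear.lip_at[OF bounded_bilinear_scaleR]
      bounded_bilinear.lip_at[OF bounded_bilinear_inner] l1 lz lg lip_at_differentiable[OF dq])
  then show "lip_at (\<lambda>y. a y *\<^sub>R (y - c) + gq (inversion c l y)) y"
    by (intro lip_at_add bounded_bilinear.lip_at[OF bounded_bilinear_scaleR] lz lg)
next
  note h = hess_onD[OF q]
  fix y assume "y \<in> D' - N'"
  then have y: "y \<in> D'" "y \<notin> N'" by auto
  define z where "z = y - c"
  define T where "T = inversion c l y"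
  have yc: "y \<noteq> c" "z \<noteq> 0" using y D' by (auto simp: z_def)
  have TD: "T \<in> D" "T \<notin> N" using y D' N' unfolding T_def by auto
  define dT where "dT = (\<lambda>h. (l\<^sup>2 / (z \<bullet> z)) *\<^sub>R (reflection z *v h))"
  have dI: "(inversion c l has_derivative dT) (at y)"
    unfolding dT_def z_def by (rule inversion_has_derivative[OF yc(1)])
  have dq: "((\<lambda>y. q (inversion c l y)) has_derivative (\<lambda>h. gq T \<bullet> dT h)) (at y)"
    unfolding T_def by (rule has_derivative_compose[OF dI h(2)[OF TD(1)[unfolded T_def]]])
  have dg: "((\<lambda>y. gq (inversion c l y)) has_derivative (\<lambda>h. Hq T *v dT h)) (at y)"
    unfolding T_def by (rule has_derivative_compose[OF dI h(4)[OF TD[unfolded T_def]]])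
  have zz: "z \<bullet> z \<noteq> 0" using yc by simp
  define w where "w = (\<lambda>h. Hq T *v dT h)"
  define da where "da = (\<lambda>h. 2 / l\<^sup>2 * (gq T \<bullet> dT h)
      - (2 * (h \<bullet> gq T + z \<bullet> w h) / (z \<bullet> z) - 2 * (z \<bullet> gq T) * (2 * (z \<bullet> h)) / ((z \<bullet> z) * (z \<bullet> z))))"
  have d1: "((\<lambda>y. y - c) has_derivative (\<lambda>h. h)) (at y)"
    by (rule has_derivative_eq_rhs, (rule derivative_intros)+) auto
  have "(a has_derivative da) (at y)"
  proof -
    have "((\<lambda>y. 2 * ((y - c) \<bullet> gq (inversion c l y))) has_derivative
        (\<lambda>h. 2 * (z \<bullet> w h + h \<bullet> gq T))) (at y)"
      using has_derivative_mult_right[OF has_derivative_inner[OF d1 dg], of 2]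
      unfolding z_def[symmetric] T_def[symmetric] w_def .
    from has_derivative_divide[OF this inner_shift_has_derivative, of c]
    have "((\<lambda>y. 2 * ((y - c) \<bullet> gq (inversion c l y)) / ((y - c) \<bullet> (y - c))) has_derivative
        (\<lambda>h. - (2 * (z \<bullet> gq T)) * (inverse (z \<bullet> z) * (2 * (z \<bullet> h)) * inverse (z \<bullet> z))
          + 2 * (z \<bullet> w h + h \<bullet> gq T) / (z \<bullet> z))) (at y)"
      using zz unfolding z_def[symmetric] T_def[symmetric] by blast
    from has_derivative_diff[OF has_derivative_mult_right[OF dq, of "2 / l\<^sup>2"] this]
    show ?thesis unfolding a_def
      by (rule has_derivative_eq_rhs) (auto simp: fun_eq_iff da_def divide_inverse algebra_simps)
  qed
  from has_derivative_add[OF has_derivative_scaleR[OF this d1] dg]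
  have "((\<lambda>y. a y *\<^sub>R (y - c) + gq (inversion c l y)) has_derivative
      (\<lambda>h. a y *\<^sub>R h + da h *\<^sub>R z + w h)) (at y)"
    unfolding w_def z_def .
  moreover have "a y *\<^sub>R h + da h *\<^sub>R z + w h =
      ((l\<^sup>2 / (z \<bullet> z)) *\<^sub>R (reflection z ** Hq T ** reflection z) + a y *\<^sub>R mat 1) *v h" for h
  proof -
    have 1: "2 / l\<^sup>2 * (gq T \<bullet> dT h) = 2 / (z \<bullet> z) * (gq T \<bullet> h - 2 * (z \<bullet> h) / (z \<bullet> z) * (gq T \<bullet> z))"
      unfolding dT_def reflection_mult_vec using l zz by (simp add: inner_diff_right field_simps)
    \<comment> \<open>All terms with \<open>gq T\<close> cancel; what remains is the correction that
      turns \<open>w h\<close> into its reflection.\<close>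
    then have da: "da h = - (2 * (z \<bullet> w h) / (z \<bullet> z))"
      unfolding da_def 1 using zz by (simp add: inner_commute field_simps)
    have "(reflection z ** Hq T ** reflection z) *v h = reflection z *v (Hq T *v (reflection z *v h))"
      by (simp add: matrix_vector_mul_assoc matrix_mul_assoc)
    then have "(l\<^sup>2 / (z \<bullet> z)) *\<^sub>R ((reflection z ** Hq T ** reflection z) *v h) = reflection z *v w h"
      unfolding w_def dT_def by (simp add: matrix_vector_mult_scaleR)
    also have "\<dots> = w h + da h *\<^sub>R z" unfolding da reflection_mult_vec by simp
    finally show ?thesis
      by (simp add: matrix_vector_mult_add_rdistrib scaleR_matrix_vector_assoc[symmetric])
  qed
  ultimately show "((\<lambda>y. a y *\<^sub>R (y - c) + gq (inversion c l y)) has_derivative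
     (\<lambda>h. ((l\<^sup>2 / ((y - c) \<bullet> (y - c))) *\<^sub>R (reflection (y - c) ** Hq (inversion c l y) ** reflection (y - c)) + a y *\<^sub>R mat 1) *v h)) (at y)"
    unfolding z_def T_def by simp
qed

text \<open>Conformal covariance of \<open>A\<^sup>u\<close> under inversion.\<close>

lemma schouten_kelvin:
  fixes z g :: "real^'n"
  assumes z: "z \<noteq> 0" and l: "l \<noteq> 0" and p: "p = (z \<bullet> z) / l\<^sup>2 * t"
    and a: "a = 2 / l\<^sup>2 * t - 2 * (z \<bullet> g) / (z \<bullet> z)"
  shows "schouten p (a *\<^sub>R z + g) ((l\<^sup>2 / (z \<bullet> z)) *\<^sub>R (reflection z ** H ** reflection z) + a *\<^sub>R mat 1)
    = reflection z ** schouten t g H ** reflection z"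
proof -
  have zz: "z \<bullet> z \<noteq> 0" using z by simp
  have "(norm (a *\<^sub>R z + g))\<^sup>2 = a\<^sup>2 * (z \<bullet> z) + 2 * a * (z \<bullet> g) + (norm g)\<^sup>2"
    unfolding power2_norm_eq_inner
    by (simp add: inner_add_left inner_add_right inner_commute power2_eq_square algebra_simps)
  \<comment> \<open>The factor left after taking out \<open>a\<close> vanishes by the choice of
    \<open>a\<close>, so the identity matrix keeps only the coefficient
    \<open>-|g|^2/2\<close>.\<close>
  moreover have "p * a - (a\<^sup>2 * (z \<bullet> z) + 2 * a * (z \<bullet> g)) / 2 = 0"
  proof -
    have "p - a * (z \<bullet> z) / 2 - (z \<bullet> g) = 0"
      unfolding p a using zz by (simp add: field_simps)
    then have "a * (p - a * (z \<bullet> z) / 2 - (z \<bullet> g)) = 0" by simp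
    then show ?thesis by (simp add: algebra_simps power2_eq_square)
  qed
  ultimately have c: "p * a - (norm (a *\<^sub>R z + g))\<^sup>2 / 2 = - ((norm g)\<^sup>2 / 2)" by (simp add: add_divide_distrib)
  have pt: "p * (l\<^sup>2 / (z \<bullet> z)) = t" unfolding p using zz l by simp
  have "schouten p (a *\<^sub>R z + g) ((l\<^sup>2 / (z \<bullet> z)) *\<^sub>R (reflection z ** H ** reflection z) + a *\<^sub>R mat 1)
    = (p * (l\<^sup>2 / (z \<bullet> z))) *\<^sub>R (reflection z ** H ** reflection z) + (p * a - (norm (a *\<^sub>R z + g))\<^sup>2 / 2) *\<^sub>R mat 1"
    unfolding schouten_def by (simp add: scaleR_add_right scaleR_diff_left)
  also have "\<dots> = t *\<^sub>R (reflection z ** H ** reflection z) - ((norm g)\<^sup>2 / 2) *\<^sub>R (reflection z ** reflection z)"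
    unfolding c pt reflection_involution[OF z] by simp
  also have "\<dots> = reflection z ** schouten t g H ** reflection z"
  proof -
    have "(t *\<^sub>R (reflection z ** H ** reflection z) - ((norm g)\<^sup>2 / 2) *\<^sub>R (reflection z ** reflection z)) *v h
      = (reflection z ** schouten t g H ** reflection z) *v h" for h
      unfolding schouten_def matrix_vector_mul_assoc[symmetric] matrix_vector_mult_diff_rdistrib
        scaleR_matrix_vector_assoc[symmetric]
      by (simp add: matrix_vector_mul_assoc[symmetric] matrix_vector_mult_diff_distrib matrix_vector_mult_scaleR)
    then show ?thesis by (simp add: matrix_eq)
  qed
  finally show ?thesis .
qed

section \<open>Reflections as limits of inversions\<close>

text \<open>The factor and the image point of the inversions, as functions of \<open>t\<close>,
  extend continuously to \<open>t = 0\<close>, where they become 1 and the mirror image of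
  \<open>y\<close>. The sign of the inner product of \<open>y\<close> and \<open>e\<close> places
  \<open>y\<close> outside the spheres.\<close>

lemma reflection_le_of_kelvin_le:
  fixes u :: "real^'n \<Rightarrow> real"
  assumes kelvin: "\<And>x r y. x \<noteq> 0 \<Longrightarrow> 0 < r \<Longrightarrow> r < norm x \<Longrightarrow> r \<le> norm (y - x) \<Longrightarrow> y \<noteq> 0 \<Longrightarrow>
      kelvin u x r y \<le> u y"
    and cont: "\<And>y. y \<noteq> 0 \<Longrightarrow> isCont u y"
    and e: "norm e = 1" and b: "y \<bullet> e < 0"
  shows "u (y - (2 * (y \<bullet> e)) *\<^sub>R e) \<le> u y"
proof -
  define b where "b = y \<bullet> e"
  define s where "s = y \<bullet> y"
  \<comment> \<open>With \<open>x = e/t\<close> and \<open>r = (1 - t^2)/t\<close>,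
    \<open>d t\<close> is \<open>t^2 |y - x|^2\<close>, \<open>k t\<close> is
    \<open>r^2/|y - x|^2\<close>, and \<open>P t\<close> is the image of \<open>y\<close> under the
    inversion.\<close>
  define d where "d = (\<lambda>t::real. 1 - 2 * b * t + s * t\<^sup>2)"
  define k where "k = (\<lambda>t. (1 - t\<^sup>2)\<^sup>2 / d t)"
  define P where "P = (\<lambda>t. ((- 2 * b + s * t + 2 * t - t ^ 3) / d t) *\<^sub>R e + k t *\<^sub>R y)"
  have y: "y \<noteq> 0" using \<open>y \<bullet> e < 0\<close> by auto
  have b0: "b < 0" using \<open>y \<bullet> e < 0\<close> by (simp add: b_def)
  have s0: "s \<ge> 0" by (simp add: s_def)
  have ee: "e \<bullet> e = 1" using e by (simp add: norm_eq_1)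
  have ineq: "(sqrt (k t)) ^ (CARD('n) - 2) * u (P t) \<le> u y" if t: "0 < t" "t < 1" for t
  proof -
    define x where "x = (1 / t) *\<^sub>R e"
    define r where "r = (1 - t\<^sup>2) / t"
    have bt: "b * t < 0" using t b0 by (simp add: mult_neg_pos)
    have st: "0 \<le> s * t\<^sup>2" using s0 by simp
    have dt: "d t \<ge> 1" unfolding d_def using bt st by simp
    have t2: "0 < t\<^sup>2" "t\<^sup>2 < 1" using t power_strict_mono[of t 1 2] by auto
    have nx: "norm x = 1 / t" unfolding x_def using t e by simp
    have r: "0 < r" "r < norm x" unfolding r_def nx using t t2 by (auto simp: divide_strict_right_mono)
    have "(y - x) \<bullet> (y - x) = d t / t\<^sup>2"
      unfolding x_def d_def b_def s_def using t ee
      by (simp add: inner_diff_left inner_diff_right inner_commute field_simps power2_eq_square)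
    then have nyx: "(norm (y - x))\<^sup>2 = d t / t\<^sup>2" by (simp add: power2_norm_eq_inner)
    have "(1 / t)\<^sup>2 \<le> (norm (y - x))\<^sup>2"
      unfolding nyx using dt t by (simp add: power_divide divide_right_mono)
    then have "norm x \<le> norm (y - x)" unfolding nx by (rule power2_le_imp_le) simp
    then have ryx: "r \<le> norm (y - x)" using r by simp
    have kt: "r\<^sup>2 / (norm (y - x))\<^sup>2 = k t"
      unfolding nyx r_def k_def using t by (simp add: power_divide)
    have "x \<noteq> 0" using nx t by auto
    from kelvin[OF this r ryx y] have "kelvin u x r y \<le> u y" .
    moreover have "r / norm (y - x) = sqrt (k t)"
      unfolding kt[symmetric] power_divide[symmetric] using r by simp
    moreover have "x + (r\<^sup>2 / (norm (y - x))\<^sup>2) *\<^sub>R (y - x) = P t"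
    proof -
      \<comment> \<open>A factor \<open>t\<close> splits off the numerator of
        \<open>1 - k t\<close>, which removes the singularity of \<open>x = e/t\<close>.\<close>
      have "(1 - k t) / t = (- 2 * b + s * t + 2 * t - t ^ 3) / d t"
      proof -
        have "1 - k t = (d t - (1 - t\<^sup>2)\<^sup>2) / d t" unfolding k_def using dt by (simp add: diff_divide_distrib)
        also have "d t - (1 - t\<^sup>2)\<^sup>2 = t * (- 2 * b + s * t + 2 * t - t ^ 3)"
          unfolding d_def by (simp add: power2_eq_square power3_eq_cube algebra_simps)
        finally show ?thesis using t by simp
      qed
      moreover have "x + k t *\<^sub>R (y - x) = ((1 - k t) / t) *\<^sub>R e + k t *\<^sub>R y"
        unfolding x_def by (simp add: scaleR_diff_right scaleR_diff_left diff_divide_distrib)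
      ultimately show ?thesis unfolding kt P_def by simp
    qed
    ultimately show ?thesis unfolding kelvin_def by (simp flip: power_divide)
  qed
  have d0: "d 0 = 1" "k 0 = 1" unfolding d_def k_def by auto
  have P0: "P 0 = y - (2 * b) *\<^sub>R e" unfolding P_def d0 by simp
  have "(y - (2 * b) *\<^sub>R e) \<bullet> e = - b" unfolding inner_diff_left inner_scaleR_left ee b_def by simp
  then have Pn: "P 0 \<noteq> 0" unfolding P0 using b0 by auto
  have cd: "isCont d 0" unfolding d_def by (intro continuous_intros)
  have ck: "isCont k 0" unfolding k_def using d0 by (intro continuous_intros cd) auto
  have cP: "isCont P 0" unfolding P_def using d0 by (intro continuous_intros cd ck) auto
  have "isCont (\<lambda>t. u (P t)) 0" by (rule isCont_o2[OF cP cont[OF Pn]])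
  then have "isCont (\<lambda>t. (sqrt (k t)) ^ (CARD('n) - 2) * u (P t)) 0"
    by (intro continuous_intros ck)
  then have "((\<lambda>t. (sqrt (k t)) ^ (CARD('n) - 2) * u (P t)) \<longlongrightarrow> (sqrt (k 0)) ^ (CARD('n) - 2) * u (P 0)) (at_right 0)"
    unfolding isCont_def by (rule filterlim_mono) (auto simp: at_le)
  moreover have "\<forall>\<^sub>F t in at_right 0. (sqrt (k t)) ^ (CARD('n) - 2) * u (P t) \<le> u y"
    unfolding eventually_at_right_field using ineq zero_less_one by blast
  ultimately have "(sqrt (k 0)) ^ (CARD('n) - 2) * u (P 0) \<le> u y"
    by (intro tendsto_upperbound[where F = "at_right (0::real)"]) auto
  then show ?thesis unfolding P0 d0 b_def by simp
qed

text \<open>For distinct points of equal norm, the reflection along \<open>z - y\<close> exchanges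
  them, and \<open>y\<close> lies on its negative side. Exchanging the roles gives the reverse
  inequality.\<close>

lemma radial_of_kelvin_le:
  fixes u :: "real^'n \<Rightarrow> real"
  assumes kelvin: "\<And>x r y. x \<noteq> 0 \<Longrightarrow> 0 < r \<Longrightarrow> r < norm x \<Longrightarrow> r \<le> norm (y - x) \<Longrightarrow> y \<noteq> 0 \<Longrightarrow>
      kelvin u x r y \<le> u y"
    and cont: "\<And>y. y \<noteq> 0 \<Longrightarrow> isCont u y"
    and yz: "norm y = norm z"
  shows "u y = u z"
proof -
  have le: "u z \<le> u y" if yz: "norm y = norm z" "y \<noteq> z" for y z
  proof -
    define l where "l = norm (z - y)"
    define e where "e = (1 / l) *\<^sub>R (z - y)"
    have l: "l > 0" using yz by (simp add: l_def)
    have "l\<^sup>2 = z \<bullet> z - 2 * (y \<bullet> z) + y \<bullet> y"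
      unfolding l_def power2_norm_eq_inner by (simp add: inner_diff_left inner_diff_right inner_commute)
    then have "l\<^sup>2 = 2 * (y \<bullet> y - y \<bullet> z)" using yz(1) by (simp add: norm_eq)
    then have ye: "y \<bullet> e = - l / 2"
      unfolding e_def using l by (simp add: inner_diff_right field_simps power2_eq_square)
    have "u (y - (2 * (y \<bullet> e)) *\<^sub>R e) \<le> u y"
    proof (rule reflection_le_of_kelvin_le[OF kelvin cont])
      show "norm e = 1" unfolding e_def using l by (simp add: l_def)
      show "y \<bullet> e < 0" unfolding ye using l by simp
    qed auto
    moreover have "y - (2 * (y \<bullet> e)) *\<^sub>R e = z" unfolding ye unfolding e_def using l by simp
    ultimately show ?thesis by simp
  qed
  show ?thesis
  proof (cases "y = z")
    case False
    then show ?thesis using le[OF yz False] le[OF yz[symmetric]] by auto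
  qed simp
qed

section \<open>The conformal Hessian\<close>

lemma has_derivative_gradient:
  assumes "u differentiable (at x)"
  shows "(u has_derivative (\<lambda>h. gradient u x \<bullet> h)) (at x)"
proof -
  let ?D = "frechet_derivative u (at x)"
  have D: "(u has_derivative ?D) (at x)" using assms by (simp add: frechet_derivative_works)
  then have lin: "linear ?D" by (rule has_derivative_linear)
  have "?D h = gradient u x \<bullet> h" for h
  proof -
    have "?D h = ?D (\<Sum>i\<in>UNIV. h $ i *\<^sub>R axis i 1)"
      using basis_expansion[of h] by (simp add: scalar_mult_eq_scaleR)
    also have "\<dots> = (\<Sum>i\<in>UNIV. h $ i * ?D (axis i 1))"
      using lin by (simp add: linear_sum linear_cmul)
    also have "\<dots> = gradient u x \<bullet> h"
      by (simp add: inner_vec_def gradient_def partial_deriv_def mult.commute)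
    finally show ?thesis .
  qed
  with D show ?thesis by (simp add: has_derivative_eq_rhs fun_eq_iff)
qed

lemma hess_on_C11:
  assumes u: "C11_on S u" and S: "open S"
    and diff: "\<And>y. y \<in> S \<Longrightarrow> y \<notin> N \<Longrightarrow> gradient u differentiable (at y)"
  shows "hess_on S N u (gradient u) (hessian u)"
  unfolding hess_on_def
proof (intro conjI ballI)
  fix y assume y: "y \<in> S"
  show "(u has_derivative (\<lambda>h. gradient u y \<bullet> h)) (at y)"
    using u y unfolding C11_on_def by (intro has_derivative_gradient) auto
  obtain r L where r: "r > 0" "L-lipschitz_on (ball y r \<inter> S) (gradient u)"
    using u y unfolding C11_on_def by blast
  have "\<forall>\<^sub>F z in nhds y. z \<in> ball y r \<inter> S"
    using r y S by (intro eventually_nhds_in_open) auto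
  then have "\<forall>\<^sub>F z in nhds y. norm (gradient u z - gradient u y) \<le> L * norm (z - y)"
  proof eventually_elim
    case (elim z)
    then show ?case using lipschitz_onD[OF r(2), of z y] r y by (simp add: dist_norm)
  qed
  then show "lip_at (gradient u) y" unfolding lip_at_def by blast
next
  fix y assume "y \<in> S - N"
  then show "(gradient u has_derivative (\<lambda>h. hessian u y *v h)) (at y)"
    using diff[of y] unfolding hessian_def by (simp add: jacobian_works)
qed (rule S)

section \<open>Local bounds for the Hessian of a function of \<open>u\<close>\<close>

lemma derivative_bound_of_lipschitz:
  fixes g :: "'a::real_normed_vector \<Rightarrow> 'b::real_normed_vector"
  assumes g: "(g has_derivative g') (at y)"
    and lip: "\<forall>\<^sub>F z in nhds y. norm (g z - g y) \<le> L * norm (z - y)"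
  shows "norm (g' h) \<le> L * norm h"
proof (rule ccontr)
  assume neg: "\<not> ?thesis"
  define e where "e = norm (g' h) - L * norm h"
  have lin: "linear g'" using g by (rule has_derivative_linear)
  have h: "h \<noteq> 0" using neg linear_0[OF lin] by auto
  have e: "e > 0" using neg by (simp add: e_def)
  obtain d where d: "d > 0" "\<And>z. norm (z - y) < d \<Longrightarrow>
      norm (g z - g y - g' (z - y)) \<le> e / (2 * norm h) * norm (z - y)"
    using g h e unfolding has_derivative_at_alt
    by (metis divide_pos_pos mult_pos_pos zero_less_norm_iff zero_less_numeral)
  obtain r where r: "r > 0" "\<And>z. dist z y < r \<Longrightarrow> norm (g z - g y) \<le> L * norm (z - y)"
    using lip unfolding eventually_nhds_metric by blast
  define t where "t = min d r / (2 * norm h)"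
  have t: "t > 0" unfolding t_def using d r h by simp
  have nt: "norm (t *\<^sub>R h) < d" "norm (t *\<^sub>R h) < r"
    unfolding t_def using d r h by (auto simp: min_def)
  have "norm (g' (t *\<^sub>R h)) \<le> norm (g (y + t *\<^sub>R h) - g y) + norm (g (y + t *\<^sub>R h) - g y - g' (t *\<^sub>R h))"
    using norm_triangle_ineq4[of "g (y + t *\<^sub>R h) - g y" "g (y + t *\<^sub>R h) - g y - g' (t *\<^sub>R h)"] by simp
  also have "\<dots> \<le> L * norm (t *\<^sub>R h) + e / (2 * norm h) * norm (t *\<^sub>R h)"
    using d(2)[of "y + t *\<^sub>R h"] r(2)[of "y + t *\<^sub>R h"] nt by (intro add_mono) (auto simp: dist_norm)
  also have "\<dots> = t * (L * norm h + e / 2)" using t h by (simp add: field_simps)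
  finally have "t * norm (g' h) \<le> t * (L * norm h + e / 2)"
    using t by (simp add: linear_cmul[OF lin])
  then have "norm (g' h) \<le> L * norm h + e / 2" using t by simp
  moreover have "norm (g' h) = L * norm h + e" by (simp add: e_def)
  ultimately show False using e by simp
qed

lemma isCont_eventually_norm_less:
  assumes "isCont f x"
  shows "\<forall>\<^sub>F y in nhds x. norm (f y) < norm (f x) + 1"
proof -
  have "((\<lambda>y. norm (f y)) \<longlongrightarrow> norm (f x)) (nhds x)"
    using assms by (simp add: isCont_def tendsto_at_iff_tendsto_nhds tendsto_norm)
  then show ?thesis by (rule order_tendstoD) simp
qed

text \<open>This provides the local bound on the Hessian of \<open>q\<close> that comparison asks
  for. It rests on a Lipschitz constant uniform over a ball, whereas the constants in
  \<open>lip_at\<close> may vary with the point.\<close>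

lemma compose_hessian_locally_bounded:
  fixes u :: "real^'n \<Rightarrow> real"
  assumes u: "C11_on S u" and hu: "hess_on S N u (gradient u) (hessian u)" and x: "x \<in> S"
    and k: "isCont (\<lambda>y. k1 (u y)) x" "isCont (\<lambda>y. k2 (u y)) x"
  shows "\<exists>r>0. \<exists>L. \<forall>y\<in>ball x r - N. \<forall>h.
    norm ((k1 (u y) *\<^sub>R hessian u y + k2 (u y) *\<^sub>R outer_prod (gradient u y) (gradient u y)) *v h) \<le> L * norm h"
proof -
  obtain r0 L where r0: "r0 > 0" "L-lipschitz_on (ball x r0 \<inter> S) (gradient u)"
    using u x unfolding C11_on_def by blast
  define K1 K2 G where "K1 = norm (k1 (u x)) + 1" and "K2 = norm (k2 (u x)) + 1"
    and "G = norm (gradient u x) + 1"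
  have S: "open S" by (rule hess_onD(1)[OF hu])
  have G: "G \<ge> 0" unfolding G_def by simp
  have L: "L \<ge> 0" using r0(2) by (rule lipschitz_on_nonneg)
  have "\<forall>\<^sub>F y in nhds x. y \<in> ball x r0 \<inter> S" using r0 x S by (intro eventually_nhds_in_open) auto
  then have "\<forall>\<^sub>F y in nhds x. y \<in> ball x r0 \<inter> S \<and> norm (k1 (u y)) < K1 \<and> norm (k2 (u y)) < K2 \<and> norm (gradient u y) < G"
    unfolding K1_def K2_def G_def
    by (intro eventually_conj isCont_eventually_norm_less k hess_on_isCont(2)[OF hu x]) auto
  then obtain r where r: "r > 0" "\<And>y. dist y x < r \<Longrightarrow>
      y \<in> ball x r0 \<inter> S \<and> norm (k1 (u y)) < K1 \<and> norm (k2 (u y)) < K2 \<and> norm (gradient u y) < G"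
    unfolding eventually_nhds_metric by blast
  have "norm ((k1 (u y) *\<^sub>R hessian u y + k2 (u y) *\<^sub>R outer_prod (gradient u y) (gradient u y)) *v h)
      \<le> (K1 * L + K2 * (G * G)) * norm h" if "y \<in> ball x r - N" for y h
  proof -
    have y: "y \<in> ball x r0 \<inter> S" "norm (k1 (u y)) < K1" "norm (k2 (u y)) < K2" "norm (gradient u y) < G" "y \<notin> N"
      using r(2)[of y] that by (auto simp: dist_commute)
    have "\<forall>\<^sub>F z in nhds y. z \<in> ball x r0 \<inter> S" using y S by (intro eventually_nhds_in_open) auto
    then have "\<forall>\<^sub>F z in nhds y. norm (gradient u z - gradient u y) \<le> L * norm (z - y)"
    proof eventually_elim
      case (elim z)
      then show ?case using lipschitz_onD[OF r0(2), of z y] y by (simp add: dist_norm)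
    qed
    then have H: "norm (hessian u y *v h) \<le> L * norm h"
      using y hess_onD(4)[OF hu] by (intro derivative_bound_of_lipschitz[of "gradient u"]) auto
    have "norm ((gradient u y \<bullet> h) *\<^sub>R gradient u y) \<le> (norm (gradient u y) * norm h) * norm (gradient u y)"
      using Cauchy_Schwarz_ineq2[of "gradient u y" h] by (simp add: mult_right_mono)
    also have "\<dots> \<le> (G * norm h) * G" using y G by (intro mult_mono) auto
    finally have O: "norm ((gradient u y \<bullet> h) *\<^sub>R gradient u y) \<le> (G * G) * norm h" by (simp add: ac_simps)
    have "norm (k1 (u y)) * norm (hessian u y *v h) \<le> K1 * (L * norm h)"
      using y H L by (intro mult_mono) auto
    moreover have "norm (k2 (u y)) * norm ((gradient u y \<bullet> h) *\<^sub>R gradient u y) \<le> K2 * ((G * G) * norm h)"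
      using y O by (intro mult_mono) auto
    moreover have "norm (k1 (u y) *\<^sub>R (hessian u y *v h) + k2 (u y) *\<^sub>R ((gradient u y \<bullet> h) *\<^sub>R gradient u y))
      \<le> norm (k1 (u y)) * norm (hessian u y *v h) + norm (k2 (u y)) * norm ((gradient u y \<bullet> h) *\<^sub>R gradient u y)"
      by (rule order_trans[OF norm_triangle_ineq]) (simp add: abs_mult mult.assoc)
    ultimately show ?thesis
      by (simp add: matrix_vector_mult_add_rdistrib scaleR_matrix_vector_assoc[symmetric] outer_prod_mult_vec distrib_right)
  qed
  then show ?thesis using r(1) by blast
qed

text \<open>\<open>a\<close> is the exponent in \<open>q = u powr a\<close>. The powers of
  \<open>u\<close> in \<open>conf_hessian\<close> are \<open>a + (a - 1)\<close> and
  \<open>a + (a - 2)\<close>, and the coefficients are \<open>a\<close>, \<open>a (a - 1)\<close>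
  and \<open>- a^2/2\<close>, as the chain rule for \<open>q\<close> yields.\<close>

lemma conf_hessian_eq_schouten:
  fixes u :: "real^'n \<Rightarrow> real"
  assumes n: "3 \<le> CARD('n)" and u: "0 < u y"
  defines "a \<equiv> - 2 / (real CARD('n) - 2)"
  shows "schouten (u y powr a) ((a * u y powr (a - 1)) *\<^sub>R gradient u y)
      ((a * u y powr (a - 1)) *\<^sub>R hessian u y + (a * (a - 1) * u y powr (a - 2)) *\<^sub>R outer_prod (gradient u y) (gradient u y))
    = conf_hessian u y"
proof -
  define m where "m = real CARD('n) - 2"
  have m: "m > 0" using n unfolding m_def by simp
  have nm: "real CARD('n) = m + 2" by (simp add: m_def)
  have a: "a = - 2 / m" unfolding a_def m_def ..
  define p where "p = u y"
  have p: "p > 0" using u by (simp add: p_def)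
  have e1: "- ((m + 2 + 2) / m) = a + (a - 1)" "- (2 * (m + 2) / m) = a + (a - 2)"
    unfolding a using m by (simp_all add: field_simps)
  have c1: "- (2 / m) = a" "2 * (m + 2) / m\<^sup>2 = a * (a - 1)" "2 / m\<^sup>2 = a\<^sup>2 / 2"
    unfolding a using m by (simp_all add: field_simps power2_eq_square)
  have p1: "p powr (a + (a - 1)) = p powr a * p powr (a - 1)" "p powr (a + (a - 2)) = p powr a * p powr (a - 2)"
    by (rule powr_add)+
  have "p powr a * p powr (a - 2) = p powr (a - 1) * p powr (a - 1)"
    unfolding powr_add[symmetric] by simp
  then have p2: "(p powr (a - 1))\<^sup>2 = p powr a * p powr (a - 2)" by (simp add: power2_eq_square)
  have "conf_hessian u y = (a * (p powr a * p powr (a - 1))) *\<^sub>R hessian u y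
      + (a * (a - 1) * (p powr a * p powr (a - 2))) *\<^sub>R outer_prod (gradient u y) (gradient u y)
      - (a\<^sup>2 / 2 * (p powr a * p powr (a - 2)) * (norm (gradient u y))\<^sup>2) *\<^sub>R mat 1"
    unfolding conf_hessian_def Let_def nm add_diff_cancel_right' p_def[symmetric] e1 c1 p1 ..
  then show ?thesis
    unfolding schouten_def p_def[symmetric]
    by (simp add: power_mult_distrib p2 scaleR_add_right mult.assoc mult.left_commute)
qed

text \<open>Comparison is applied inside the ball to \<open>q\<close> and its Kelvin transform, with
  the centre and the image of the origin as punctures. The inversion carries the result to the
  exterior, and the negative exponent \<open>a\<close> turns it into the inequality for
  \<open>u\<close>.\<close>

lemma kelvin_le:
  fixes U :: "(real^'n^'n) set"
    and u :: "real^'n \<Rightarrow> real"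
  assumes n: "3 \<le> CARD('n)" and U: "admissible_cone U"
    and U_inv: "\<And>Q M. orthogonal_matrix Q \<Longrightarrow> M \<in> closure U \<Longrightarrow> transpose Q ** M ** Q \<in> closure U"
    and u_pos: "\<And>y. y \<noteq> 0 \<Longrightarrow> 0 < u y"
    and u: "C11_on (- {0}) u" and N: "negligible N"
    and diff: "\<And>y. y \<noteq> 0 \<Longrightarrow> y \<notin> N \<Longrightarrow> gradient u differentiable (at y)"
    and eq: "\<And>y. y \<noteq> 0 \<Longrightarrow> y \<notin> N \<Longrightarrow> conf_hessian u y \<in> closure U - U"
    and x: "x \<noteq> 0" and r: "0 < r" "r < norm x" and y: "r \<le> norm (y - x)" "y \<noteq> 0"
  shows "kelvin u x r y \<le> u y"
proof -
  interpret admissible_cone U by (rule U)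
  define m where "m = real CARD('n) - 2"
  have m: "m > 0" using n unfolding m_def by simp
  define a where "a = - 2 / m"
  define q where "q = (\<lambda>y. u y powr a)"
  define gq where "gq = (\<lambda>y. (a * u y powr (a - 1)) *\<^sub>R gradient u y)"
  define Hq where "Hq = (\<lambda>y. (a * u y powr (a - 1)) *\<^sub>R hessian u y +
     (a * (a - 1) * u y powr (a - 2)) *\<^sub>R outer_prod (gradient u y) (gradient u y))"
  have hu: "hess_on (- {0}) N u (gradient u) (hessian u)"
    using diff by (intro hess_on_C11 u) auto
  have hq: "hess_on (- {0}) N q gq Hq"
    unfolding q_def gq_def Hq_def
    by (rule hess_on_compose[OF hu]) (use u_pos in \<open>auto intro!: derivative_eq_intros simp: diff_diff_eq\<close>)
  have qpos: "0 < q y" if "y \<noteq> 0" for y unfolding q_def using u_pos[OF that] by simp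
  have A: "schouten (q y) (gq y) (Hq y) = conf_hessian u y" if "y \<noteq> 0" for y
    unfolding q_def gq_def Hq_def a_def m_def by (rule conf_hessian_eq_schouten[where u = u, OF n u_pos[OF that]])
  let ?I = "inversion x r"
  have r0: "r \<noteq> 0" using r by simp
  define s where "s = ?I 0"
  \<comment> \<open>Both functions must be twice differentiable off one null set, so the image of
    \<open>N\<close> is added; it is null because the inversion is differentiable away from
    \<open>x\<close>.\<close>
  define N' where "N' = N \<union> ?I ` (N - {x})"
  have N': "negligible N'"
    unfolding N'_def
  proof (intro negligible_Un N negligible_lip_at_image)
    show "negligible (N - {x})" using N by (rule negligible_diff)
    show "lip_at ?I z" if "z \<in> N - {x}" for z
      using that by (intro lip_at_differentiable[OF inversion_has_derivative]) auto
  qed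
  have Inx: "?I z \<noteq> x" if "z \<noteq> x" for z
  proof -
    have "?I z - x \<noteq> 0" unfolding inversion_minus using that r by simp
    then show ?thesis by simp
  qed
  have II: "?I (?I z) = z" if "z \<noteq> x" for z by (rule inversion_involution[OF that r0])
  define D' where "D' = - {x, s}"
  have ID: "?I z \<noteq> 0" if "z \<in> D'" for z
  proof
    assume "?I z = 0"
    then have "z = s" using II[of z] that unfolding D'_def s_def by auto
    then show False using that unfolding D'_def by simp
  qed
  have hW: "hess_on D' N' (\<lambda>y. ((y - x) \<bullet> (y - x)) / r\<^sup>2 * q (?I y))
    (\<lambda>y. (2 / r\<^sup>2 * q (?I y) - 2 * ((y - x) \<bullet> gq (?I y)) / ((y - x) \<bullet> (y - x))) *\<^sub>R (y - x) + gq (?I y))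
    (\<lambda>y. (r\<^sup>2 / ((y - x) \<bullet> (y - x))) *\<^sub>R (reflection (y - x) ** Hq (?I y) ** reflection (y - x)) +
      (2 / r\<^sup>2 * q (?I y) - 2 * ((y - x) \<bullet> gq (?I y)) / ((y - x) \<bullet> (y - x))) *\<^sub>R mat 1)"
  proof (rule hess_on_kelvin[OF hq r0])
    show "open D'" unfolding D'_def by auto
    show "x \<notin> D'" unfolding D'_def by auto
    show "?I ` D' \<subseteq> - {0}" using ID by auto
    show "z \<in> N'" if "z \<in> D'" "?I z \<in> N" for z
    proof -
      have "z \<noteq> x" using that unfolding D'_def by auto
      then show ?thesis unfolding N'_def using that II[of z] Inx[of z] by (metis DiffI UnI2 imageI singletonD)
    qed
  qed
  have main: "((z - x) \<bullet> (z - x)) / r\<^sup>2 * q (?I z) \<le> q z" if z: "z \<in> cball x r - {x, s}" for z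
  proof (rule comparison[OF n hess_on_subset[OF hq] N' _ _ _ r(1) _ _ _ hW _ _ _ _ z])
    show "open (- {0 :: real^'n})" "- {0} \<subseteq> - {0 :: real^'n}" "N \<subseteq> N'" unfolding N'_def by auto
    show "0 < q y" if "y \<in> - {0}" for y using qpos that by simp
    show "\<exists>r>0. \<exists>L. \<forall>y\<in>ball x r - N'. \<forall>h. norm (Hq y *v h) \<le> L * norm h" if "x \<in> - {0}" for x
    proof -
      have cu: "isCont u x" by (rule hess_on_isCont[OF hu that])
      have "u x \<noteq> 0" using u_pos[of x] that by auto
      then have "isCont (\<lambda>y. (\<lambda>t. a * t powr (a - 1)) (u y)) x" "isCont (\<lambda>y. (\<lambda>t. a * (a - 1) * t powr (a - 2)) (u y)) x"
        by (auto intro!: continuous_intros cu)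
      from compose_hessian_locally_bounded[OF u hu that this] show ?thesis
        unfolding Hq_def N'_def by blast
    qed
    show "schouten (q y) (gq y) (Hq y) \<in> sym_mats - U" if "y \<in> - {0}" "y \<notin> N'" for y
    proof -
      have "conf_hessian u y \<in> closure U - U" using that by (intro eq) (auto simp: N'_def)
      then show ?thesis using A[of y] that closure_sym by auto
    qed
    show "cball x r \<subseteq> - {0}" using r by (auto simp: dist_norm)
    show "finite {x, s}" by simp
    \<comment> \<open>\<open>|s - x| = r^2/|x|\<close>, which is below \<open>r\<close> because
      \<open>r < |x|\<close>.\<close>
    show "{x, s} \<subseteq> ball x r"
    proof -
      have "dist x s = norm (s - x)" by (simp add: dist_norm norm_minus_commute)
      also have "\<dots> = r\<^sup>2 / norm x"
        unfolding s_def inversion_minus using x by (simp add: power2_norm_eq_inner[symmetric] power2_eq_square)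
      also have "\<dots> < r" using r x by (simp add: divide_less_eq power2_eq_square)
      finally show ?thesis using r by simp
    qed
    show "cball x r - {x, s} \<subseteq> D'" unfolding D'_def by auto
  next
    fix y assume y: "y \<in> D'"
    then have "y - x \<noteq> 0" unfolding D'_def by simp
    then show "0 < ((y - x) \<bullet> (y - x)) / r\<^sup>2 * q (?I y)"
      using qpos[OF ID[OF y]] r by simp
  next
    fix y assume y: "y \<in> D'" "y \<notin> N'"
    have yx: "y \<noteq> x" using y unfolding D'_def by simp
    have "?I y \<notin> N" using y II[OF yx] Inx[OF yx] unfolding N'_def by (metis DiffI UnI2 imageI singletonD)
    then have "schouten (q (?I y)) (gq (?I y)) (Hq (?I y)) \<in> closure U"
      using eq[OF ID[OF y(1)]] A[OF ID[OF y(1)]] by auto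
    then have "reflection (y - x) ** schouten (q (?I y)) (gq (?I y)) (Hq (?I y)) ** reflection (y - x) \<in> closure U"
      using U_inv[of "reflection (y - x)"] orthogonal_reflection[of "y - x"] yx by (simp add: transpose_reflection)
    then show "schouten (((y - x) \<bullet> (y - x)) / r\<^sup>2 * q (?I y))
      ((2 / r\<^sup>2 * q (?I y) - 2 * ((y - x) \<bullet> gq (?I y)) / ((y - x) \<bullet> (y - x))) *\<^sub>R (y - x) + gq (?I y))
      ((r\<^sup>2 / ((y - x) \<bullet> (y - x))) *\<^sub>R (reflection (y - x) ** Hq (?I y) ** reflection (y - x)) +
        (2 / r\<^sup>2 * q (?I y) - 2 * ((y - x) \<bullet> gq (?I y)) / ((y - x) \<bullet> (y - x))) *\<^sub>R mat 1) \<in> closure U"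
      using yx r0 by (subst schouten_kelvin[OF _ _ refl refl]) auto
  next
    fix y assume y: "y \<in> sphere x r"
    then have "norm (y - x) = r" by (simp add: dist_norm norm_minus_commute)
    then have i: "(y - x) \<bullet> (y - x) = r\<^sup>2" by (metis power2_norm_eq_inner)
    then have "?I y = y" unfolding inversion_def using r by simp
    then show "((y - x) \<bullet> (y - x)) / r\<^sup>2 * q (?I y) = q y" unfolding i using r by simp
  qed
  \<comment> \<open>The inverse point of \<open>y\<close> lies in the ball, at distance
    \<open>r^2/R\<close> from \<open>x\<close>; there the transform of \<open>q\<close> takes the
    value \<open>(r/R)^2 q y\<close>.\<close>
  define z where "z = ?I y"
  define R where "R = norm (y - x)"
  have R: "R > 0" "r \<le> R" using y r unfolding R_def by auto
  have yx: "y \<noteq> x" using R by (auto simp: R_def)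
  have zi: "(z - x) \<bullet> (z - x) = r\<^sup>2 * r\<^sup>2 / R\<^sup>2"
    unfolding z_def R_def power2_norm_eq_inner by (rule inversion_inner[OF yx, unfolded])
  have zy: "?I z = y" unfolding z_def by (rule II[OF yx])
  have zx: "z \<noteq> x" unfolding z_def by (rule Inx[OF yx])
  have "r\<^sup>2 * r\<^sup>2 / R\<^sup>2 \<le> r\<^sup>2"
  proof -
    have "r\<^sup>2 \<le> R\<^sup>2" using R r by (intro power_mono) auto
    then have "r\<^sup>2 * r\<^sup>2 \<le> r\<^sup>2 * R\<^sup>2" by (intro mult_left_mono) auto
    then show ?thesis using R by (simp add: divide_le_eq)
  qed
  then have "(norm (z - x))\<^sup>2 \<le> r\<^sup>2" unfolding power2_norm_eq_inner zi .
  then have "norm (z - x) \<le> r" by (rule power2_le_imp_le) (use r in simp)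
  moreover have "z \<noteq> s"
  proof
    assume "z = s"
    then have "y = 0" using zy II[of 0] x unfolding s_def by simp
    then show False using y by simp
  qed
  ultimately have "z \<in> cball x r - {x, s}" using zx by (simp add: dist_norm norm_minus_commute)
  from main[OF this] have qz: "(r / R)\<^sup>2 * q y \<le> q z"
    unfolding zy zi using r by (simp add: power_divide power2_eq_square field_simps)
  have z0: "z \<noteq> 0" using \<open>z \<in> cball x r - {x, s}\<close> r by (auto simp: dist_norm)
  define B where "B = (R / r) ^ (CARD('n) - 2) * u y"
  have B: "B > 0" unfolding B_def using R r u_pos[OF y(2)] by simp
  have "u z \<le> B"
  proof (rule ccontr)
    assume "\<not> u z \<le> B"
    then have "u z powr a < B powr a"
      using B m by (intro powr_less_mono2_neg) (auto simp: a_def divide_neg_pos)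
    also have "B powr a = (r / R)\<^sup>2 * q y"
    proof -
      have "real (CARD('n) - 2) = m" using n by (simp add: m_def of_nat_diff)
      then have "(R / r) ^ (CARD('n) - 2) = (R / r) powr m"
        using R r by (metis divide_pos_pos powr_realpow)
      then have "B powr a = (R / r) powr (m * a) * u y powr a"
        unfolding B_def using R r u_pos[OF y(2)] by (simp add: powr_mult powr_powr)
      also have "m * a = - 2" using m by (simp add: a_def)
      also have "(R / r) powr (- 2) = (r / R)\<^sup>2"
        using R r powr_realpow[of "R / r" 2] by (simp add: powr_minus power_divide inverse_eq_divide)
      finally show ?thesis by (simp add: q_def)
    qed
    finally show False using qz by (simp add: q_def)
  qed
  have "kelvin u x r y = (r / R) ^ (CARD('n) - 2) * u z"
    unfolding kelvin_def z_def inversion_def R_def power2_norm_eq_inner power_divide ..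
  also have "\<dots> \<le> (r / R) ^ (CARD('n) - 2) * B"
    using \<open>u z \<le> B\<close> r R by (intro mult_left_mono) auto
  also have "\<dots> = ((r / R) * (R / r)) ^ (CARD('n) - 2) * u y"
    unfolding B_def power_mult_distrib by simp
  also have "\<dots> = u y" using r R by simp
  finally show ?thesis .
qed

section \<open>Kelvin comparison and radial symmetry of the solution\<close>

theorem theorem1p5:
  fixes U :: "(real^'n^'n) set"
    and F :: "real^'n^'n \<Rightarrow> real"
    and u :: "real^'n \<Rightarrow> real"
  assumes dim: "3 \<le> CARD('n)"
    and U_convex: "convex U"
    and U_open: "sym_open U"
    and F_C1: "C1_on_sym U F"
    and F_C0: "continuous_on (closure U) F"
    and U_inv: "\<And>Q. orthogonal_matrix Q \<Longrightarrow> (\<lambda>M. matrix_inv Q ** M ** Q) ` U = U"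
    and U_add: "\<And>M N. M \<in> U \<Longrightarrow> pos_def N \<Longrightarrow> M + N \<in> U"
    and U_cone: "\<And>M a. M \<in> U \<Longrightarrow> 0 < a \<Longrightarrow> a *\<^sub>R M \<in> U"
    and U_id: "{a *\<^sub>R mat 1 | a. 0 < a} \<inter> sym_frontier U = {}"
    and F_inv: "\<And>M Q. M \<in> U \<Longrightarrow> orthogonal_matrix Q \<Longrightarrow> F (matrix_inv Q ** M ** Q) = F M"
    and F_elliptic: "\<And>M. M \<in> U \<Longrightarrow> pos_def (sym_gradient F M)"
    and F_pos: "\<And>M. M \<in> U \<Longrightarrow> 0 < F M"
    and F_zero: "\<And>M. M \<in> sym_frontier U \<Longrightarrow> F M = 0"
    and u_pos: "\<And>y. y \<noteq> 0 \<Longrightarrow> 0 < u y"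
    and u_C11: "C11_on (- {0}) u"
    and u_super: "laplacian_le_0_distr (- {0}) u"
    and u_eq: "AE y in lebesgue. y \<noteq> 0 \<longrightarrow> twice_differentiable_at u y \<and>
                 conf_hessian u y \<in> closure U \<and> F (conf_hessian u y) = 0"
  shows "(\<forall>x r y. x \<noteq> 0 \<and> 0 < r \<and> r < norm x \<and> r \<le> norm (y - x) \<and> y \<noteq> 0 \<longrightarrow>
            kelvin u x r y \<le> u y) \<and>
         (\<forall>y z. y \<noteq> 0 \<and> z \<noteq> 0 \<and> norm y = norm z \<longrightarrow> u y = u z)"
proof -
  obtain N where N: "N \<in> null_sets lebesgue"
    "{y \<in> space lebesgue. \<not> (y \<noteq> 0 \<longrightarrow> twice_differentiable_at u y \<and>
                 conf_hessian u y \<in> closure U \<and> F (conf_hessian u y) = 0)} \<subseteq> N"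
    using u_eq unfolding eventually_ae_filter by blast
  have negN: "negligible N" using N(1) by (simp add: negligible_iff_null_sets)
  \<comment> \<open>\<open>F\<close> is positive on \<open>U\<close>, so a zero of \<open>F\<close>
    in the closure lies outside \<open>U\<close>.\<close>
  have good: "twice_differentiable_at u y" "conf_hessian u y \<in> closure U - U" if "y \<noteq> 0" "y \<notin> N" for y
  proof -
    have y: "twice_differentiable_at u y" "conf_hessian u y \<in> closure U" "F (conf_hessian u y) = 0"
      using N(2) that by auto
    then show "twice_differentiable_at u y" "conf_hessian u y \<in> closure U - U" using F_pos by force+
  qed
  \<comment> \<open>A single point off the null set supplies a matrix in
    \<open>closure U - U\<close>, which is the properness required of the cone.\<close>
  have "\<exists>y. y \<noteq> 0 \<and> y \<notin> N"
  proof (rule ccontr)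
    assume "\<nexists>y. y \<noteq> 0 \<and> y \<notin> N"
    then have "- {0} \<subseteq> N" by auto
    then have "negligible (- {0 :: real^'n})" using negN negligible_subset by blast
    moreover have "axis undefined 1 \<in> - {0 :: real^'n}" by (simp add: axis_eq_0_iff)
    ultimately show False using open_not_negligible[of "- {0 :: real^'n}"] by auto
  qed
  then have proper: "\<not> closure U \<subseteq> U" using good by blast
  have U_sym: "U \<subseteq> sym_mats" using U_open openin_subset by fastforce
  have U_conj: "transpose Q ** M ** Q \<in> U" if "orthogonal_matrix Q" "M \<in> U" for Q M
    using U_inv[OF that(1)] that(2) unfolding matrix_inv_orthogonal[OF that(1)] by blast
  note cone = convex_cone_admissible[OF U_convex U_sym U_conj U_add U_cone proper]
  have kelvin: "kelvin u x r y \<le> u y"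
    if "x \<noteq> 0" "0 < r" "r < norm x" "r \<le> norm (y - x)" "y \<noteq> 0" for x r y
    by (rule kelvin_le[OF dim cone(1) cone(2) u_pos u_C11 negN _ _ that])
      (use good in \<open>auto simp: twice_differentiable_at_def\<close>)
  have cont: "isCont u y" if "y \<noteq> 0" for y
    using u_C11 that unfolding C11_on_def by (auto intro: differentiable_imp_continuous_within)
  have "u y = u z" if "norm y = norm z" for y z
    by (rule radial_of_kelvin_le[OF kelvin cont that])
  with kelvin show ?thesis by blast
qed

end
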